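(* If $N=1$ and $\mu_1,\mu_2,\rho>0$, then for every $\beta>0$ one has $-\infty<m_\beta(b_1,b_2)<0$ and $m_\beta(b_1,b_2)$ is achieved. In addition, any minimizing sequence for $m_\beta(b_1,b_2)$ is, up to translation, strongly convergent in $H^1(\mathbb{R})\times H^1(\mathbb{R})$ to a solution $(u,v)$ of $$\begin{cases}-\Delta u+\lambda_1u=\beta uv+\mu_1u^3+\rho v^2u & \text{in }\mathbb{R},\\ -\Delta v+\lambda_2v=\frac{\beta}{2}u^2+\mu_2v^3+\rho u^2v&\text{in }\mathbb{R},\end{cases}\qquad \int_{\mathbb{R}}u^2dx=b_1^2,\quad \int_{\mathbb{R}}v^2dx=b_2^2 .$$
   Context: Here $N$ is the space dimension and $b_1,b_2>0$ are prescribed constants. For $b\in\mathbb{R}$ let $\mathrm{T}_b=\{u\in H^1(\mathbb{R}):\int_{\mathbb{R}}u^2dx=b^2\}$. Define $$J_\beta(u,v)=\frac12\int_{\mathbb{R}}(|\nabla u|^2+|\nabla v|^2)dx-\frac14\int_{\mathbb{R}}(\mu_1u^4+\mu_2v^4+2\rho u^2v^2)dx-\frac{\beta}{2}\int_{\mathbb{R}}u^2v\,dx$$ and $m_\beta(b_1,b_2)=\inf_{(u,v)\in \mathrm{T}_{b_1}\times \mathrm{T}_{b_2}}J_\beta(u,v)$. A minimizing sequence for $m_\beta(b_1,b_2)$ is a sequence $(u_n,v_n)\in \mathrm{T}_{b_1}\times \mathrm{T}_{b_2}$ with $J_\beta(u_n,v_n)\to m_\beta(b_1,b_2)$; "up to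 translation" means after replacing $(u_n,v_n)$ by $(u_n(\cdot+y_n),v_n(\cdot+y_n))$ for some $y_n\in\mathbb{R}$. The frequencies $\lambda_1,\lambda_2\in\mathbb{R}$ in the system are unknown and appear as Lagrange multipliers: $(u,v)$ is a solution if the system and the mass constraints hold for some $\lambda_1,\lambda_2\in\mathbb{R}$.
   Formalization: "Strongly convergent up to translation" is stated up to translation and passing to a subsequence; for the full sequence it is false, since for a minimizer (u,v) the sequence ((-1)^n u, v) is minimizing but no translates of it converge. *)

theory Defs
  imports "HOL-Analysis.Analysis"
begin

text \<open>
  Elements of \<open>L\<^sup>2(\<real>)\<close> and \<open>H\<^sup>1(\<real>)\<close> are represented by Borel measurable real-valued functions;
  two representatives of the same class agree almost everywhere. Every class of Lebesgue measurable
  functions has a Borel representative, and all quantities below depend only on the class.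
\<close>

definition test_function :: "(real \<Rightarrow> real) \<Rightarrow> bool" where
  "test_function \<phi> \<longleftrightarrow>
     (\<forall>n x. (deriv ^^ n) \<phi> differentiable (at x)) \<and> compact (closure {x. \<phi> x \<noteq> 0})"

definition L2 :: "(real \<Rightarrow> real) set" where
  "L2 = {u. u \<in> borel_measurable lborel \<and> integrable lborel (\<lambda>x. (u x)\<^sup>2)}"

definition weak_derivative :: "(real \<Rightarrow> real) \<Rightarrow> (real \<Rightarrow> real) \<Rightarrow> bool" where
  "weak_derivative u g \<longleftrightarrow>
     (\<forall>\<phi>. test_function \<phi> \<longrightarrow>
        (LINT x|lborel. u x * deriv \<phi> x) = - (LINT x|lborel. g x * \<phi> x))"

definition H1 :: "(real \<Rightarrow> real) set" where
  "H1 = {u \<in> L2. \<exists>g \<in> L2. weak_derivative u g}"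

text \<open>The weak derivative is unique only up to null sets, so \<open>grad u\<close> is a chosen representative.\<close>

definition grad :: "(real \<Rightarrow> real) \<Rightarrow> real \<Rightarrow> real" where
  "grad u = (SOME g. g \<in> L2 \<and> weak_derivative u g)"

definition H1_norm :: "(real \<Rightarrow> real) \<Rightarrow> real" where
  "H1_norm u = sqrt ((LINT x|lborel. (u x)\<^sup>2) + (LINT x|lborel. (grad u x)\<^sup>2))"

definition H1_tendsto :: "(nat \<Rightarrow> real \<Rightarrow> real) \<Rightarrow> (real \<Rightarrow> real) \<Rightarrow> bool" where
  "H1_tendsto U u \<longleftrightarrow> (\<lambda>n. H1_norm (\<lambda>x. U n x - u x)) \<longlonglongrightarrow> 0"

definition T :: "real \<Rightarrow> (real \<Rightarrow> real) set" where
  "T b = {u \<in> H1. (LINT x|lborel. (u x)\<^sup>2) = b\<^sup>2}"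

definition J ::
  "real \<Rightarrow> real \<Rightarrow> real \<Rightarrow> real \<Rightarrow> (real \<Rightarrow> real) \<Rightarrow> (real \<Rightarrow> real) \<Rightarrow> real" where
  "J \<mu>\<^sub>1 \<mu>\<^sub>2 \<rho> \<beta> u v =
     1/2 * (LINT x|lborel. \<bar>grad u x\<bar>\<^sup>2 + \<bar>grad v x\<bar>\<^sup>2)
     - 1/4 * (LINT x|lborel. \<mu>\<^sub>1 * (u x)^4 + \<mu>\<^sub>2 * (v x)^4 + 2 * \<rho> * (u x)\<^sup>2 * (v x)\<^sup>2)
     - \<beta>/2 * (LINT x|lborel. (u x)\<^sup>2 * v x)"

text \<open>The infimum is taken in the extended reals, so that it is meaningful without presupposing
  boundedness from below.\<close>

definition m :: "real \<Rightarrow> real \<Rightarrow> real \<Rightarrow> real \<Rightarrow> real \<Rightarrow> real \<Rightarrow> ereal" where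
  "m \<mu>\<^sub>1 \<mu>\<^sub>2 \<rho> \<beta> b\<^sub>1 b\<^sub>2 = (INF (u, v) \<in> T b\<^sub>1 \<times> T b\<^sub>2. ereal (J \<mu>\<^sub>1 \<mu>\<^sub>2 \<rho> \<beta> u v))"

definition minimizing_sequence ::
  "real \<Rightarrow> real \<Rightarrow> real \<Rightarrow> real \<Rightarrow> real \<Rightarrow> real \<Rightarrow>
   (nat \<Rightarrow> real \<Rightarrow> real) \<Rightarrow> (nat \<Rightarrow> real \<Rightarrow> real) \<Rightarrow> bool" where
  "minimizing_sequence \<mu>\<^sub>1 \<mu>\<^sub>2 \<rho> \<beta> b\<^sub>1 b\<^sub>2 U V \<longleftrightarrow>
     (\<forall>n. U n \<in> T b\<^sub>1 \<and> V n \<in> T b\<^sub>2) \<and>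
     (\<lambda>n. ereal (J \<mu>\<^sub>1 \<mu>\<^sub>2 \<rho> \<beta> (U n) (V n))) \<longlonglongrightarrow> m \<mu>\<^sub>1 \<mu>\<^sub>2 \<rho> \<beta> b\<^sub>1 b\<^sub>2"

text \<open>\<open>weak_solution f l u\<close>: the function \<open>u \<in> H\<^sup>1(\<real>)\<close> solves \<open>-\<Delta>u + l u = f\<close> in the
  usual weak sense, tested against all of \<open>H\<^sup>1(\<real>)\<close>.\<close>

definition weak_solution :: "(real \<Rightarrow> real) \<Rightarrow> real \<Rightarrow> (real \<Rightarrow> real) \<Rightarrow> bool" where
  "weak_solution f l u \<longleftrightarrow> u \<in> H1 \<and>
     (\<forall>\<phi>\<in>H1. (LINT x|lborel. grad u x * grad \<phi> x) + l * (LINT x|lborel. u x * \<phi> x)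
              = (LINT x|lborel. f x * \<phi> x))"

definition is_solution ::
  "real \<Rightarrow> real \<Rightarrow> real \<Rightarrow> real \<Rightarrow> real \<Rightarrow> real \<Rightarrow> (real \<Rightarrow> real) \<Rightarrow> (real \<Rightarrow> real) \<Rightarrow> bool" where
  "is_solution \<mu>\<^sub>1 \<mu>\<^sub>2 \<rho> \<beta> b\<^sub>1 b\<^sub>2 u v \<longleftrightarrow>
     (\<exists>l\<^sub>1 l\<^sub>2.
        weak_solution (\<lambda>x. \<beta> * u x * v x + \<mu>\<^sub>1 * (u x)^3 + \<rho> * (v x)\<^sup>2 * u x) l\<^sub>1 u \<and>
        weak_solution (\<lambda>x. \<beta>/2 * (u x)\<^sup>2 + \<mu>\<^sub>2 * (v x)^3 + \<rho> * (u x)\<^sup>2 * v x) l\<^sub>2 v) \<and>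
     (LINT x|lborel. (u x)\<^sup>2) = b\<^sub>1\<^sup>2 \<and> (LINT x|lborel. (v x)\<^sup>2) = b\<^sub>2\<^sup>2"

end

theory Submission
  imports Defs "HOL-Complex_Analysis.Great_Picard" "HOL-Computational_Algebra.Polynomial"
begin

text \<open>
  The energy is coercive on the constraint because \<open>sup u\<^sup>2 \<le> 2 |u|\<^sup>2 / L + 2 L |u'|\<^sup>2\<close> for every
  \<open>L > 0\<close>, and its infimum is negative because spreading out a bump makes the quartic terms dominate
  the kinetic one. A minimizing sequence cannot vanish uniformly, so suitable translates of a
  subsequence converge pointwise to some \<open>(U, V) \<noteq> 0\<close>, and energy and masses split
  asymptotically into those of \<open>(U, V)\<close> and of the remainder \<open>(w, z)\<close>.

  Suppose that the remainder keeps a positive amount of mass. The quadratic mean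
  \<open>sqrt (u\<^sup>2 + w\<^sup>2)\<close> adds masses, does not increase the sum of the kinetic energies, and gains at least
  a multiple of the integral of \<open>(U\<^sup>2 + V\<^sup>2) (w\<^sup>2 + z\<^sup>2)\<close> in the potential energy, which after
  translating the remainder is bounded below unless \<open>(w, z)\<close> tends to \<open>0\<close> uniformly. In that case
  the energy of \<open>(U, V)\<close> is already at most the infimum, and one merges \<open>(U, V)\<close> with a wide bump of
  negative energy carrying the missing mass instead. Either way the infimum is undercut. Hence no mass
  is lost, the convergence is strong, and differentiating the energy along normalised variations of
  the minimizer gives the system.
\<close>

section \<open>Test functions\<close>

text \<open>The definitions supply only weak derivatives, and \<open>grad\<close> is an arbitrary
  representative. The analysis therefore runs on pairs \<open>AC u g\<close> of a continuous
  function and an explicit derivative, and returns to \<open>H1\<close> only at the end. Such pairs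
  are recognised by dyadic energies, finite sums of squared increments: these pass to pointwise
  limits and can be compared term by term when two functions are merged. They stand in for weak
  compactness, lower semicontinuity of the kinetic energy and a chain rule for the square root. Two
  masses are prescribed at once, and they may be lost in any proportion. The quadratic mean adds
  both, even if one component loses nothing. Its gain involves all four products of squares, because
  both self-interactions and the coupling \<open>\<rho>\<close> are attractive; so it persists when
  the limit lives in one component and the remainder in the other. The merged pairs built from a
  remainder have the right masses only asymptotically, so the lower bound given by the infimum has
  to be carried to nearby masses by rescaling.\<close>

text \<open>The factor \<open>poly p x * (1 / q x) ^ k\<close> makes the family closed under differentiation.\<close>

definition bump :: "real \<Rightarrow> real \<Rightarrow> real \<Rightarrow> real poly \<Rightarrow> nat \<Rightarrow> real \<Rightarrow> real" where
  "bump a b c p k x = (if a < x \<and> x < b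
     then poly p x * (1 / ((x - a) * (b - x))) ^ k * exp (- c / ((x - a) * (b - x))) else 0)"

text \<open>From \<open>(1 + x / n) ^ n \<le> exp x\<close> at \<open>x = c * y\<close>: the
  exponential absorbs any power of \<open>y\<close>, with an explicit constant.\<close>

lemma pow_times_exp_le:
  fixes y c :: real
  assumes "y \<ge> 0" "c > 0"
  shows "y ^ Suc n * exp (- c * y) \<le> (real (Suc n) / c) ^ Suc n"
proof -
  let ?n = "Suc n"
  have "c * y / real ?n \<le> 1 + c * y / real ?n" by simp
  then have "(c * y / real ?n) ^ ?n \<le> (1 + c * y / real ?n) ^ ?n"
    using assms by (intro power_mono) auto
  also have "\<dots> \<le> exp (c * y)"
    using assms by (intro exp_ge_one_plus_x_over_n_power_n) (auto intro: order_trans[of _ 0])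
  finally have "(c * y / real ?n) ^ ?n * exp (- c * y) \<le> exp (c * y) * exp (- c * y)"
    by (intro mult_right_mono) auto
  also have "\<dots> = 1" by (simp add: exp_minus)
  finally have "(c / real ?n) ^ ?n * (y ^ ?n * exp (- c * y)) \<le> 1"
    by (simp add: power_mult_distrib power_divide mult_ac)
  then have "(real ?n / c) ^ ?n * ((c / real ?n) ^ ?n * (y ^ ?n * exp (- c * y))) \<le> (real ?n / c) ^ ?n * 1"
    using assms by (intro mult_left_mono) auto
  then have "((real ?n / c) ^ ?n * (c / real ?n) ^ ?n) * (y ^ ?n * exp (- c * y)) \<le> (real ?n / c) ^ ?n"
    by (simp only: mult.assoc mult_1_right)
  moreover have "(real ?n / c) ^ ?n * (c / real ?n) ^ ?n = 1"
    unfolding power_mult_distrib[symmetric] using assms by simp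
  ultimately show ?thesis by simp
qed

text \<open>The exponential absorbs all factors \<open>1 / q\<close>, where \<open>q\<close> is the
  product of the distances to the end points, and leaves two powers of \<open>q\<close> to spare.
  This is what makes the derivative vanish at \<open>a\<close> and \<open>b\<close>.\<close>

lemma bump_quadratic_bound:
  assumes "a < b" "c > 0"
  obtains C where "C \<ge> 0" "\<And>x. a < x \<Longrightarrow> x < b \<Longrightarrow> \<bar>bump a b c p k x\<bar> \<le> C * ((x - a) * (b - x))\<^sup>2"
proof -
  have "compact (poly p ` {a..b})"
    by (intro compact_continuous_image continuous_intros) auto
  then obtain B where B: "\<And>x. x \<in> {a..b} \<Longrightarrow> \<bar>poly p x\<bar> \<le> B"
    by (metis bounded_real compact_imp_bounded imageI)
  then have B0: "B \<ge> 0" using assms(1) by (metis abs_ge_zero atLeastAtMost_iff less_le order_trans order_refl)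
  \<comment> \<open>Exponent \<open>k + 2\<close>, two more than the pole has; the surplus becomes
    the factor \<open>q\<^sup>2\<close>.\<close>
  define D where "D = (real (Suc (Suc k)) / c) ^ Suc (Suc k)"
  have D0: "D \<ge> 0" unfolding D_def using assms by simp
  show ?thesis
  proof (rule that[of "B * D"])
    show "B * D \<ge> 0" using B0 D0 by simp
    fix x assume x: "a < x" "x < b"
    define q where "q = (x - a) * (b - x)"
    have q: "q > 0" using x by (simp add: q_def)
    have *: "(1 / q) ^ Suc (Suc k) * exp (- c * (1 / q)) \<le> D"
      unfolding D_def using q assms by (intro pow_times_exp_le) auto
    have "(1 / q) ^ k * exp (- c / q) = q\<^sup>2 * ((1 / q) ^ Suc (Suc k) * exp (- c * (1 / q)))"
      using q by (simp add: field_simps power2_eq_square)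
    also have "\<dots> \<le> q\<^sup>2 * D" using * by (intro mult_left_mono) auto
    finally have 1: "(1 / q) ^ k * exp (- c / q) \<le> D * q\<^sup>2" by (simp add: mult.commute)
    have "\<bar>bump a b c p k x\<bar> = \<bar>poly p x\<bar> * ((1 / q) ^ k * exp (- c / q))"
      using x q by (simp add: bump_def q_def abs_mult)
    also have "\<dots> \<le> B * (D * q\<^sup>2)"
      by (rule mult_mono[OF B[of x] 1]) (use x q B0 in auto)
    finally show "\<bar>bump a b c p k x\<bar> \<le> B * D * ((x - a) * (b - x))\<^sup>2" by (simp add: q_def mult.assoc)
  qed
qed

lemma DERIV_zero_quadratic:
  fixes f :: "real \<Rightarrow> real"
  assumes "\<And>x. \<bar>f x\<bar> \<le> C * (x - a)\<^sup>2"
  shows "(f has_real_derivative 0) (at a)"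
proof -
  have fa: "f a = 0" using assms[of a] by simp
  have "((\<lambda>y. f y / (y - a)) \<longlongrightarrow> 0) (at a)"
  proof (rule Lim_null_comparison)
    show "((\<lambda>y. C * \<bar>y - a\<bar>) \<longlongrightarrow> 0) (at a)" by (auto intro!: tendsto_eq_intros)
    have "norm (f y / (y - a)) \<le> C * \<bar>y - a\<bar>" if "y \<noteq> a" for y
      using assms[of y] that by (simp add: field_simps power2_eq_square)
    then show "\<forall>\<^sub>F y in at a. norm (f y / (y - a)) \<le> C * \<bar>y - a\<bar>"
      by (auto simp: eventually_at_filter)
  qed
  then show ?thesis by (simp add: has_field_derivative_iff fa)
qed

text \<open>Inside the interval, \<open>p'\<close> is the numerator that the product rule leaves
  over the common denominator \<open>q ^ (k + 2)\<close>. Outside it, end points included, the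
  function is squeezed by a quadratic.\<close>

lemma DERIV_bump:
  fixes a b c :: real and p :: "real poly" and k :: nat
  assumes ab: "a < b" and c: "c > 0"
  defines "q \<equiv> [:- a, 1:] * [:b, - 1:]"
  defines "p' \<equiv> pderiv p * q\<^sup>2 - of_nat k * p * q * pderiv q + [:c:] * p * pderiv q"
  shows "(bump a b c p k has_real_derivative bump a b c p' (k + 2) x) (at x)"
proof (cases "a < x \<and> x < b")
  case True
  have qx: "poly q y = (y - a) * (b - y)" for y by (simp add: q_def algebra_simps)
  have qpos: "poly q x > 0" using True by (simp add: qx)
  define f where "f = (\<lambda>y. poly p y * (1 / poly q y) ^ k * exp (- c / poly q y))"
  have f: "(f has_real_derivative bump a b c p' (k + 2) x) (at x)"
  proof -
    \<comment> \<open>At \<open>k = 0\<close> the subtraction in the exponent is truncated, but then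
      the factor \<open>real k\<close> vanishes.\<close>
    have eq: "real k * (1 / poly q x) ^ (k - Suc 0) = real k * (1 / poly q x) ^ k * poly q x"
      using qpos by (cases k) auto
    have D1: "((\<lambda>y. 1 / poly q y) has_real_derivative - poly (pderiv q) x / (poly q x)\<^sup>2) (at x)"
      using qpos by (auto intro!: derivative_eq_intros poly_DERIV simp: power2_eq_square)
    have D2: "((\<lambda>y. (1 / poly q y) ^ k) has_real_derivative
        (real k * (1 / poly q x) ^ (k - Suc 0)) * (- poly (pderiv q) x / (poly q x)\<^sup>2)) (at x)"
      using DERIV_power[OF D1, of k] by (simp add: mult_ac)
    have D3: "((\<lambda>y. exp (- c / poly q y)) has_real_derivative
        exp (- c / poly q x) * (c * poly (pderiv q) x / (poly q x)\<^sup>2)) (at x)"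
      using qpos by (auto intro!: derivative_eq_intros poly_DERIV simp: power2_eq_square)
    have "(f has_real_derivative
      (poly (pderiv p) x * (1 / poly q x) ^ k
        + (real k * (1 / poly q x) ^ (k - Suc 0)) * (- poly (pderiv q) x / (poly q x)\<^sup>2) * poly p x) * exp (- c / poly q x)
        + exp (- c / poly q x) * (c * poly (pderiv q) x / (poly q x)\<^sup>2) * (poly p x * (1 / poly q x) ^ k)) (at x)"
      unfolding f_def by (rule DERIV_mult[OF DERIV_mult[OF poly_DERIV D2] D3])
    also have "(poly (pderiv p) x * (1 / poly q x) ^ k
        + (real k * (1 / poly q x) ^ (k - Suc 0)) * (- poly (pderiv q) x / (poly q x)\<^sup>2) * poly p x) * exp (- c / poly q x)
        + exp (- c / poly q x) * (c * poly (pderiv q) x / (poly q x)\<^sup>2) * (poly p x * (1 / poly q x) ^ k)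
      = (poly (pderiv p) x * (poly q x)\<^sup>2 - real k * poly p x * poly q x * poly (pderiv q) x + c * poly p x * poly (pderiv q) x)
         * (1 / poly q x) ^ (k + 2) * exp (- c / poly q x)"
      unfolding eq using qpos by (simp add: field_simps power2_eq_square)
    also have "\<dots> = bump a b c p' (k + 2) x"
      using True by (simp add: bump_def p'_def qx of_nat_poly)
    finally show ?thesis .
  qed
  show ?thesis
  proof (rule has_field_derivative_transform_within_open[OF f, of "{a<..<b}"])
    show "f y = bump a b c p k y" if "y \<in> {a<..<b}" for y
      using that by (simp add: f_def bump_def qx)
  qed (use True in auto)
next
  case False
  obtain C where C: "C \<ge> 0" "\<And>x. a < x \<Longrightarrow> x < b \<Longrightarrow> \<bar>bump a b c p k x\<bar> \<le> C * ((x - a) * (b - x))\<^sup>2"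
    using bump_quadratic_bound[OF ab c] by blast
  \<comment> \<open>For \<open>y\<close> in the interval, the distance from \<open>y\<close> to the
    end nearer to \<open>x\<close> is at most \<open>\<bar>y - x\<bar>\<close>, and the distance to
    the other end is at most \<open>b - a\<close>.\<close>
  have "\<bar>bump a b c p k y\<bar> \<le> (C * (b - a)\<^sup>2) * (y - x)\<^sup>2" for y
  proof (cases "a < y \<and> y < b")
    case y: True
    have "(y - a) * (b - y) \<le> \<bar>y - x\<bar> * (b - a)"
    proof (cases "x \<le> a")
      case True
      then show ?thesis using y by (intro mult_mono) auto
    next
      case xa: False
      then have "(b - y) * (y - a) \<le> \<bar>y - x\<bar> * (b - a)"
        using y False by (intro mult_mono) auto
      then show ?thesis by (simp add: mult.commute)
    qed
    then have "((y - a) * (b - y))\<^sup>2 \<le> (\<bar>y - x\<bar> * (b - a))\<^sup>2"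
      using y by (intro power_mono) auto
    then have "C * ((y - a) * (b - y))\<^sup>2 \<le> C * ((b - a)\<^sup>2 * (y - x)\<^sup>2)"
      using C(1) by (intro mult_left_mono) (auto simp: power_mult_distrib mult.commute)
    then show ?thesis using C(2)[of y] y by (auto simp: mult.assoc)
  next
    case False
    then show ?thesis using C(1) by (auto simp: bump_def)
  qed
  then have "(bump a b c p k has_real_derivative 0) (at x)" by (rule DERIV_zero_quadratic)
  moreover have "bump a b c p' (k + 2) x = 0" using False by (auto simp: bump_def)
  ultimately show ?thesis by simp
qed

lemma higher_deriv_bump:
  assumes "a < b" "c > 0"
  shows "\<exists>p' k'. (deriv ^^ n) (bump a b c p k) = bump a b c p' k'"
proof (induction n)
  case (Suc n)
  then obtain p' k' where "(deriv ^^ n) (bump a b c p k) = bump a b c p' k'" by blast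
  then have "(deriv ^^ Suc n) (bump a b c p k) = deriv (bump a b c p' k')" by simp
  also obtain q where "deriv (bump a b c p' k') = bump a b c q (k' + 2)"
    using DERIV_bump[OF assms, of p' k'] by (blast intro: DERIV_imp_deriv)
  finally show ?case by blast
qed auto

section \<open>General properties of test functions\<close>

lemma test_functionI:
  assumes "\<And>n x. (deriv ^^ n) \<phi> differentiable (at x)" "\<And>x. x \<notin> {A..B} \<Longrightarrow> \<phi> x = 0"
  shows "test_function \<phi>"
proof -
  have "closure {x. \<phi> x \<noteq> 0} \<subseteq> {A..B}"
    using assms(2) by (intro closure_minimal subsetI CollectI closed_atLeastAtMost) blast
  then have "compact (closure {x. \<phi> x \<noteq> 0})"
    by (metis bounded_closed_interval bounded_subset closed_closure compact_eq_bounded_closed)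
  then show ?thesis using assms(1) by (simp add: test_function_def)
qed

lemma test_function_bounded_support:
  assumes "test_function \<phi>"
  obtains A B where "A < B" "\<And>x. x \<notin> {A..B} \<Longrightarrow> \<phi> x = 0"
proof -
  have "bounded {x. \<phi> x \<noteq> 0}"
    using assms unfolding test_function_def by (meson bounded_subset closure_subset compact_imp_bounded)
  then obtain M where "\<And>x. \<phi> x \<noteq> 0 \<Longrightarrow> \<bar>x\<bar> \<le> M" by (auto simp: bounded_iff)
  then have "\<phi> x = 0" if "x \<notin> {- \<bar>M\<bar> - 1..\<bar>M\<bar> + 1}" for x
    using that by (force simp: abs_le_iff)
  then show ?thesis by (intro that[of "- \<bar>M\<bar> - 1" "\<bar>M\<bar> + 1"]) linarith+
qed

lemma deriv_zero_outside:
  fixes \<phi> :: "real \<Rightarrow> real"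
  assumes "\<And>x. x \<notin> {A..B} \<Longrightarrow> \<phi> x = 0" "x \<notin> {A..B}"
  shows "deriv \<phi> x = 0"
proof -
  have "(\<phi> has_real_derivative 0) (at x)"
    by (rule has_field_derivative_transform_within_open[of "\<lambda>_. 0" _ _ "- {A..B}"])
      (use assms in auto)
  then show ?thesis by (rule DERIV_imp_deriv)
qed

lemma test_function_DERIV:
  assumes "test_function \<phi>"
  shows "(\<phi> has_real_derivative deriv \<phi> x) (at x)"
proof -
  have "(deriv ^^ 0) \<phi> differentiable (at x)" using assms unfolding test_function_def by blast
  then show ?thesis by (simp add: DERIV_deriv_iff_real_differentiable)
qed

lemma test_function_continuous_deriv:
  assumes "test_function \<phi>"
  shows "continuous_on A (deriv \<phi>)"
proof -
  have "(deriv ^^ 1) \<phi> differentiable (at x)" for x using assms unfolding test_function_def by blast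
  then show ?thesis
    by (auto intro!: continuous_at_imp_continuous_on differentiable_imp_continuous_within)
qed

lemma test_function_continuous:
  assumes "test_function \<phi>"
  shows "continuous_on A \<phi>"
  using test_function_DERIV[OF assms] by (meson DERIV_isCont continuous_at_imp_continuous_on)

lemma test_function_bump:
  assumes "a < b" "c > 0"
  shows "test_function (bump a b c p k)"
proof (rule test_functionI[of _ a b])
  fix n x
  obtain p' k' where "(deriv ^^ n) (bump a b c p k) = bump a b c p' k'"
    using higher_deriv_bump[OF assms] by blast
  then show "(deriv ^^ n) (bump a b c p k) differentiable (at x)"
    using DERIV_bump[OF assms] by (auto simp: real_differentiable_def)
qed (auto simp: bump_def)

lemma higher_deriv_linear:
  fixes f g :: "real \<Rightarrow> real"
  assumes "\<And>n x. (deriv ^^ n) f differentiable (at x)" "\<And>n x. (deriv ^^ n) g differentiable (at x)"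
  shows "(deriv ^^ n) (\<lambda>x. f x + c * g x) = (\<lambda>x. (deriv ^^ n) f x + c * (deriv ^^ n) g x)"
proof (induction n)
  case (Suc n)
  have "deriv (\<lambda>x. (deriv ^^ n) f x + c * (deriv ^^ n) g x) x
     = deriv ((deriv ^^ n) f) x + c * deriv ((deriv ^^ n) g) x" for x
    using assms by (intro DERIV_imp_deriv DERIV_add DERIV_cmult)
      (simp_all add: DERIV_deriv_iff_real_differentiable)
  then show ?case using Suc by auto
qed auto

lemma test_function_linear:
  assumes f: "test_function f" and g: "test_function g"
  shows "test_function (\<lambda>x. f x + c * g x)"
proof -
  have df: "\<And>n x. (deriv ^^ n) f differentiable (at x)" and dg: "\<And>n x. (deriv ^^ n) g differentiable (at x)"
    using f g by (auto simp: test_function_def)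
  obtain A B where AB: "\<And>x. x \<notin> {A..B} \<Longrightarrow> f x = 0" using test_function_bounded_support[OF f] by blast
  obtain A' B' where AB': "\<And>x. x \<notin> {A'..B'} \<Longrightarrow> g x = 0" using test_function_bounded_support[OF g] by blast
  show ?thesis
  proof (rule test_functionI[of _ "min A A'" "max B B'"])
    fix n x
    show "(deriv ^^ n) (\<lambda>x. f x + c * g x) differentiable (at x)"
      unfolding higher_deriv_linear[OF df dg] using df dg by (intro derivative_intros) auto
  next
    fix x assume "x \<notin> {min A A'..max B B'}"
    then have "x \<notin> {A..B}" "x \<notin> {A'..B'}" by auto
    then show "f x + c * g x = 0" using AB AB' by simp
  qed
qed

lemma test_function_integrable:
  assumes "test_function \<phi>"
  shows "integrable lborel \<phi>"
proof -
  obtain A B where AB: "A < B" "\<And>x. x \<notin> {A..B} \<Longrightarrow> \<phi> x = 0"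
    using test_function_bounded_support[OF assms] by blast
  have "integrable lborel (\<lambda>x. indicator {A..B} x *\<^sub>R \<phi> x)"
    using test_function_continuous[OF assms] by (intro borel_integrable_compact) auto
  moreover have "(\<lambda>x. indicator {A..B} x *\<^sub>R \<phi> x) = \<phi>"
    using AB(2) by (intro ext) (metis indicator_simps mult_zero_left real_scaleR_def scaleR_one)
  ultimately show ?thesis by simp
qed

text \<open>The antiderivative normalised at \<open>A\<close> is 0 to the left of the support. To
  the right it is constant, and this constant is the total integral, which vanishes.\<close>

lemma test_function_primitive:
  assumes \<eta>: "test_function \<eta>" and int0: "(LINT x|lborel. \<eta> x) = 0"
  obtains \<Phi> where "test_function \<Phi>" "deriv \<Phi> = \<eta>"
proof -
  obtain A B where AB: "A < B" "\<And>x. x \<notin> {A..B} \<Longrightarrow> \<eta> x = 0"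
    using test_function_bounded_support[OF \<eta>] by blast
  have ct: "isCont \<eta> x" for x using test_function_DERIV[OF \<eta>] by (meson DERIV_isCont)
  obtain F where F: "\<And>x. (F has_vector_derivative \<eta> x) (at x)"
    using einterval_antiderivative[of "-\<infinity>" "\<infinity>" \<eta>] ct by auto
  then have DF: "\<And>x. (F has_real_derivative \<eta> x) (at x)"
    by (simp add: has_real_derivative_iff_has_vector_derivative)
  define \<Phi> where "\<Phi> = (\<lambda>x. F x - F A)"
  have D: "(\<Phi> has_real_derivative \<eta> x) (at x)" for x
    unfolding \<Phi>_def by (auto intro!: derivative_eq_intros DF)
  then have dPhi: "deriv \<Phi> = \<eta>" using DERIV_imp_deriv by blast
  have left: "\<Phi> x = 0" if "x < A" for x
  proof -
    have "\<exists>z. z > x \<and> z < A \<and> \<Phi> A - \<Phi> x = (A - x) * \<eta> z"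
      using that D by (intro MVT2) auto
    then show ?thesis using AB(2) by (auto simp: \<Phi>_def)
  qed
  have "(LINT x|lborel. \<eta> x * indicator {A..B} x) = F B - F A"
    using AB(1) DF ct by (intro integral_FTC_Icc_real) auto
  moreover have "(\<lambda>x. \<eta> x * indicator {A..B} x) = \<eta>"
    using AB(2) by (intro ext) (metis indicator_simps mult_zero_left mult.right_neutral)
  ultimately have FB: "\<Phi> B = 0" using int0 by (simp add: \<Phi>_def)
  have right: "\<Phi> x = 0" if "x > B" for x
  proof -
    have "\<exists>z. z > B \<and> z < x \<and> \<Phi> x - \<Phi> B = (x - B) * \<eta> z"
      using that D by (intro MVT2) auto
    then show ?thesis using AB(2) FB by auto
  qed
  have "test_function \<Phi>"
  proof (rule test_functionI[of _ A B])
    fix n x show "(deriv ^^ n) \<Phi> differentiable (at x)"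
    proof (cases n)
      case 0 then show ?thesis using D real_differentiable_def by auto
    next
      case (Suc k)
      then show ?thesis using \<eta> by (simp add: funpow_Suc_right dPhi test_function_def del: funpow.simps)
    qed
  next
    fix x assume "x \<notin> {A..B}"
    then show "\<Phi> x = 0" using left right by force
  qed
  then show ?thesis using dPhi that by blast
qed

section \<open>The fundamental lemma of the calculus of variations\<close>

definition loc_integrable :: "(real \<Rightarrow> real) \<Rightarrow> bool" where
  "loc_integrable f \<longleftrightarrow> f \<in> borel_measurable borel \<and> (\<forall>a b. set_integrable lborel {a..b} f)"

lemma loc_integrable_subset:
  assumes "loc_integrable f" "S \<subseteq> {a..b}" "S \<in> sets borel"
  shows "set_integrable lborel S f"
  using assms unfolding loc_integrable_def by (metis set_integrable_subset sets_lborel)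

text \<open>Positive and negative part of \<open>f\<close>, taken as densities, define measures that
  agree on half-lines and hence coincide; densities are unique almost everywhere.\<close>

lemma AE_zero_if_interval_integrals_zero:
  assumes f: "loc_integrable f" and zero: "\<And>a b. a < b \<Longrightarrow> (LINT x:{a<..<b}|lborel. f x) = 0"
  shows "AE x in lborel. f x = 0"
proof -
  have [measurable]: "f \<in> borel_measurable borel" using f by (simp add: loc_integrable_def)
  \<comment> \<open>The cut-off to a bounded interval makes both measures finite.\<close>
  have "AE x in lborel. f x * indicator {- real n<..<real n} x = 0" for n
  proof -
    define g where "g = (\<lambda>x. f x * indicator {- real n<..<real n} x)"
    have gm[measurable]: "g \<in> borel_measurable borel" unfolding g_def by measurable
    have "set_integrable lborel {- real n<..<real n} f"
      by (rule loc_integrable_subset[OF f, of _ "- real n" "real n"]) auto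
    then have gi: "integrable lborel g" by (simp add: g_def set_integrable_def mult.commute)
    define P where "P = (\<lambda>x. max 0 (g x))"
    define N where "N = (\<lambda>x. max 0 (- g x))"
    have [measurable]: "P \<in> borel_measurable borel" "N \<in> borel_measurable borel"
      unfolding P_def N_def by measurable
    have Pi: "integrable lborel P" and Ni: "integrable lborel N"
      unfolding P_def N_def using gi by auto
    have int: "(LINT y|lborel. g y * indicator {x<..} y) = 0" for x
    proof -
      have "(LINT y|lborel. g y * indicator {x<..} y) = (LINT y:{max x (- real n)<..<real n}|lborel. f y)"
        unfolding set_lebesgue_integral_def
        by (rule Bochner_Integration.integral_cong) (auto simp: g_def indicator_def)
      also have "\<dots> = 0"
      proof (cases "max x (- real n) < real n")
        case True then show ?thesis by (rule zero)
      next
        case False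
        then have "{max x (- real n)<..<real n} = {}" by (intro greaterThanLessThan_empty) linarith
        then show ?thesis by (simp only: set_lebesgue_integral_def) simp
      qed
      finally show ?thesis .
    qed
    have em: "emeasure (density lborel (\<lambda>y. ennreal (Q y))) {x<..} = ennreal (LINT y|lborel. Q y * indicator {x<..} y)"
      if [measurable]: "Q \<in> borel_measurable borel" and Qi: "integrable lborel Q" and Q0: "\<And>y. Q y \<ge> 0" for Q :: "real \<Rightarrow> real" and x
    proof -
      have "emeasure (density lborel (\<lambda>y. ennreal (Q y))) {x<..} = (\<integral>\<^sup>+ y. ennreal (Q y * indicator {x<..} y) \<partial>lborel)"
        by (simp add: emeasure_density) (intro nn_integral_cong, auto simp: indicator_def)
      also have "\<dots> = ennreal (LINT y|lborel. Q y * indicator {x<..} y)"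
        using Q0 Qi by (intro nn_integral_eq_integral integrable_real_mult_indicator) auto
      finally show ?thesis .
    qed
    have "density lborel (\<lambda>y. ennreal (P y)) = density lborel (\<lambda>y. ennreal (N y))"
    proof (rule measure_eqI_lessThan)
      fix x
      have eq: "P y * indicator {x<..} y - N y * indicator {x<..} y = g y * indicator {x<..} y" for y
        by (auto simp: P_def N_def indicator_def)
      have "(LINT y|lborel. P y * indicator {x<..} y) - (LINT y|lborel. N y * indicator {x<..} y)
          = (LINT y|lborel. P y * indicator {x<..} y - N y * indicator {x<..} y)"
        by (rule Bochner_Integration.integral_diff[symmetric])
           (use Pi Ni in \<open>auto intro: integrable_real_mult_indicator\<close>)
      also have "\<dots> = 0" unfolding eq using int[of x] by simp
      finally have "(LINT y|lborel. P y * indicator {x<..} y) = (LINT y|lborel. N y * indicator {x<..} y)" by simp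
      then show "emeasure (density lborel (\<lambda>y. ennreal (P y))) {x<..} = emeasure (density lborel (\<lambda>y. ennreal (N y))) {x<..}"
        using em[of P x] em[of N x] Pi Ni by (auto simp: P_def N_def)
      show "emeasure (density lborel (\<lambda>y. ennreal (P y))) {x<..} < \<infinity>"
        using em[of P x] Pi by (auto simp: P_def)
    qed auto
    then have "AE x in lborel. ennreal (P x) = ennreal (N x)"
      by (subst (asm) sigma_finite_measure.density_unique_iff[OF lborel.sigma_finite_measure_axioms]) auto
    then have "AE x in lborel. g x = 0"
      by eventually_elim (auto simp: P_def N_def max_def split: if_splits)
    then show ?thesis by (simp only: g_def)
  qed
  then have "AE x in lborel. \<forall>n. f x * indicator {- real n<..<real n} x = 0"
    by (subst AE_all_countable) auto
  then show ?thesis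
  proof eventually_elim
    case (elim x)
    obtain n where "\<bar>x\<bar> < real n" using reals_Archimedean2 by blast
    then show ?case using elim[rule_format, of n] by (auto simp: indicator_def abs_less_iff)
  qed
qed

lemma loc_integrable_mult_test:
  assumes f: "loc_integrable f" and \<phi>: "continuous_on UNIV \<phi>" "\<And>x. x \<notin> {A..B} \<Longrightarrow> \<phi> x = 0"
  shows "integrable lborel (\<lambda>x. f x * \<phi> x)"
proof -
  have [measurable]: "\<phi> \<in> borel_measurable borel" "f \<in> borel_measurable borel"
    using f \<phi> by (auto simp: loc_integrable_def borel_measurable_continuous_onI)
  have "compact (\<phi> ` {A..B})"
    using \<phi>(1) continuous_on_subset by (intro compact_continuous_image) auto
  then obtain C where C: "\<And>x. x \<in> {A..B} \<Longrightarrow> \<bar>\<phi> x\<bar> \<le> C"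
    by (metis bounded_real compact_imp_bounded imageI)
  show ?thesis
  proof (rule Bochner_Integration.integrable_bound)
    have "set_integrable lborel {A..B} f" using f by (simp add: loc_integrable_def)
    then show "integrable lborel (\<lambda>x. C * (indicator {A..B} x * f x))" by (simp add: set_integrable_def)
    have "norm (f x * \<phi> x) \<le> norm (C * (indicator {A..B} x * f x))" for x
    proof (cases "x \<in> {A..B}")
      case True
      then have "\<bar>\<phi> x\<bar> * \<bar>f x\<bar> \<le> \<bar>C\<bar> * \<bar>f x\<bar>" using C[OF True] by (intro mult_right_mono) auto
      then show ?thesis using True by (simp add: abs_mult mult.commute)
    qed (simp add: \<phi>)
    then show "AE x in lborel. norm (f x * \<phi> x) \<le> norm (C * (indicator {A..B} x * f x))" by simp
  qed auto
qed

lemma integrable_mult_test_function: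
  assumes "loc_integrable f" "test_function \<phi>"
  shows "integrable lborel (\<lambda>x. f x * \<phi> x)"
  using test_function_bounded_support[OF assms(2)] loc_integrable_mult_test[OF assms(1)]
    test_function_continuous[OF assms(2)] by metis

lemma bump_tendsto_indicator:
  "(\<lambda>n. bump a b (1 / real (Suc n)) 1 0 x) \<longlonglongrightarrow> indicator {a<..<b} x"
proof (cases "a < x \<and> x < b")
  case True
  have "(\<lambda>n. exp (- (1 / real (Suc n)) / ((x - a) * (b - x)))) \<longlonglongrightarrow> exp (- 0 / ((x - a) * (b - x)))"
    using True by (intro tendsto_intros LIMSEQ_Suc lim_1_over_n) auto
  then show ?thesis using True by (simp add: bump_def)
qed (auto simp: bump_def)

lemma bump_bounds:
  assumes "c > 0"
  shows "0 \<le> bump a b c 1 0 x" "bump a b c 1 0 x \<le> indicator {a<..<b} x"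
  using assms by (auto simp: bump_def)

text \<open>For \<open>c\<close> decreasing to 0 the bumps \<open>bump a b c 1 0\<close> increase to
  the indicator of the open interval, so dominated convergence applies.\<close>

lemma interval_integral_eq_if_test_integrals_eq:
  assumes f: "loc_integrable f" and "a < b"
    and eq: "\<And>\<phi>. test_function \<phi> \<Longrightarrow> (LINT x|lborel. f x * \<phi> x) = 0"
  shows "(LINT x:{a<..<b}|lborel. f x) = 0"
proof -
  have [measurable]: "f \<in> borel_measurable borel" using f by (simp add: loc_integrable_def)
  let ?\<eta> = "\<lambda>n. bump a b (1 / real (Suc n)) 1 0"
  have tf: "test_function (?\<eta> n)" for n using assms by (intro test_function_bump) auto
  have [measurable]: "?\<eta> n \<in> borel_measurable borel" for n
    using test_function_continuous[OF tf] by (intro borel_measurable_continuous_onI)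
  have "(\<lambda>n. LINT x|lborel. f x * ?\<eta> n x) \<longlonglongrightarrow> (LINT x|lborel. f x * indicator {a<..<b} x)"
  proof (rule integral_dominated_convergence)
    have "set_integrable lborel {a..b} f" using f by (simp add: loc_integrable_def)
    then show "integrable lborel (\<lambda>x. \<bar>indicator {a..b} x * f x\<bar>)" by (simp add: set_integrable_def)
    show "AE x in lborel. (\<lambda>n. f x * ?\<eta> n x) \<longlonglongrightarrow> f x * indicator {a<..<b} x"
      by (intro AE_I2 tendsto_intros bump_tendsto_indicator)
    fix n
    have "norm (f x * ?\<eta> n x) \<le> \<bar>indicator {a..b} x * f x\<bar>" for x
    proof -
      have "\<bar>?\<eta> n x\<bar> \<le> indicator {a..b} x"
        using bump_bounds[of "1 / real (Suc n)" a b x] by (cases "a < x \<and> x < b") auto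
      then show ?thesis using mult_right_mono[of "\<bar>?\<eta> n x\<bar>" "indicator {a..b} x" "\<bar>f x\<bar>"]
        by (simp add: abs_mult mult.commute)
    qed
    then show "AE x in lborel. norm (f x * ?\<eta> n x) \<le> \<bar>indicator {a..b} x * f x\<bar>" by simp
  qed measurable
  then have "(\<lambda>n. 0) \<longlonglongrightarrow> (LINT x|lborel. f x * indicator {a<..<b} x)"
    using eq[OF tf] by simp
  then have "(LINT x|lborel. f x * indicator {a<..<b} x) = 0" using LIMSEQ_unique tendsto_const by blast
  then show ?thesis by (simp add: set_lebesgue_integral_def mult.commute)
qed

lemma fundamental_lemma:
  assumes "loc_integrable f" "\<And>\<phi>. test_function \<phi> \<Longrightarrow> (LINT x|lborel. f x * \<phi> x) = 0"
  shows "AE x in lborel. f x = 0"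
  using assms by (intro AE_zero_if_interval_integrals_zero interval_integral_eq_if_test_integrals_eq) auto

lemma loc_integrable_continuous:
  assumes "continuous_on UNIV f"
  shows "loc_integrable f"
  unfolding loc_integrable_def set_integrable_def
  using borel_measurable_continuous_onI[OF assms] borel_integrable_compact[OF compact_Icc continuous_on_subset[OF assms subset_UNIV]]
  by (simp add: scaleR_conv_of_real)

lemma loc_integrable_diff:
  assumes "loc_integrable f" "loc_integrable g"
  shows "loc_integrable (\<lambda>x. f x - g x)"
  using assms unfolding loc_integrable_def by (auto intro: set_integral_diff)

lemma bump_integral_pos: "(LINT x|lborel. bump 0 1 1 1 0 x) > 0"
proof -
  have tf: "test_function (bump 0 1 1 1 0)" by (rule test_function_bump) auto
  have ge0: "0 \<le> bump 0 1 1 1 0 x" for x by (rule bump_bounds) auto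
  have "(LINT x|lborel. bump 0 1 1 1 0 x) \<noteq> 0"
  proof
    assume "(LINT x|lborel. bump 0 1 1 1 0 x) = 0"
    then have "AE x in lborel. bump 0 1 1 1 0 x = 0"
      using test_function_integrable[OF tf] ge0 by (subst (asm) integral_nonneg_eq_0_iff_AE) auto
    then have "AE x in lborel. x \<notin> {0<..<1::real}" by eventually_elim (auto simp: bump_def)
    then have "emeasure lborel {0<..<1::real} = 0" by (subst (asm) AE_iff_measurable[of "{0<..<1}"]) auto
    then show False by simp
  qed
  moreover have "(LINT x|lborel. bump 0 1 1 1 0 x) \<ge> 0" using ge0 by simp
  ultimately show ?thesis by simp
qed

text \<open>A test function minus a suitable multiple of a fixed bump \<open>\<psi>\<close> has
  integral 0, hence is the derivative of a test function. This reduces the claim to the fundamental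
  lemma for \<open>f - c\<close>, where \<open>c\<close> is the mean of \<open>f\<close> weighted by
  \<open>\<psi>\<close>.\<close>

lemma du_Bois_Reymond:
  assumes f: "loc_integrable f"
    and eq: "\<And>\<phi>. test_function \<phi> \<Longrightarrow> (LINT x|lborel. f x * deriv \<phi> x) = 0"
  shows "\<exists>c. AE x in lborel. f x = c"
proof -
  define \<psi> where "\<psi> = bump 0 1 1 1 0"
  have \<psi>: "test_function \<psi>" unfolding \<psi>_def by (rule test_function_bump) auto
  define I where "I = (LINT x|lborel. \<psi> x)"
  have I: "I > 0" unfolding I_def \<psi>_def by (rule bump_integral_pos)
  define c where "c = (LINT x|lborel. f x * \<psi> x) / I"
  have "AE x in lborel. f x - c = 0"
  proof (rule fundamental_lemma)
    show "loc_integrable (\<lambda>x. f x - c)"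
      by (intro loc_integrable_diff[OF f] loc_integrable_continuous) auto
    fix \<phi> assume \<phi>: "test_function \<phi>"
    define d where "d = (LINT x|lborel. \<phi> x) / I"
    have "test_function (\<lambda>x. \<phi> x + (- d) * \<psi> x)" by (rule test_function_linear[OF \<phi> \<psi>])
    moreover have "(LINT x|lborel. \<phi> x + (- d) * \<psi> x) = 0"
      using test_function_integrable[OF \<phi>] test_function_integrable[OF \<psi>] I by (simp add: d_def I_def)
    ultimately obtain \<Phi> where \<Phi>: "test_function \<Phi>" "deriv \<Phi> = (\<lambda>x. \<phi> x + (- d) * \<psi> x)"
      using test_function_primitive by metis
    have i1: "integrable lborel (\<lambda>x. f x * \<phi> x)" "integrable lborel (\<lambda>x. f x * \<psi> x)"
      using integrable_mult_test_function[OF f] \<phi> \<psi> by auto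
    have "0 = (LINT x|lborel. f x * \<phi> x - d * (f x * \<psi> x))"
      using eq[OF \<Phi>(1)] unfolding \<Phi>(2) by (simp add: algebra_simps)
    also have "\<dots> = (LINT x|lborel. f x * \<phi> x) - d * (LINT x|lborel. f x * \<psi> x)" using i1 by simp
    also have "d * (LINT x|lborel. f x * \<psi> x) = c * (LINT x|lborel. \<phi> x)" by (simp add: d_def c_def)
    also have "(LINT x|lborel. f x * \<phi> x) - c * (LINT x|lborel. \<phi> x) = (LINT x|lborel. (f x - c) * \<phi> x)"
      using i1 test_function_integrable[OF \<phi>] by (simp add: left_diff_distrib)
    finally show "(LINT x|lborel. (f x - c) * \<phi> x) = 0" by simp
  qed
  then show ?thesis by auto
qed

section \<open>Square-integrable functions\<close>

abbreviation sqint :: "(real \<Rightarrow> real) \<Rightarrow> real" where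
  "sqint u \<equiv> LINT x|lborel. (u x)\<^sup>2"

lemma L2_measurable: "u \<in> L2 \<Longrightarrow> u \<in> borel_measurable borel"
  by (simp add: L2_def)

lemma L2_integrable_power2: "u \<in> L2 \<Longrightarrow> integrable lborel (\<lambda>x. (u x)\<^sup>2)"
  by (simp add: L2_def)

lemma L2_integrable_mult:
  assumes "u \<in> L2" "v \<in> L2"
  shows "integrable lborel (\<lambda>x. u x * v x)"
proof (rule Bochner_Integration.integrable_bound)
  show "integrable lborel (\<lambda>x. (u x)\<^sup>2 + (v x)\<^sup>2)" using assms by (simp add: L2_def)
  have "\<bar>u x * v x\<bar> \<le> (u x)\<^sup>2 + (v x)\<^sup>2" for x
  proof -
    have "2 * (\<bar>u x\<bar> * \<bar>v x\<bar>) \<le> (u x)\<^sup>2 + (v x)\<^sup>2" "0 \<le> \<bar>u x\<bar> * \<bar>v x\<bar>"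
      using sum_squares_bound[of "\<bar>u x\<bar>" "\<bar>v x\<bar>"] by (simp_all add: mult.assoc)
    then show ?thesis unfolding abs_mult by linarith
  qed
  then show "AE x in lborel. norm (u x * v x) \<le> norm ((u x)\<^sup>2 + (v x)\<^sup>2)" by simp
  show "(\<lambda>x. u x * v x) \<in> borel_measurable lborel"
    using L2_measurable[OF assms(1)] L2_measurable[OF assms(2)] by simp
qed

lemma L2_I: "u \<in> borel_measurable borel \<Longrightarrow> integrable lborel (\<lambda>x. (u x)\<^sup>2) \<Longrightarrow> u \<in> L2"
  by (simp add: L2_def)

lemma L2_linear:
  assumes "u \<in> L2" "v \<in> L2"
  shows "(\<lambda>x. u x + c * v x) \<in> L2"
proof (rule L2_I)
  have "integrable lborel (\<lambda>x. (u x)\<^sup>2 + 2 * c * (u x * v x) + c\<^sup>2 * (v x)\<^sup>2)"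
    by (intro Bochner_Integration.integrable_add integrable_mult_right L2_integrable_mult[OF assms]
      L2_integrable_power2 assms)
  also have "(\<lambda>x. (u x)\<^sup>2 + 2 * c * (u x * v x) + c\<^sup>2 * (v x)\<^sup>2) = (\<lambda>x. (u x + c * v x)\<^sup>2)"
    by (simp add: power2_eq_square algebra_simps)
  finally show "integrable lborel (\<lambda>x. (u x + c * v x)\<^sup>2)" .
  show "(\<lambda>x. u x + c * v x) \<in> borel_measurable borel"
    by (intro borel_measurable_add borel_measurable_times borel_measurable_const L2_measurable assms)
qed

lemma sqint_linear:
  assumes "u \<in> L2" "v \<in> L2"
  shows "sqint (\<lambda>x. u x + c * v x) = sqint u + 2 * c * (LINT x|lborel. u x * v x) + c\<^sup>2 * sqint v"
proof -
  have "sqint (\<lambda>x. u x + c * v x) = (LINT x|lborel. (u x)\<^sup>2 + 2 * c * (u x * v x) + c\<^sup>2 * (v x)\<^sup>2)"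
    by (rule Bochner_Integration.integral_cong) (auto simp: power2_eq_square algebra_simps)
  also have "\<dots> = (LINT x|lborel. (u x)\<^sup>2 + 2 * c * (u x * v x)) + (LINT x|lborel. c\<^sup>2 * (v x)\<^sup>2)"
    by (intro Bochner_Integration.integral_add Bochner_Integration.integrable_add integrable_mult_right
      L2_integrable_mult[OF assms] L2_integrable_power2 assms)
  also have "(LINT x|lborel. (u x)\<^sup>2 + 2 * c * (u x * v x)) = sqint u + (LINT x|lborel. 2 * c * (u x * v x))"
    by (intro Bochner_Integration.integral_add integrable_mult_right
      L2_integrable_mult[OF assms] L2_integrable_power2 assms)
  finally show ?thesis by (simp only: integral_mult_right_zero)
qed

lemma L2_scale: "u \<in> L2 \<Longrightarrow> (\<lambda>x. c * u x) \<in> L2"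
  by (auto simp: L2_def power_mult_distrib)

lemma L2_diff: "u \<in> L2 \<Longrightarrow> v \<in> L2 \<Longrightarrow> (\<lambda>x. u x - v x) \<in> L2"
  using L2_linear[of u v "-1"] by simp

lemma L2_add: "u \<in> L2 \<Longrightarrow> v \<in> L2 \<Longrightarrow> (\<lambda>x. u x + v x) \<in> L2"
  using L2_linear[of u v 1] by simp

lemma sqint_diff:
  "u \<in> L2 \<Longrightarrow> v \<in> L2 \<Longrightarrow> sqint (\<lambda>x. u x - v x) = sqint u - 2 * (LINT x|lborel. u x * v x) + sqint v"
  using sqint_linear[of u v "-1"] by simp

lemma sqint_nonneg [simp]: "sqint u \<ge> 0"
  by simp

lemma L2_Cauchy_Schwarz:
  assumes "u \<in> L2" "v \<in> L2"
  shows "(LINT x|lborel. u x * v x)\<^sup>2 \<le> sqint u * sqint v"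
proof -
  define I where "I = (LINT x|lborel. u x * v x)"
  have *: "0 \<le> sqint u + 2 * c * I + c\<^sup>2 * sqint v" for c
    using sqint_nonneg[of "\<lambda>x. u x + c * v x"] unfolding sqint_linear[OF assms] I_def .
  show ?thesis
  proof (cases "sqint v = 0")
    case True
    have "I = 0"
    proof (rule ccontr)
      assume "I \<noteq> 0"
      \<comment> \<open>At this argument the polynomial, which is affine here, takes the value
        -1.\<close>
      then have "0 \<le> sqint u - (sqint u + 1)"
        using *[of "- (sqint u + 1) / (2 * I)"] True by (simp add: field_simps)
      then show False by simp
    qed
    then show ?thesis by (simp add: I_def[symmetric] True)
  next
    case False
    then have v: "sqint v > 0" using sqint_nonneg[of v] by linarith
    \<comment> \<open>The quadratic polynomial is evaluated at its minimum point
      \<open>- I / sqint v\<close>.\<close>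
    have "0 \<le> sqint v * (sqint u + 2 * (- I / sqint v) * I + (- I / sqint v)\<^sup>2 * sqint v)"
      by (intro mult_nonneg_nonneg *) (use v in auto)
    also have "\<dots> = sqint u * sqint v - I\<^sup>2" using v by (simp add: field_simps power2_eq_square)
    finally show ?thesis by (simp add: I_def)
  qed
qed

lemma L2_Cauchy_Schwarz_abs:
  assumes "u \<in> L2" "v \<in> L2"
  shows "\<bar>LINT x|lborel. u x * v x\<bar> \<le> sqrt (sqint u) * sqrt (sqint v)"
  using real_sqrt_le_mono[OF L2_Cauchy_Schwarz[OF assms]] by (simp add: real_sqrt_mult)

lemma sqint_diff_le: "u \<in> L2 \<Longrightarrow> v \<in> L2 \<Longrightarrow> sqint (\<lambda>x. u x - v x) \<le> 2 * sqint u + 2 * sqint v"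
  using sqint_linear[of u v 1] sqint_diff[of u v] sqint_nonneg[of "\<lambda>x. u x + v x"] by simp

lemma sqint_cong_AE:
  assumes "u \<in> borel_measurable borel" "v \<in> borel_measurable borel" "AE x in lborel. u x = v x"
  shows "sqint u = sqint v"
  using assms by (intro integral_cong_AE) auto

lemma L2_cong_AE:
  assumes "u \<in> L2" "v \<in> borel_measurable borel" "AE x in lborel. u x = v x"
  shows "v \<in> L2"
proof (rule L2_I)
  show "integrable lborel (\<lambda>x. (v x)\<^sup>2)"
    using assms by (subst integrable_cong_AE[where g = "\<lambda>x. (u x)\<^sup>2"]) (auto simp: L2_def)
qed (use assms in auto)

lemma L2_indicator: "u \<in> L2 \<Longrightarrow> A \<in> sets borel \<Longrightarrow> (\<lambda>x. u x * indicator A x) \<in> L2"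
proof (rule L2_I)
  assume u: "u \<in> L2" and A: "A \<in> sets borel"
  have "(\<lambda>x. (u x * indicator A x)\<^sup>2) = (\<lambda>x. (u x)\<^sup>2 * indicator A x)" by (auto simp: indicator_def)
  then show "integrable lborel (\<lambda>x. (u x * indicator A x)\<^sup>2)"
    using u A by (auto intro: integrable_real_mult_indicator L2_integrable_power2)
  show "(\<lambda>x. u x * indicator A x) \<in> borel_measurable borel" using u A by (auto simp: L2_def)
qed

lemma indicator_interval_L2: "(indicator {a..<b} :: real \<Rightarrow> real) \<in> L2"
proof (rule L2_I)
  have "integrable lborel (indicator {a..<b} :: real \<Rightarrow> real)"
    by (rule integrable_real_indicator)
      (auto intro: order.strict_trans1[OF emeasure_mono[of "{a..<b}" "{a..b}"]] simp: emeasure_lborel_Icc_eq)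
  moreover have "(\<lambda>x. (indicator {a..<b} x)\<^sup>2) = (indicator {a..<b} :: real \<Rightarrow> real)" by (auto simp: indicator_def)
  ultimately show "integrable lborel (\<lambda>x. (indicator {a..<b} x :: real)\<^sup>2)" by simp
qed auto

lemma sqint_indicator: "a \<le> b \<Longrightarrow> sqint (indicator {a..<b}) = b - a"
proof -
  assume "a \<le> b"
  have "(\<lambda>x. (indicator {a..<b} x)\<^sup>2) = (indicator {a..<b} :: real \<Rightarrow> real)" by (auto simp: indicator_def)
  then show ?thesis using \<open>a \<le> b\<close> by simp
qed

lemma L2_set_integrable:
  assumes "u \<in> L2"
  shows "set_integrable lborel {a..<b} u"
  using L2_integrable_mult[OF indicator_interval_L2 assms] by (simp add: set_integrable_def)

lemma L2_interval_integral_bound: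
  assumes "u \<in> L2" "a \<le> b"
  shows "(LINT x:{a..<b}|lborel. u x)\<^sup>2 \<le> (b - a) * sqint u"
  using L2_Cauchy_Schwarz[OF indicator_interval_L2 assms(1), of a b] sqint_indicator[OF assms(2)]
  by (simp add: set_lebesgue_integral_def)

lemma L2_loc_integrable:
  assumes "u \<in> L2"
  shows "loc_integrable u"
  unfolding loc_integrable_def
proof (intro conjI allI)
  fix a b :: real
  have "set_integrable lborel {a..<b + 1} u" by (rule L2_set_integrable[OF assms])
  then show "set_integrable lborel {a..b} u" by (rule set_integrable_subset) auto
qed (use assms in \<open>auto simp: L2_def\<close>)

lemma interval_integral_split:
  assumes "u \<in> L2" "a \<le> b" "b \<le> c"
  shows "(LINT x:{a..<c}|lborel. u x) = (LINT x:{a..<b}|lborel. u x) + (LINT x:{b..<c}|lborel. u x)"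
proof -
  have "{a..<c} = {a..<b} \<union> {b..<c}" using assms by auto
  then show ?thesis
    using L2_set_integrable[OF assms(1)] by (simp only:) (rule set_integral_Un, auto)
qed

text \<open>Along a subsequence with rapidly decreasing increments \<open>d\<^sub>k\<close> the integral of
  \<open>\<Sum>k. 2\<^sup>k d\<^sub>k\<^sup>2\<close> is finite, which gives pointwise convergence almost everywhere.\<close>

lemma L2_complete:
  fixes g :: "nat \<Rightarrow> real \<Rightarrow> real"
  assumes g: "\<And>k. g k \<in> L2" and e: "e \<longlonglongrightarrow> (0::real)"
    and gap: "\<And>k l. k \<le> l \<Longrightarrow> sqint (\<lambda>x. g l x - g k x) \<le> e k"
  obtains h where "h \<in> L2" "\<And>k. sqint (\<lambda>x. h x - g k x) \<le> e k"
proof -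
  have [measurable]: "g k \<in> borel_measurable borel" for k using g[of k] by (simp add: L2_def)
  have "\<exists>n. \<forall>k\<ge>n. e k < (1/4) ^ j" for j
    using order_tendstoD(2)[OF e, of "(1/4) ^ j"] by (auto simp: eventually_sequentially)
  then obtain N where N: "\<And>j k. N j \<le> k \<Longrightarrow> e k < (1/4) ^ j" by metis
  \<comment> \<open>Strictly increasing with \<open>r j \<ge> N j\<close>: the squared increment of
    step \<open>j\<close> is at most \<open>(1/4) ^ j\<close> and stays summable after weighting by
    \<open>2 ^ j\<close>.\<close>
  define r where "r = rec_nat (N 0) (\<lambda>j x. max (Suc x) (N (Suc j)))"
  have r_Suc: "r (Suc j) = max (Suc (r j)) (N (Suc j))" for j by (simp add: r_def)
  have r_mono: "strict_mono r" by (rule strict_monoI_Suc) (simp add: r_Suc)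
  have rN: "N j \<le> r j" for j by (cases j) (auto simp: r_Suc, simp add: r_def)
  define d where "d = (\<lambda>j x. g (r (Suc j)) x - g (r j) x)"
  have dL2: "d j \<in> L2" for j unfolding d_def by (intro L2_diff g)
  have [measurable]: "d k \<in> borel_measurable borel" for k using dL2[of k] by (simp add: L2_def)
  have d: "sqint (d j) \<le> (1/4) ^ j" for j
    using gap[of "r j" "r (Suc j)"] N[OF rN, of j] strict_monoD[OF r_mono, of j "Suc j"] by (simp add: d_def)
  have "(\<integral>\<^sup>+x. (\<Sum>j. ennreal (2 ^ j * (d j x)\<^sup>2)) \<partial>lborel) = (\<Sum>j. \<integral>\<^sup>+x. ennreal (2 ^ j * (d j x)\<^sup>2) \<partial>lborel)"
    by (rule nn_integral_suminf) auto
  also have "\<dots> = (\<Sum>j. ennreal (2 ^ j * sqint (d j)))"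
    using L2_integrable_power2[OF dL2] by (subst nn_integral_eq_integral) auto
  also have "\<dots> \<le> (\<Sum>j. ennreal ((1/2) ^ j))"
  proof (rule suminf_le)
    fix j
    have "2 ^ j * sqint (d j) \<le> 2 ^ j * (1/4) ^ j" using d by (intro mult_left_mono) auto
    also have "\<dots> = (1/2) ^ j" by (simp flip: power_mult_distrib)
    finally show "ennreal (2 ^ j * sqint (d j)) \<le> ennreal ((1/2) ^ j)" by (rule ennreal_leI)
  qed auto
  also have "\<dots> < \<infinity>"
    by (subst suminf_ennreal_eq[OF _ geometric_sums[of "1/2"]]) auto
  finally have "AE x in lborel. (\<Sum>j. ennreal (2 ^ j * (d j x)\<^sup>2)) \<noteq> \<infinity>"
    by (intro nn_integral_noteq_infinite) auto
  then have conv: "AE x in lborel. convergent (\<lambda>j. g (r j) x)"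
  proof eventually_elim
    case (elim x)
    then have "summable (\<lambda>j. 2 ^ j * (d j x)\<^sup>2)"
      by (intro summable_suminf_not_top) auto
    then have "summable (\<lambda>j. 2 ^ j * (d j x)\<^sup>2 + (1/2) ^ j)"
      by (intro summable_add summable_geometric) auto
    then have "summable (\<lambda>j. d j x)"
    proof (rule summable_comparison_test'[of _ 0])
      fix j :: nat
      \<comment> \<open>Arithmetic-geometric mean with weights \<open>2 ^ j\<close> and
        \<open>(1/2) ^ j\<close>, which turns summable weighted squares into absolute
        convergence.\<close>
      have "2 * \<bar>d j x\<bar> \<le> 2 ^ j * (d j x)\<^sup>2 + (1/2) ^ j"
        using sum_squares_bound[of "sqrt (2 ^ j) * \<bar>d j x\<bar>" "sqrt ((1/2) ^ j)"]
        by (simp add: power_mult_distrib power_one_over real_sqrt_divide)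
      then show "norm (d j x) \<le> 2 ^ j * (d j x)\<^sup>2 + (1/2) ^ j" by simp
    qed
    then have "convergent (\<lambda>n. \<Sum>j<n. d j x)" by (simp add: summable_iff_convergent)
    moreover have "(\<Sum>j<n. d j x) = g (r n) x - g (r 0) x" for n
      unfolding d_def by (rule sum_lessThan_telescope)
    ultimately have "convergent (\<lambda>n. (g (r n) x - g (r 0) x) + g (r 0) x)"
      by (intro convergent_add convergent_const) auto
    then show ?case by simp
  qed
  define h where "h = (\<lambda>x. lim (\<lambda>j. g (r j) x))"
  have [measurable]: "h \<in> borel_measurable borel" unfolding h_def by measurable
  have lim: "AE x in lborel. (\<lambda>j. g (r j) x) \<longlonglongrightarrow> h x"
    using conv by eventually_elim (simp add: h_def convergent_LIMSEQ_iff)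
  \<comment> \<open>Fatou's lemma along the subsequence bounds the distance from the limit to every
    \<open>g k\<close>, also to those outside the subsequence.\<close>
  have key: "(\<integral>\<^sup>+x. ennreal ((h x - g k x)\<^sup>2) \<partial>lborel) \<le> ennreal (e k)" for k
  proof -
    have "(\<integral>\<^sup>+x. ennreal ((h x - g k x)\<^sup>2) \<partial>lborel)
        = (\<integral>\<^sup>+x. liminf (\<lambda>j. ennreal ((g (r j) x - g k x)\<^sup>2)) \<partial>lborel)"
    proof (rule nn_integral_cong_AE, use lim in eventually_elim)
      fix x assume "(\<lambda>j. g (r j) x) \<longlonglongrightarrow> h x"
      then have "(\<lambda>j. ennreal ((g (r j) x - g k x)\<^sup>2)) \<longlonglongrightarrow> ennreal ((h x - g k x)\<^sup>2)"
        by (intro tendsto_intros)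
      then show "ennreal ((h x - g k x)\<^sup>2) = liminf (\<lambda>j. ennreal ((g (r j) x - g k x)\<^sup>2))"
        by (rule lim_imp_Liminf[OF sequentially_bot, symmetric])
    qed
    also have "\<dots> \<le> liminf (\<lambda>j. \<integral>\<^sup>+x. ennreal ((g (r j) x - g k x)\<^sup>2) \<partial>lborel)"
      by (rule nn_integral_liminf) auto
    also have "\<dots> \<le> ennreal (e k)"
    proof (rule Liminf_le)
      show "\<forall>\<^sub>F j in sequentially. (\<integral>\<^sup>+x. ennreal ((g (r j) x - g k x)\<^sup>2) \<partial>lborel) \<le> ennreal (e k)"
        unfolding eventually_sequentially
      proof (intro exI[of _ k] allI impI)
        fix j assume "k \<le> j"
        then have "k \<le> r j" using seq_suble[OF r_mono, of j] by simp
        have "(\<integral>\<^sup>+x. ennreal ((g (r j) x - g k x)\<^sup>2) \<partial>lborel) = ennreal (sqint (\<lambda>x. g (r j) x - g k x))"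
          using L2_integrable_power2[OF L2_diff[OF g g]] by (intro nn_integral_eq_integral) auto
        also have "\<dots> \<le> ennreal (e k)" using gap[OF \<open>k \<le> r j\<close>] by (rule ennreal_leI)
        finally show "(\<integral>\<^sup>+x. ennreal ((g (r j) x - g k x)\<^sup>2) \<partial>lborel) \<le> ennreal (e k)" .
      qed
    qed auto
    finally show ?thesis .
  qed
  have e0: "e k \<ge> 0" for k using gap[of k k] by simp
  have diff: "(\<lambda>x. h x - g k x) \<in> L2" for k
  proof (rule L2_I)
    show "integrable lborel (\<lambda>x. (h x - g k x)\<^sup>2)"
      using key[of k] by (intro integrableI_bounded) (auto simp: top_unique less_top[symmetric])
  qed auto
  show ?thesis
  proof (rule that)
    show "h \<in> L2" using L2_add[OF diff[of 0] g[of 0]] by simp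
    show "sqint (\<lambda>x. h x - g k x) \<le> e k" for k
      using key[of k] L2_integrable_power2[OF diff, of k] e0[of k]
      by (subst (asm) nn_integral_eq_integral) (auto simp: ennreal_le_iff)
  qed
qed

section \<open>Absolutely continuous representatives\<close>

text \<open>Carrying the derivative as an argument avoids the choice made by \<open>grad\<close>.
  The identity holds at every point, so \<open>u\<close> is the continuous representative; half-open
  intervals concatenate without overlap.\<close>

definition AC :: "(real \<Rightarrow> real) \<Rightarrow> (real \<Rightarrow> real) \<Rightarrow> bool" where
  "AC u g \<longleftrightarrow> u \<in> L2 \<and> g \<in> L2 \<and> (\<forall>x y. x \<le> y \<longrightarrow> u y - u x = (LINT t:{x..<y}|lborel. g t))"

lemma AC_L2: "AC u g \<Longrightarrow> u \<in> L2" "AC u g \<Longrightarrow> g \<in> L2"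
  by (auto simp: AC_def)

text \<open>Cauchy-Schwarz on the interval between the two points. \<open>U\<close> enters through
  its increments alone, so that primitives of \<open>L2\<close> functions are covered before they
  are known to be square integrable.\<close>

lemma increments_Hoelder:
  assumes "g \<in> L2" "\<And>x y. x \<le> y \<Longrightarrow> U y - U x = (LINT t:{x..<y}|lborel. g t)"
  shows "(U y - U x)\<^sup>2 \<le> \<bar>y - x\<bar> * sqint g"
proof (cases "x \<le> y")
  case True
  then show ?thesis using assms(2)[OF True] L2_interval_integral_bound[of g x y] assms(1) by simp
next
  case False
  then have "(U x - U y)\<^sup>2 \<le> (x - y) * sqint g"
    using assms(2)[of y x] L2_interval_integral_bound[of g y x] assms(1) by simp
  then show ?thesis using False by (simp add: power2_commute)
qed

lemma AC_Hoelder: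
  assumes "AC u g"
  shows "(u y - u x)\<^sup>2 \<le> \<bar>y - x\<bar> * sqint g"
  using assms by (intro increments_Hoelder) (auto simp: AC_def)

lemma Hoelder_imp_continuous:
  fixes u :: "real \<Rightarrow> real"
  assumes "\<And>x y. (u y - u x)\<^sup>2 \<le> \<bar>y - x\<bar> * G"
  shows "continuous_on A u"
proof -
  have "isCont u x" for x
  proof -
    have "((\<lambda>y. u y - u x) \<longlongrightarrow> 0) (at x)"
    proof (rule Lim_null_comparison)
      show "((\<lambda>y. sqrt (\<bar>y - x\<bar> * G)) \<longlongrightarrow> 0) (at x)" by (auto intro!: tendsto_eq_intros)
      show "\<forall>\<^sub>F y in at x. norm (u y - u x) \<le> sqrt (\<bar>y - x\<bar> * G)"
        by (intro always_eventually allI) (simp add: real_le_rsqrt assms)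
    qed
    then show ?thesis by (simp add: isCont_def LIM_zero_iff)
  qed
  then show ?thesis by (simp add: continuous_at_imp_continuous_on)
qed

lemma AC_continuous: "AC u g \<Longrightarrow> continuous_on A u"
  by (rule Hoelder_imp_continuous) (rule AC_Hoelder)

lemma AC_linear:
  assumes "AC u g" "AC v k"
  shows "AC (\<lambda>x. u x + c * v x) (\<lambda>x. g x + c * k x)"
  unfolding AC_def
proof (intro conjI allI impI L2_linear)
  fix x y :: real assume xy: "x \<le> y"
  have "(LINT t:{x..<y}|lborel. g t + c * k t) = (LINT t:{x..<y}|lborel. g t) + c * (LINT t:{x..<y}|lborel. k t)"
    using assms L2_set_integrable by (subst set_integral_add) (auto simp: AC_def)
  also have "\<dots> = (u y - u x) + c * (v y - v x)" using assms xy by (simp add: AC_def)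
  finally show "u y + c * v y - (u x + c * v x) = (LINT t:{x..<y}|lborel. g t + c * k t)"
    by (simp add: algebra_simps)
qed (use assms in \<open>auto simp: AC_def\<close>)

lemma AC_diff:
  assumes "AC u g" "AC v k"
  shows "AC (\<lambda>x. u x - v x) (\<lambda>x. g x - k x)"
  using AC_linear[OF assms, of "-1"] by simp

lemma AC_zero: "AC (\<lambda>x. 0) (\<lambda>x. 0)"
  by (simp add: AC_def L2_def)

lemma AC_scale:
  assumes "AC u g"
  shows "AC (\<lambda>x. c * u x) (\<lambda>x. c * g x)"
  using AC_linear[OF AC_zero assms, of c] by simp

lemma integral_affine_comp:
  fixes f :: "real \<Rightarrow> real"
  assumes "t > 0"
  shows "(LINT x|lborel. f (t * x + c)) = (LINT x|lborel. f x) / t"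
  using lborel_integral_real_affine[of t f c] assms by (simp add: add.commute)

lemma L2_affine_comp:
  assumes "u \<in> L2" "t > 0"
  shows "(\<lambda>x. u (t * x + c)) \<in> L2"
proof (rule L2_I)
  show "integrable lborel (\<lambda>x. (u (t * x + c))\<^sup>2)"
    using lborel_integrable_real_affine[OF L2_integrable_power2[OF assms(1)], of t c] assms
    by (simp add: add.commute)
  show "(\<lambda>x. u (t * x + c)) \<in> borel_measurable borel"
    using L2_measurable[OF assms(1)] by measurable
qed

lemma AC_affine_comp:
  assumes "AC u g" "t > 0"
  shows "AC (\<lambda>x. u (t * x + c)) (\<lambda>x. t * g (t * x + c))"
  unfolding AC_def
proof (intro conjI allI impI L2_scale L2_affine_comp)
  fix x y :: real assume xy: "x \<le> y"
  have "(LINT s:{x..<y}|lborel. t * g (t * s + c)) = (LINT s|lborel. t * (indicator {t * x + c..<t * y + c} (t * s + c) * g (t * s + c)))"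
    unfolding set_lebesgue_integral_def using assms(2)
    by (intro Bochner_Integration.integral_cong) (auto simp: indicator_def)
  also have "\<dots> = t * (LINT s|lborel. indicator {t * x + c..<t * y + c} (t * s + c) * g (t * s + c))"
    by simp
  also have "\<dots> = (LINT s:{t * x + c..<t * y + c}|lborel. g s)"
    using integral_affine_comp[OF assms(2), of "\<lambda>s. indicator {t * x + c..<t * y + c} s * g s" c] assms(2)
    by (simp add: set_lebesgue_integral_def)
  also have "\<dots> = u (t * y + c) - u (t * x + c)"
    using assms xy by (simp add: AC_def)
  finally show "u (t * y + c) - u (t * x + c) = (LINT s:{x..<y}|lborel. t * g (t * s + c))" by simp
qed (use assms in \<open>auto simp: AC_def\<close>)

lemma AC_translate:
  assumes "AC u g"
  shows "AC (\<lambda>x. u (x + c)) (\<lambda>x. g (x + c))"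
  using AC_affine_comp[OF assms, of 1 c] by simp

lemma sqint_translate: "sqint (\<lambda>x. u (x + c)) = sqint u"
  using integral_affine_comp[of 1 "\<lambda>x. (u x)\<^sup>2" c] by simp

text \<open>Average \<open>u(x)\<^sup>2 \<le> 2 u(y)\<^sup>2 + 2 (u(x) - u(y))\<^sup>2\<close> over \<open>y \<in> [x, x + L)\<close>.\<close>

lemma AC_sup_bound:
  assumes "AC u g" "L > 0"
  shows "(u x)\<^sup>2 \<le> 2 * sqint u / L + 2 * L * sqint g"
proof -
  define I where "I = (indicator {x..<x + L} :: real \<Rightarrow> real)"
  have Iint: "integrable lborel I" unfolding I_def
    by (rule integrable_real_indicator) (use assms(2) in \<open>auto simp: emeasure_lborel_Ico\<close>)
  have Iv: "(LINT y|lborel. I y) = L" using assms(2) by (simp add: I_def)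
  have pt: "I y * (u x)\<^sup>2 \<le> 2 * (u y)\<^sup>2 + I y * (2 * L * sqint g)" for y
  proof (cases "y \<in> {x..<x + L}")
    case True
    \<comment> \<open>The right side exceeds the left one by
      \<open>(u x - 2 * u y)\<^sup>2\<close>.\<close>
    have "(u x)\<^sup>2 \<le> 2 * (u y)\<^sup>2 + 2 * (u y - u x)\<^sup>2"
      using sum_squares_bound[of "u x - 2 * u y" 0] zero_le_power2[of "u x - 2 * u y"]
      by (simp add: power2_eq_square algebra_simps)
    also have "(u y - u x)\<^sup>2 \<le> L * sqint g"
      by (rule order_trans[OF AC_Hoelder[OF assms(1)]]) (use True in \<open>auto intro!: mult_right_mono\<close>)
    finally show ?thesis using True by (simp add: I_def)
  qed (simp add: I_def)
  have "(LINT y|lborel. I y * (u x)\<^sup>2) \<le> (LINT y|lborel. 2 * (u y)\<^sup>2 + I y * (2 * L * sqint g))"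
    using Iint L2_integrable_power2[OF AC_L2(1)[OF assms(1)]] pt by (intro integral_mono) auto
  then have "L * (u x)\<^sup>2 \<le> 2 * sqint u + L * (2 * L * sqint g)"
    using Iint Iv L2_integrable_power2[OF AC_L2(1)[OF assms(1)]] by simp
  then show ?thesis using assms(2) by (simp add: field_simps power2_eq_square)
qed

section \<open>Weak derivatives and the passage between \<open>H1\<close> and
  \<open>AC\<close>\<close>

lemma integrable_product:
  fixes F G :: "real \<Rightarrow> real"
  assumes F: "integrable lborel F" and G: "integrable lborel G"
  shows "integrable (lborel \<Otimes>\<^sub>M lborel) (\<lambda>(x, t). F x * G t)"
proof (rule lborel_pair.Fubini_integrable)
  have [measurable]: "F \<in> borel_measurable borel" "G \<in> borel_measurable borel"
    using assms by (auto dest: borel_measurable_integrable)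
  show "(\<lambda>(x, t). F x * G t) \<in> borel_measurable (lborel \<Otimes>\<^sub>M lborel)" by measurable
  show "integrable lborel (\<lambda>x. LINT y|lborel. norm (case (x, y) of (x, t) \<Rightarrow> F x * G t))"
    using assms by (simp add: abs_mult)
  show "AE x in lborel. integrable lborel (\<lambda>y. case (x, y) of (x, t) \<Rightarrow> F x * G t)"
    using assms by simp
qed

text \<open>Integration by parts through Fubini: \<open>U x - U A\<close> is an integral of
  \<open>g\<close> up to \<open>x\<close>, and after the exchange the inner integral of
  \<open>deriv \<phi>\<close> beyond \<open>t\<close> is \<open>- \<phi> t\<close>. Subtracting
  \<open>U A\<close> changes nothing, as \<open>deriv \<phi>\<close> has integral 0.\<close>

lemma increments_weak_derivative:
  assumes g: "g \<in> L2" and U: "\<And>x y. x \<le> y \<Longrightarrow> U y - U x = (LINT t:{x..<y}|lborel. g t)"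
  shows "weak_derivative U g"
  unfolding weak_derivative_def
proof (intro allI impI)
  fix \<phi> assume \<phi>: "test_function \<phi>"
  obtain A' B' where AB': "A' < B'" "\<And>x. x \<notin> {A'..B'} \<Longrightarrow> \<phi> x = 0"
    using test_function_bounded_support[OF \<phi>] by blast
  \<comment> \<open>One unit beyond the support bounds, so that \<open>\<phi>\<close> is 0 at
    \<open>A\<close> and \<open>B\<close> themselves.\<close>
  define A where "A = A' - 1"
  define B where "B = B' + 1"
  have AB: "A < B" using AB' by (simp add: A_def B_def)
  have D: "(\<phi> has_real_derivative deriv \<phi> x) (at x)" for x by (rule test_function_DERIV[OF \<phi>])
  have \<phi>0: "\<phi> x = 0" if "x \<le> A \<or> x \<ge> B" for x using that AB' by (force simp: A_def B_def)
  have d0: "deriv \<phi> x = 0" if "x \<notin> {A'..B'}" for x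
      by (rule deriv_zero_outside[OF AB'(2) that])
  have d0': "deriv \<phi> x = 0" if "x \<notin> {A..B}" for x
    using that by (intro d0) (auto simp: A_def B_def)
  have dc: "continuous_on S (deriv \<phi>)" for S by (rule test_function_continuous_deriv[OF \<phi>])
  have dcI: "isCont (deriv \<phi>) x" for x using dc[of UNIV] by (simp add: continuous_on_eq_continuous_at)
  have tail: "(LINT x|lborel. deriv \<phi> x * indicator {t<..} x) = - \<phi> t" if "A \<le> t" for t
  proof (cases "t \<le> B")
    case True
    have "(LINT x|lborel. deriv \<phi> x * indicator {t<..} x) = (LINT x|lborel. deriv \<phi> x * indicator {t..B} x)"
    proof (rule integral_cong_AE)
      show "AE x in lborel. deriv \<phi> x * indicator {t<..} x = deriv \<phi> x * indicator {t..B} x"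
        using AE_lborel_singleton[of t]
      proof eventually_elim
        case (elim x)
        show ?case
        proof (cases "x \<in> {A..B}")
          case True then show ?thesis using elim by (auto simp: indicator_def)
        qed (simp add: d0')
      qed
    qed (use borel_measurable_continuous_onI[OF dc] in auto)
    also have "\<dots> = \<phi> B - \<phi> t"
      by (rule integral_FTC_Icc_real[OF True D dcI])
    finally show ?thesis using \<phi>0[of B] by simp
  next
    case False
    then have *: "deriv \<phi> x * indicator {t<..} x = 0" for x using d0'[of x] by (auto simp: indicator_def)
    show ?thesis unfolding * using False \<phi>0[of t] by simp
  qed
  define f where "f = (\<lambda>x t. (indicator {A..<x} t * g t) * deriv \<phi> x)"
  have [measurable]: "g \<in> borel_measurable borel" "deriv \<phi> \<in> borel_measurable borel"
    using g borel_measurable_continuous_onI[OF dc] by (auto simp: L2_def)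
  have dint: "integrable lborel (deriv \<phi>)"
    using loc_integrable_mult_test[OF loc_integrable_continuous[OF continuous_on_const[of _ 1]] dc d0] by simp
  have gint: "integrable lborel (\<lambda>t. indicator {A..<B} t * g t)"
    using L2_set_integrable[OF g, of A B] by (simp add: set_integrable_def)
  have fint: "integrable (lborel \<Otimes>\<^sub>M lborel) (case_prod f)"
  proof (rule Bochner_Integration.integrable_bound)
    show "integrable (lborel \<Otimes>\<^sub>M lborel) (\<lambda>(x, t). deriv \<phi> x * (indicator {A..<B} t * g t))"
      by (rule integrable_product[OF dint gint])
    have "(\<lambda>p. indicator {p::real \<times> real. A \<le> snd p \<and> snd p < fst p} p * g (snd p) * deriv \<phi> (fst p))
        \<in> borel_measurable (lborel \<Otimes>\<^sub>M lborel)"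
      by measurable
    also have "(\<lambda>p. indicator {p::real \<times> real. A \<le> snd p \<and> snd p < fst p} p * g (snd p) * deriv \<phi> (fst p)) = case_prod f"
      by (auto simp: f_def indicator_def fun_eq_iff)
    finally show "case_prod f \<in> borel_measurable (lborel \<Otimes>\<^sub>M lborel)" .
    have "norm (case_prod f p) \<le> norm (case p of (x, t) \<Rightarrow> deriv \<phi> x * (indicator {A..<B} t * g t))" for p
    proof (cases p)
      case (Pair x t)
      then show ?thesis
        by (cases "x \<in> {A..B}") (auto simp: f_def d0' abs_mult indicator_def)
    qed
    then show "AE p in lborel \<Otimes>\<^sub>M lborel. norm (case_prod f p) \<le> norm (case p of (x, t) \<Rightarrow> deriv \<phi> x * (indicator {A..<B} t * g t))"
      by simp
  qed
  have Uc: "continuous_on S U" for S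
    by (rule Hoelder_imp_continuous) (rule increments_Hoelder[OF g U])
  have inner: "(LINT t|lborel. f x t) = (U x - U A) * deriv \<phi> x" for x
  proof (cases "A \<le> x")
    case True
    then show ?thesis unfolding f_def using U[OF True] by (simp add: set_lebesgue_integral_def)
  next
    case False
    then show ?thesis using d0'[of x] by (simp add: f_def)
  qed
  have outer: "(LINT x|lborel. f x t) = - (g t * \<phi> t)" for t
  proof (cases "A \<le> t")
    case True
    have "(LINT x|lborel. f x t) = (LINT x|lborel. g t * (deriv \<phi> x * indicator {t<..} x))"
      unfolding f_def using True by (intro Bochner_Integration.integral_cong) (auto simp: indicator_def)
    also have "\<dots> = g t * (LINT x|lborel. deriv \<phi> x * indicator {t<..} x)" by simp
    finally show ?thesis using tail[OF True] by simp
  next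
    case False
    then show ?thesis using \<phi>0[of t] by (simp add: f_def)
  qed
  have "(LINT x|lborel. deriv \<phi> x) = (LINT x|lborel. deriv \<phi> x * indicator {A..B} x)"
  proof -
    have "deriv \<phi> x * indicator {A..B} x = deriv \<phi> x" for x using d0'[of x] by (cases "x \<in> {A..B}") auto
    then show ?thesis by (simp only:)
  qed
  also have "\<dots> = 0"
    using integral_FTC_Icc_real[OF less_imp_le[OF AB] D dcI] \<phi>0[of A] \<phi>0[of B] by simp
  finally have dzero: "(LINT x|lborel. deriv \<phi> x) = 0" .
  have i1: "integrable lborel (\<lambda>x. U x * deriv \<phi> x)"
    by (rule loc_integrable_mult_test[OF loc_integrable_continuous[OF Uc] dc d0])
  have "(LINT x|lborel. U x * deriv \<phi> x) = (LINT x|lborel. U x * deriv \<phi> x) - U A * (LINT x|lborel. deriv \<phi> x)"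
    by (simp add: dzero)
  also have "\<dots> = (LINT x|lborel. (U x - U A) * deriv \<phi> x)"
    using i1 dint by (simp add: left_diff_distrib)
  also have "\<dots> = (LINT x|lborel. LINT t|lborel. f x t)" by (simp only: inner)
  also have "\<dots> = (LINT t|lborel. LINT x|lborel. f x t)"
    by (rule lborel_pair.Fubini_integral[OF fint, symmetric])
  also have "\<dots> = - (LINT x|lborel. g x * \<phi> x)" by (simp add: outer)
  finally show "(LINT x|lborel. U x * deriv \<phi> x) = - (LINT x|lborel. g x * \<phi> x)" .
qed

text \<open>This is what determines \<open>grad\<close> up to null sets, whatever representative was
  chosen.\<close>

lemma weak_derivative_unique:
  assumes "g \<in> L2" "k \<in> L2" "weak_derivative u g" "weak_derivative u k"
  shows "AE x in lborel. g x = k x"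
proof -
  have "AE x in lborel. g x - k x = 0"
  proof (rule fundamental_lemma)
    show "loc_integrable (\<lambda>x. g x - k x)"
      using assms by (intro loc_integrable_diff L2_loc_integrable)
    fix \<phi> assume \<phi>: "test_function \<phi>"
    have "(LINT x|lborel. (g x - k x) * \<phi> x) = (LINT x|lborel. g x * \<phi> x) - (LINT x|lborel. k x * \<phi> x)"
      using integrable_mult_test_function[OF L2_loc_integrable \<phi>] assms by (simp add: left_diff_distrib)
    then show "(LINT x|lborel. (g x - k x) * \<phi> x) = 0"
      using assms(3,4) \<phi> unfolding weak_derivative_def by auto
  qed
  then show ?thesis by simp
qed

lemma primitive_exists:
  assumes g: "g \<in> L2"
  obtains F where "\<And>x y. x \<le> y \<Longrightarrow> F y - F x = (LINT t:{x..<y}|lborel. g t)"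
proof -
  define F where "F = (\<lambda>x. if 0 \<le> x then (LINT t:{0..<x}|lborel. g t) else - (LINT t:{x..<0}|lborel. g t))"
  have "F y - F x = (LINT t:{x..<y}|lborel. g t)" if "x \<le> y" for x y
  proof -
    consider "0 \<le> x" | "x < 0" "0 \<le> y" | "x < 0" "y < 0" by linarith
    then show ?thesis
    proof cases
      case 1
      then show ?thesis using interval_integral_split[OF g 1 that] that by (simp add: F_def)
    next
      case 2
      then show ?thesis using interval_integral_split[OF g, of x 0 y] by (simp add: F_def)
    next
      case 3
      then show ?thesis using interval_integral_split[OF g that, of 0] by (simp add: F_def)
    qed
  qed
  then show ?thesis by (rule that)
qed

lemma AC_weak_derivative: "AC u g \<Longrightarrow> weak_derivative u g"
  by (rule increments_weak_derivative) (auto simp: AC_def)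

lemma weak_derivative_cong_AE:
  assumes "u \<in> borel_measurable borel" "v \<in> borel_measurable borel"
    and "AE x in lborel. u x = v x" and "weak_derivative u g"
  shows "weak_derivative v g"
  unfolding weak_derivative_def
proof (intro allI impI)
  fix \<phi> assume \<phi>: "test_function \<phi>"
  have [measurable]: "deriv \<phi> \<in> borel_measurable borel"
    by (rule borel_measurable_continuous_onI[OF test_function_continuous_deriv[OF \<phi>]])
  have "(LINT x|lborel. v x * deriv \<phi> x) = (LINT x|lborel. u x * deriv \<phi> x)"
    by (rule integral_cong_AE) (use assms in auto)
  then show "(LINT x|lborel. v x * deriv \<phi> x) = - (LINT x|lborel. g x * \<phi> x)"
    using assms(4) \<phi> by (simp add: weak_derivative_def)
qed

lemma grad_properties:
  assumes "u \<in> H1"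
  shows "grad u \<in> L2" "weak_derivative u (grad u)"
proof -
  have "\<exists>g. g \<in> L2 \<and> weak_derivative u g" using assms by (auto simp: H1_def)
  then have "grad u \<in> L2 \<and> weak_derivative u (grad u)" unfolding grad_def by (rule someI_ex)
  then show "grad u \<in> L2" "weak_derivative u (grad u)" by auto
qed

lemma AE_AC_imp_H1:
  assumes "AC u g" "v \<in> borel_measurable borel" "AE x in lborel. v x = u x"
  shows "v \<in> H1" "AE x in lborel. grad v x = g x"
proof -
  have eq: "AE x in lborel. u x = v x" using assms(3) by eventually_elim simp
  have v: "v \<in> L2" by (rule L2_cong_AE[OF AC_L2(1)[OF assms(1)] assms(2) eq])
  have w: "weak_derivative v g"
    by (rule weak_derivative_cong_AE[OF _ assms(2) eq AC_weak_derivative[OF assms(1)]])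
      (rule L2_measurable[OF AC_L2(1)[OF assms(1)]])
  show H: "v \<in> H1" using v w AC_L2(2)[OF assms(1)] by (auto simp: H1_def)
  show "AE x in lborel. grad v x = g x"
    by (rule weak_derivative_unique[OF grad_properties(1)[OF H] AC_L2(2)[OF assms(1)] grad_properties(2)[OF H] w])
qed

text \<open>A primitive \<open>F\<close> of \<open>grad u\<close> has the same weak derivative as
  \<open>u\<close>, so \<open>u - F\<close> is almost everywhere a constant by the lemma of du
  Bois-Reymond. Adding this constant to \<open>F\<close> makes it square integrable.\<close>

lemma H1_imp_AC:
  assumes "u \<in> H1"
  obtains U g where "AC U g" "AE x in lborel. u x = U x"
proof -
  define g where "g = grad u"
  have g: "g \<in> L2" and w: "weak_derivative u g" using grad_properties[OF assms] by (auto simp: g_def)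
  have u: "u \<in> L2" using assms by (simp add: H1_def)
  obtain F where F: "\<And>x y. x \<le> y \<Longrightarrow> F y - F x = (LINT t:{x..<y}|lborel. g t)"
    using primitive_exists[OF g] by blast
  have Fc: "continuous_on S F" for S
    by (rule Hoelder_imp_continuous) (rule increments_Hoelder[OF g F])
  have wF: "weak_derivative F g" by (rule increments_weak_derivative[OF g F])
  have "\<exists>c. AE x in lborel. u x - F x = c"
  proof (rule du_Bois_Reymond)
    show "loc_integrable (\<lambda>x. u x - F x)"
      by (intro loc_integrable_diff L2_loc_integrable[OF u] loc_integrable_continuous[OF Fc])
    fix \<phi> assume \<phi>: "test_function \<phi>"
    obtain A B where AB: "\<And>x. x \<notin> {A..B} \<Longrightarrow> \<phi> x = 0" using test_function_bounded_support[OF \<phi>] by blast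
    have d0: "deriv \<phi> x = 0" if "x \<notin> {A..B}" for x
      by (rule deriv_zero_outside[OF AB that])
    have "integrable lborel (\<lambda>x. u x * deriv \<phi> x)" "integrable lborel (\<lambda>x. F x * deriv \<phi> x)"
      by (rule loc_integrable_mult_test[OF L2_loc_integrable[OF u] test_function_continuous_deriv[OF \<phi>] d0],
        assumption, rule loc_integrable_mult_test[OF loc_integrable_continuous[OF Fc] test_function_continuous_deriv[OF \<phi>] d0],
        assumption)
    then have "(LINT x|lborel. (u x - F x) * deriv \<phi> x) = (LINT x|lborel. u x * deriv \<phi> x) - (LINT x|lborel. F x * deriv \<phi> x)"
      by (simp add: left_diff_distrib)
    then show "(LINT x|lborel. (u x - F x) * deriv \<phi> x) = 0"
      using w[unfolded weak_derivative_def, rule_format, OF \<phi>] wF[unfolded weak_derivative_def, rule_format, OF \<phi>]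
      by linarith
  qed
  then obtain c where c: "AE x in lborel. u x - F x = c" by blast
  have eq: "AE x in lborel. u x = F x + c" using c by eventually_elim simp
  have "(\<lambda>x. F x + c) \<in> borel_measurable borel"
    by (intro borel_measurable_continuous_onI continuous_intros Fc)
  then have "(\<lambda>x. F x + c) \<in> L2" by (rule L2_cong_AE[OF u _ eq])
  moreover have "(F y + c) - (F x + c) = (LINT t:{x..<y}|lborel. g t)" if "x \<le> y" for x y
    using F[OF that] by linarith
  ultimately have "AC (\<lambda>x. F x + c) g" using g unfolding AC_def by blast
  then show ?thesis using eq by (rule that)
qed

lemma AC_imp_H1: "AC u g \<Longrightarrow> u \<in> H1"
  by (rule AE_AC_imp_H1(1)[of u g u]) (auto intro: L2_measurable AC_L2(1))

lemma AC_deriv_unique: "AC u g \<Longrightarrow> AC u k \<Longrightarrow> AE x in lborel. g x = k x"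
  by (rule weak_derivative_unique[OF AC_L2(2) AC_L2(2) AC_weak_derivative AC_weak_derivative])

section \<open>Dyadic energies\<close>

text \<open>A continuous square-integrable function has a weak derivative in \<open>L\<^sup>2\<close> iff its dyadic
  energies are bounded: the step functions of dyadic slopes form an \<open>L\<^sup>2\<close>-bounded martingale.
  The nodes of level \<open>k\<close> cover \<open>[-k, k]\<close> with mesh \<open>2\<^sup>-\<^sup>k\<close>, so that all sums are finite and the
  nodes of level \<open>k\<close> are among those of every finer level.\<close>

definition node :: "nat \<Rightarrow> nat \<Rightarrow> real" where
  "node k i = real i / 2 ^ k - real k"

definition cells :: "nat \<Rightarrow> nat" where
  "cells k = 2 * k * 2 ^ k"

definition slope :: "(real \<Rightarrow> real) \<Rightarrow> nat \<Rightarrow> nat \<Rightarrow> real" where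
  "slope f k i = 2 ^ k * (f (node k (Suc i)) - f (node k i))"

definition step_slope :: "(real \<Rightarrow> real) \<Rightarrow> nat \<Rightarrow> real \<Rightarrow> real" where
  "step_slope f k x = (\<Sum>i<cells k. slope f k i * indicator {node k i..<node k (Suc i)} x)"

text \<open>The squared \<open>L2\<close> norm of \<open>step_slope f k\<close>, since cells have
  length \<open>1 / 2 ^ k\<close>. Being a polynomial in finitely many values of \<open>f\<close>,
  it is continuous under pointwise convergence.\<close>

definition energy :: "(real \<Rightarrow> real) \<Rightarrow> nat \<Rightarrow> real" where
  "energy f k = (\<Sum>i<cells k. 2 ^ k * (f (node k (Suc i)) - f (node k i))\<^sup>2)"

lemma node_mono: "i \<le> j \<Longrightarrow> node k i \<le> node k j"
  by (simp add: node_def divide_right_mono)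

lemma node_Suc: "node k (Suc i) - node k i = 1 / 2 ^ k"
  by (simp add: node_def add_divide_distrib)

lemma L2_sum:
  assumes "\<And>i. i \<in> I \<Longrightarrow> u i \<in> L2"
  shows "(\<lambda>x. \<Sum>i\<in>I. u i x) \<in> L2"
  using assms
proof (induction I rule: infinite_finite_induct)
  case (insert i I)
  then show ?case using L2_add[of "u i" "\<lambda>x. \<Sum>i\<in>I. u i x"] by simp
qed (auto simp: L2_def)

lemma step_slope_L2: "step_slope f k \<in> L2"
  unfolding step_slope_def[abs_def] by (intro L2_sum L2_scale indicator_interval_L2)

lemma step_slope_inner:
  assumes "G \<in> L2"
  shows "(LINT x|lborel. step_slope f k x * G x)
    = (\<Sum>i<cells k. slope f k i * (LINT x:{node k i..<node k (Suc i)}|lborel. G x))"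
proof -
  have i: "integrable lborel (\<lambda>x. slope f k i * (indicator {node k i..<node k (Suc i)} x * G x))" for i
    by (intro integrable_mult_right L2_integrable_mult indicator_interval_L2 assms)
  have "(LINT x|lborel. step_slope f k x * G x)
      = (LINT x|lborel. (\<Sum>i<cells k. slope f k i * (indicator {node k i..<node k (Suc i)} x * G x)))"
    by (simp only: step_slope_def sum_distrib_right mult.assoc)
  also have "\<dots> = (\<Sum>i<cells k. LINT x|lborel. slope f k i * (indicator {node k i..<node k (Suc i)} x * G x))"
    using i by (rule Bochner_Integration.integral_sum)
  finally show ?thesis by (simp add: set_lebesgue_integral_def)
qed

text \<open>Each cell contributes slope times increment. The hypothesis is met by finer step slopes
  of \<open>f\<close> and by a true derivative of \<open>f\<close>, and the lemma is used for
  both.\<close>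

lemma step_slope_inner_matching:
  assumes "G \<in> L2"
    and "\<And>i. i < cells k \<Longrightarrow> (LINT x:{node k i..<node k (Suc i)}|lborel. G x) = f (node k (Suc i)) - f (node k i)"
  shows "(LINT x|lborel. step_slope f k x * G x) = energy f k"
  unfolding step_slope_inner[OF assms(1)] energy_def
  by (rule sum.cong) (auto simp: assms(2) slope_def power2_eq_square)

lemma step_slope_on_cell:
  assumes "j < cells k" "x \<in> {node k j..<node k (Suc j)}"
  shows "step_slope f k x = slope f k j"
proof -
  have ind: "indicator {node k i..<node k (Suc i)} x = (if i = j then 1 else 0 :: real)" for i
  proof (cases i j rule: linorder_cases)
    case less
    then have "node k (Suc i) \<le> node k j" by (intro node_mono) auto
    then show ?thesis using assms less by auto
  next
    case greater
    then have "node k (Suc j) \<le> node k i" by (intro node_mono) auto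
    then show ?thesis using assms greater by auto
  qed (use assms in auto)
  have "step_slope f k x = (\<Sum>i<cells k. if i = j then slope f k i else 0)"
    unfolding step_slope_def ind by (rule sum.cong) auto
  then show ?thesis using assms(1) by simp
qed

lemma step_slope_integral_nodes:
  assumes "a \<le> b" "b \<le> cells k"
  shows "(LINT x:{node k a..<node k b}|lborel. step_slope f k x) = f (node k b) - f (node k a)"
  using assms
proof (induction b rule: dec_induct)
  case base
  then show ?case by (simp add: set_lebesgue_integral_def)
next
  case (step n)
  have "(LINT x:{node k a..<node k (Suc n)}|lborel. step_slope f k x)
      = (LINT x:{node k a..<node k n}|lborel. step_slope f k x) + (LINT x:{node k n..<node k (Suc n)}|lborel. step_slope f k x)"
    using step by (intro interval_integral_split step_slope_L2 node_mono) auto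
  also have "(LINT x:{node k n..<node k (Suc n)}|lborel. step_slope f k x) = (LINT x:{node k n..<node k (Suc n)}|lborel. slope f k n)"
    unfolding set_lebesgue_integral_def using step
    by (intro Bochner_Integration.integral_cong) (auto simp: step_slope_on_cell indicator_def)
  also have "\<dots> = f (node k (Suc n)) - f (node k n)"
    using node_mono[of n "Suc n" k] by (simp add: set_lebesgue_integral_def node_Suc slope_def)
  finally show ?case using step by simp
qed

text \<open>Level \<open>l\<close> starts at \<open>-l\<close>, which is
  \<open>(l - k) * 2 ^ l\<close> fine cells before the start \<open>-k\<close> of level
  \<open>k\<close>; each coarse cell consists of \<open>2 ^ (l - k)\<close> fine ones.\<close>

lemma node_refine:
  assumes "k \<le> l"
  shows "node k i = node l ((l - k) * 2 ^ l + i * 2 ^ (l - k))"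
proof -
  have "(2::real) ^ l = 2 ^ (l - k) * 2 ^ k" using assms by (simp flip: power_add)
  then show ?thesis using assms by (simp add: node_def of_nat_diff field_simps)
qed

lemma cells_refine:
  assumes "k \<le> l" "i \<le> cells k"
  shows "(l - k) * 2 ^ l + i * 2 ^ (l - k) \<le> cells l"
proof -
  have "i * 2 ^ (l - k) \<le> (2 * k * 2 ^ k) * 2 ^ (l - k)" using assms(2) by (simp add: cells_def)
  also have "\<dots> = 2 * k * 2 ^ l" using assms(1) by (simp flip: power_add add: mult.assoc)
  finally have "(l - k) * 2 ^ l + i * 2 ^ (l - k) \<le> (l - k) * 2 ^ l + 2 * k * 2 ^ l" by simp
  also have "\<dots> = (l - k + 2 * k) * 2 ^ l" by (simp add: add_mult_distrib)
  also have "\<dots> \<le> (2 * l) * 2 ^ l" using assms(1) by (intro mult_right_mono) auto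
  finally show ?thesis by (simp add: cells_def)
qed

lemma step_slope_integral_coarse_nodes:
  assumes "k \<le> l" "a \<le> b" "b \<le> cells k"
  shows "(LINT x:{node k a..<node k b}|lborel. step_slope f l x) = f (node k b) - f (node k a)"
  unfolding node_refine[OF assms(1)] using assms
  by (intro step_slope_integral_nodes cells_refine) auto

text \<open>The martingale property: \<open>step_slope f l - step_slope f k\<close> is orthogonal to
  \<open>step_slope f k\<close>, so squared distances between levels are energy differences.\<close>

lemma step_slope_inner_step_slope:
  assumes "k \<le> l"
  shows "(LINT x|lborel. step_slope f k x * step_slope f l x) = energy f k"
  by (rule step_slope_inner_matching[OF step_slope_L2]) (rule step_slope_integral_coarse_nodes[OF assms], auto)

lemma sqint_step_slope: "sqint (step_slope f k) = energy f k"
  using step_slope_inner_step_slope[of k k f] by (simp add: power2_eq_square)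

lemma sqint_step_slope_diff:
  assumes "k \<le> l"
  shows "sqint (\<lambda>x. step_slope f l x - step_slope f k x) = energy f l - energy f k"
  unfolding sqint_diff[OF step_slope_L2 step_slope_L2] sqint_step_slope
  using step_slope_inner_step_slope[OF assms, of f] by (simp add: mult.commute)

lemma energy_mono: "k \<le> l \<Longrightarrow> energy f k \<le> energy f l"
  using sqint_step_slope_diff[of k l f] sqint_nonneg[of "\<lambda>x. step_slope f l x - step_slope f k x"] by linarith

lemma energy_nonneg: "energy f k \<ge> 0"
  using sqint_step_slope[of f k] sqint_nonneg by metis

text \<open>A Bessel inequality: pairing the step slope with \<open>g\<close> gives the energy, and
  Cauchy-Schwarz bounds its square by the energy times \<open>sqint g\<close>.\<close>

lemma energy_le_sqint:
  assumes "AC f g"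
  shows "energy f k \<le> sqint g"
proof -
  have g: "g \<in> L2" by (rule AC_L2(2)[OF assms])
  have "(LINT x|lborel. step_slope f k x * g x) = energy f k"
    using assms node_mono[of _ "Suc _" k] by (intro step_slope_inner_matching[OF g]) (auto simp: AC_def)
  then have "(energy f k)\<^sup>2 \<le> energy f k * sqint g"
    using L2_Cauchy_Schwarz[OF step_slope_L2[of f k] g] by (simp add: sqint_step_slope)
  then show ?thesis
    using energy_nonneg[of f k] sqint_nonneg[of g] by (cases "energy f k = 0") (auto simp: power2_eq_square)
qed

text \<open>A point of the grid with mesh \<open>1 / 2 ^ j\<close> just to the left of
  \<open>x\<close>; it is a node of level \<open>j\<close> once
  \<open>\<bar>x\<bar> \<le> j\<close>.\<close>

definition dyadic_floor :: "nat \<Rightarrow> real \<Rightarrow> real" where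
  "dyadic_floor j x = real_of_int \<lfloor>2 ^ j * x\<rfloor> / 2 ^ j"

lemma dyadic_floor_le: "dyadic_floor j x \<le> x"
  unfolding dyadic_floor_def by (subst pos_divide_le_eq) (auto simp: mult.commute)

lemma dyadic_floor_gt: "x - 1 / 2 ^ j \<le> dyadic_floor j x"
proof -
  have "2 ^ j * x - 1 \<le> real_of_int \<lfloor>2 ^ j * x\<rfloor>" by linarith
  then have "(2 ^ j * x - 1) / 2 ^ j \<le> dyadic_floor j x"
    unfolding dyadic_floor_def by (intro divide_right_mono) auto
  then show ?thesis by (simp add: diff_divide_distrib)
qed

lemma dyadic_floor_mono: "x \<le> y \<Longrightarrow> dyadic_floor j x \<le> dyadic_floor j y"
  unfolding dyadic_floor_def by (intro divide_right_mono) (auto intro: floor_mono)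

lemma dyadic_floor_tendsto: "(\<lambda>j. dyadic_floor j x) \<longlonglongrightarrow> x"
proof (rule tendsto_sandwich)
  have "(\<lambda>j. x - (1 / 2) ^ j) \<longlonglongrightarrow> x - 0" by (intro tendsto_intros LIMSEQ_power_zero) auto
  then show "(\<lambda>j. x - 1 / 2 ^ j) \<longlonglongrightarrow> x" by (simp add: power_one_over)
qed (auto simp: dyadic_floor_le dyadic_floor_gt)

lemma dyadic_floor_node:
  assumes "\<bar>x\<bar> \<le> real j"
  obtains i where "dyadic_floor j x = node j i" "i \<le> cells j"
proof -
  define z where "z = \<lfloor>2 ^ j * x\<rfloor> + int (j * 2 ^ j)"
  have "real_of_int (- int (j * 2 ^ j)) \<le> 2 ^ j * x"
    using assms mult_left_mono[of "- real j" x "2 ^ j"] by (simp add: mult.commute abs_le_iff)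
  then have z0: "z \<ge> 0" unfolding z_def by (simp only: le_floor_iff[symmetric])
  have "2 ^ j * x \<le> real_of_int (int (j * 2 ^ j))"
    using assms mult_left_mono[of x "real j" "2 ^ j"] by (simp add: mult.commute abs_le_iff)
  then have "\<lfloor>2 ^ j * x\<rfloor> \<le> int (j * 2 ^ j)" by linarith
  then have "z \<le> int (cells j)" by (simp add: z_def cells_def)
  then have "nat z \<le> cells j" by simp
  moreover have "dyadic_floor j x = node j (nat z)"
    using z0 by (simp add: dyadic_floor_def node_def z_def field_simps)
  ultimately show ?thesis using that by blast
qed

text \<open>The energies increase to a finite limit, so the step slopes are Cauchy in
  \<open>L2\<close>. Their limit \<open>g\<close> has the increments of \<open>f\<close> as
  integrals between nodes, and continuity of \<open>f\<close> extends this to arbitrary end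
  points.\<close>

theorem energy_bounded_imp_AC:
  assumes f: "continuous_on UNIV f" "f \<in> L2" and M: "\<And>k. energy f k \<le> M"
  obtains g where "AC f g" "sqint g \<le> M" "(\<lambda>k. sqint (\<lambda>x. g x - step_slope f k x)) \<longlonglongrightarrow> 0"
proof -
  obtain S where S: "(\<lambda>k. energy f k) \<longlonglongrightarrow> S" "\<And>k. energy f k \<le> S"
    using incseq_convergent[of "energy f" M] energy_mono M by (auto simp: incseq_def)
  have e: "(\<lambda>k. S - energy f k) \<longlonglongrightarrow> 0" using tendsto_diff[OF tendsto_const S(1), of S] by simp
  obtain g where g: "g \<in> L2" and ge: "\<And>k. sqint (\<lambda>x. g x - step_slope f k x) \<le> S - energy f k"
  proof (rule L2_complete[of "step_slope f" "\<lambda>k. S - energy f k"])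
    show "sqint (\<lambda>x. step_slope f l x - step_slope f k x) \<le> S - energy f k" if "k \<le> l" for k l
      using sqint_step_slope_diff[OF that, of f] S(2)[of l] by simp
  qed (use step_slope_L2 e that in auto)
  have lim0: "(\<lambda>k. sqint (\<lambda>x. g x - step_slope f k x)) \<longlonglongrightarrow> 0"
    by (rule tendsto_sandwich[OF _ _ tendsto_const e]) (auto simp: ge)
  have nodes: "(LINT x:{node k a..<node k b}|lborel. g x) = f (node k b) - f (node k a)"
    if ab: "a \<le> b" "b \<le> cells k" for k a b
  proof -
    \<comment> \<open>From level \<open>k\<close> on, step slopes integrate between these nodes
      exactly to the increment of \<open>f\<close>. So \<open>D\<close> is the integral of
      \<open>g - step_slope f l\<close> for every \<open>l \<ge> k\<close>, and that tends to
      0.\<close>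
    define D where "D = (LINT x:{node k a..<node k b}|lborel. g x) - (f (node k b) - f (node k a))"
    have "D\<^sup>2 \<le> (node k b - node k a) * sqint (\<lambda>x. g x - step_slope f l x)" if "k \<le> l" for l
    proof -
      have "D = (LINT x:{node k a..<node k b}|lborel. g x) - (LINT x:{node k a..<node k b}|lborel. step_slope f l x)"
        using step_slope_integral_coarse_nodes[OF that ab] by (simp add: D_def)
      also have "\<dots> = (LINT x:{node k a..<node k b}|lborel. g x - step_slope f l x)"
        by (rule set_integral_diff(2)[symmetric]) (intro L2_set_integrable g step_slope_L2)+
      finally show ?thesis
        using L2_interval_integral_bound[OF L2_diff[OF g step_slope_L2[of f l]] node_mono[OF ab(1), of k]] by simp
    qed
    moreover have "(\<lambda>l. (node k b - node k a) * sqint (\<lambda>x. g x - step_slope f l x)) \<longlonglongrightarrow> (node k b - node k a) * 0"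
      by (intro tendsto_intros lim0)
    ultimately have "D\<^sup>2 \<le> (node k b - node k a) * 0"
      by (intro LIMSEQ_le_const) auto
    then show ?thesis by (simp add: D_def)
  qed
  have incr: "f y - f x = (LINT t:{x..<y}|lborel. g t)" if "x \<le> y" for x y
  proof -
    obtain n :: nat where n: "\<bar>x\<bar> \<le> real n" "\<bar>y\<bar> \<le> real n"
      using real_arch_simple[of "max \<bar>x\<bar> \<bar>y\<bar>"] by auto
    let ?d = "dyadic_floor"
    let ?I = "\<lambda>a b. LINT t:{a..<b}|lborel. g t"
    \<comment> \<open>The interval from \<open>?d j x\<close> to \<open>y\<close> is cut once at
      \<open>?d j y\<close> and once at \<open>x\<close>; the two short pieces vanish in the
      limit.\<close>
    have eq: "f (?d j y) - f (?d j x) + ?I (?d j y) y = ?I (?d j x) x + ?I x y" if nj: "n \<le> j" for j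
    proof -
      obtain a where a: "?d j x = node j a" "a \<le> cells j"
        using n(1) nj by (auto intro: dyadic_floor_node[of x j])
      obtain b where b: "?d j y = node j b" "b \<le> cells j"
        using n(2) nj by (auto intro: dyadic_floor_node[of y j])
      have "node j a \<le> node j b" using dyadic_floor_mono[OF \<open>x \<le> y\<close>, of j] a b by simp
      then have "a \<le> b" by (simp add: node_def divide_le_cancel)
      then have "f (?d j y) - f (?d j x) = ?I (?d j x) (?d j y)" using nodes[of a b j] a b by simp
      moreover have "?I (?d j x) y = ?I (?d j x) (?d j y) + ?I (?d j y) y"
        using \<open>x \<le> y\<close> by (intro interval_integral_split g dyadic_floor_mono dyadic_floor_le)
      moreover have "?I (?d j x) y = ?I (?d j x) x + ?I x y"
        using \<open>x \<le> y\<close> by (intro interval_integral_split g dyadic_floor_le)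
      ultimately show ?thesis by simp
    qed
    have small: "(\<lambda>j. ?I (?d j z) z) \<longlonglongrightarrow> 0" for z
    proof (rule Lim_null_comparison)
      have "(\<lambda>j. sqrt ((z - ?d j z) * sqint g)) \<longlonglongrightarrow> sqrt ((z - z) * sqint g)"
        by (intro tendsto_intros dyadic_floor_tendsto)
      then show "(\<lambda>j. sqrt ((z - ?d j z) * sqint g)) \<longlonglongrightarrow> 0" by simp
      show "\<forall>\<^sub>F j in sequentially. norm (?I (?d j z) z) \<le> sqrt ((z - ?d j z) * sqint g)"
        using L2_interval_integral_bound[OF g dyadic_floor_le] by (auto intro!: always_eventually real_le_rsqrt)
    qed
    have fc: "(\<lambda>j. f (?d j z)) \<longlonglongrightarrow> f z" for z
      using f(1) isCont_tendsto_compose[OF _ dyadic_floor_tendsto[of z]] by (auto simp: continuous_on_eq_continuous_at)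
    have "(\<lambda>j. f (?d j y) - f (?d j x) + ?I (?d j y) y) \<longlonglongrightarrow> f y - f x + 0"
      by (intro tendsto_intros fc small)
    moreover have "(\<lambda>j. ?I (?d j x) x + ?I x y) \<longlonglongrightarrow> 0 + ?I x y"
      by (intro tendsto_intros small)
    moreover have "\<forall>\<^sub>F j in sequentially. f (?d j y) - f (?d j x) + ?I (?d j y) y = ?I (?d j x) x + ?I x y"
      using eq by (auto simp: eventually_sequentially)
    ultimately have "(\<lambda>j. ?I (?d j x) x + ?I x y) \<longlonglongrightarrow> f y - f x + 0"
      by (blast intro: Lim_transform_eventually)
    then have "f y - f x + 0 = 0 + ?I x y"
      using \<open>(\<lambda>j. ?I (?d j x) x + ?I x y) \<longlonglongrightarrow> 0 + ?I x y\<close> by (rule LIMSEQ_unique)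
    then show ?thesis by simp
  qed
  have "AC f g" using f g incr by (simp add: AC_def)
  moreover have "sqint g \<le> M"
  proof -
    \<comment> \<open>With this pairing the squared distance from \<open>g\<close> to
      \<open>step_slope f 0\<close> equals \<open>sqint g - energy f 0\<close>, and the energy
      cancels against the bound \<open>S - energy f 0\<close>.\<close>
    have "(LINT x|lborel. step_slope f 0 x * g x) = energy f 0"
      by (rule step_slope_inner_matching[OF g]) (rule nodes, auto)
    then have "sqint g \<le> S"
      using ge[of 0] sqint_diff[OF g step_slope_L2[of f 0]] by (simp add: sqint_step_slope mult.commute)
    also have "S \<le> M" using S(1) M by (intro LIMSEQ_le_const2) auto
    finally show ?thesis .
  qed
  ultimately show ?thesis using lim0 by (rule that)
qed

section \<open>Limits and quadratic means\<close>

text \<open>The step slopes converge to some derivative of \<open>f\<close>, and derivatives are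
  unique almost everywhere.\<close>

lemma AC_step_slope_approx:
  assumes "AC f g"
  shows "(\<lambda>k. sqint (\<lambda>x. g x - step_slope f k x)) \<longlonglongrightarrow> 0"
proof -
  obtain h where h: "AC f h" "(\<lambda>k. sqint (\<lambda>x. h x - step_slope f k x)) \<longlonglongrightarrow> 0"
    using energy_bounded_imp_AC[OF AC_continuous[OF assms] AC_L2(1)[OF assms] energy_le_sqint[OF assms]] by blast
  have "sqint (\<lambda>x. g x - step_slope f k x) = sqint (\<lambda>x. h x - step_slope f k x)" for k
  proof (rule sqint_cong_AE)
    show "AE x in lborel. g x - step_slope f k x = h x - step_slope f k x"
      using AC_deriv_unique[OF assms h(1)] by eventually_elim simp
  qed (auto intro!: L2_measurable L2_diff step_slope_L2 AC_L2(2)[OF assms] AC_L2(2)[OF h(1)])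
  then show ?thesis using h(2) by simp
qed

text \<open>Paired with a step slope of \<open>f\<close>, the gradients give a finite combination of
  point values of \<open>w n\<close>, which tends to 0. Replacing \<open>g\<close> by a step slope
  costs little, uniformly in \<open>n\<close>, by Cauchy-Schwarz.\<close>

lemma AC_gradient_weak_null:
  assumes f: "AC f g" and w: "\<And>n. AC (w n) (p n)" and M: "\<And>n. sqint (p n) \<le> M"
    and lim: "\<And>x. (\<lambda>n. w n x) \<longlonglongrightarrow> 0"
  shows "(\<lambda>n. LINT x|lborel. g x * p n x) \<longlonglongrightarrow> 0"
proof (rule LIMSEQ_I)
  fix e :: real assume e: "e > 0"
  have gL: "g \<in> L2" and pL: "p n \<in> L2" for n
    by (rule AC_L2(2)[OF f], rule AC_L2(2)[OF w])
  have "(\<lambda>k. sqrt (sqint (\<lambda>x. g x - step_slope f k x)) * sqrt M) \<longlonglongrightarrow> sqrt 0 * sqrt M"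
    by (intro tendsto_intros AC_step_slope_approx[OF f])
  then have "\<forall>\<^sub>F k in sequentially. sqrt (sqint (\<lambda>x. g x - step_slope f k x)) * sqrt M < e / 2"
    using e by (intro order_tendstoD) auto
  then obtain k where k: "sqrt (sqint (\<lambda>x. g x - step_slope f k x)) * sqrt M < e / 2"
    by (metis (mono_tags, lifting) eventually_sequentially order_refl)
  let ?s = "step_slope f k"
  have inner: "(LINT x|lborel. ?s x * p n x) = (\<Sum>i<cells k. slope f k i * (w n (node k (Suc i)) - w n (node k i)))" for n
    unfolding step_slope_inner[OF pL] using w[of n] node_mono[of _ "Suc _" k] by (auto simp: AC_def)
  have "(\<lambda>n. \<Sum>i<cells k. slope f k i * (w n (node k (Suc i)) - w n (node k i))) \<longlonglongrightarrow> (\<Sum>i<cells k. slope f k i * (0 - 0))"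
    by (intro tendsto_intros lim)
  then have "\<forall>\<^sub>F n in sequentially. \<bar>\<Sum>i<cells k. slope f k i * (w n (node k (Suc i)) - w n (node k i))\<bar> < e / 2"
    using e by (intro order_tendstoD[OF tendsto_rabs_zero]) auto
  then obtain N where N: "\<And>n. n \<ge> N \<Longrightarrow> \<bar>LINT x|lborel. ?s x * p n x\<bar> < e / 2"
    unfolding eventually_sequentially inner by blast
  show "\<exists>N. \<forall>n\<ge>N. norm ((LINT x|lborel. g x * p n x) - 0) < e"
  proof (intro exI[of _ N] allI impI)
    fix n assume n: "N \<le> n"
    have "(LINT x|lborel. g x * p n x) = (LINT x|lborel. (g x - ?s x) * p n x + ?s x * p n x)"
      by (simp add: algebra_simps)
    also have "\<dots> = (LINT x|lborel. (g x - ?s x) * p n x) + (LINT x|lborel. ?s x * p n x)"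
      by (intro Bochner_Integration.integral_add L2_integrable_mult L2_diff gL pL step_slope_L2)
    finally have eq: "(LINT x|lborel. g x * p n x) = (LINT x|lborel. (g x - ?s x) * p n x) + (LINT x|lborel. ?s x * p n x)" .
    have "\<bar>LINT x|lborel. (g x - ?s x) * p n x\<bar> \<le> sqrt (sqint (\<lambda>x. g x - ?s x)) * sqrt (sqint (p n))"
      by (intro L2_Cauchy_Schwarz_abs L2_diff gL pL step_slope_L2)
    also have "\<dots> \<le> sqrt (sqint (\<lambda>x. g x - ?s x)) * sqrt M"
      using M[of n] by (intro mult_left_mono) auto
    finally show "norm ((LINT x|lborel. g x * p n x) - 0) < e"
      using k N[OF n] eq by simp
  qed
qed

text \<open>Fatou's lemma preserves the mass bound, the uniform Hoelder estimate gives continuity,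
  and each energy passes to the limit as a finite sum, so all of them stay below
  \<open>M\<close>.\<close>

lemma AC_limit:
  assumes u: "\<And>n. AC (u n) (g n)" and B: "\<And>n. sqint (u n) \<le> B" and M: "\<And>n. sqint (g n) \<le> M"
    and lim: "\<And>x. (\<lambda>n. u n x) \<longlonglongrightarrow> f x"
  obtains h where "AC f h" "sqint h \<le> M"
proof -
  have [measurable]: "u n \<in> borel_measurable borel" for n by (rule L2_measurable[OF AC_L2(1)[OF u]])
  have fm[measurable]: "f \<in> borel_measurable borel"
    by (rule borel_measurable_LIMSEQ_real[OF lim]) auto
  have "(f y - f x)\<^sup>2 \<le> \<bar>y - x\<bar> * M" for x y
  proof (rule LIMSEQ_le_const2)
    show "(\<lambda>n. (u n y - u n x)\<^sup>2) \<longlonglongrightarrow> (f y - f x)\<^sup>2" by (intro tendsto_intros lim)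
    have "(u n y - u n x)\<^sup>2 \<le> \<bar>y - x\<bar> * M" for n
      using AC_Hoelder[OF u, of n y x] mult_left_mono[OF M[of n], of "\<bar>y - x\<bar>"] by linarith
    then show "\<exists>N. \<forall>n\<ge>N. (u n y - u n x)\<^sup>2 \<le> \<bar>y - x\<bar> * M" by blast
  qed
  then have fc: "continuous_on UNIV f" by (rule Hoelder_imp_continuous)
  have "(\<integral>\<^sup>+x. ennreal ((f x)\<^sup>2) \<partial>lborel) = (\<integral>\<^sup>+x. liminf (\<lambda>n. ennreal ((u n x)\<^sup>2)) \<partial>lborel)"
  proof (rule nn_integral_cong)
    fix x
    have "(\<lambda>n. ennreal ((u n x)\<^sup>2)) \<longlonglongrightarrow> ennreal ((f x)\<^sup>2)"
      by (intro tendsto_intros lim)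
    then show "ennreal ((f x)\<^sup>2) = liminf (\<lambda>n. ennreal ((u n x)\<^sup>2))"
      by (rule lim_imp_Liminf[OF sequentially_bot, symmetric])
  qed
  also have "\<dots> \<le> liminf (\<lambda>n. \<integral>\<^sup>+x. ennreal ((u n x)\<^sup>2) \<partial>lborel)"
    by (rule nn_integral_liminf) auto
  also have "\<dots> \<le> ennreal B"
  proof (rule Liminf_le)
    have "(\<integral>\<^sup>+x. ennreal ((u n x)\<^sup>2) \<partial>lborel) \<le> ennreal B" for n
      using L2_integrable_power2[OF AC_L2(1)[OF u]] B[of n]
      by (subst nn_integral_eq_integral) (auto intro: ennreal_leI)
    then show "\<forall>\<^sub>F n in sequentially. (\<integral>\<^sup>+x. ennreal ((u n x)\<^sup>2) \<partial>lborel) \<le> ennreal B" by simp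
  qed auto
  finally have "(\<integral>\<^sup>+x. ennreal ((f x)\<^sup>2) \<partial>lborel) \<le> ennreal B" .
  then have fL: "f \<in> L2"
    by (intro L2_I integrableI_bounded) (auto simp: top_unique less_top[symmetric])
  have en: "energy f k \<le> M" for k
  proof (rule LIMSEQ_le_const2)
    show "(\<lambda>n. energy (u n) k) \<longlonglongrightarrow> energy f k"
      unfolding energy_def by (intro tendsto_intros lim)
    have "energy (u n) k \<le> M" for n using energy_le_sqint[OF u, of n k] M[of n] by linarith
    then show "\<exists>N. \<forall>n\<ge>N. energy (u n) k \<le> M" by blast
  qed
  show ?thesis by (rule energy_bounded_imp_AC[OF fc fL en]) (rule that)
qed

text \<open>By the reverse triangle inequality in the plane, the increments of \<open>sqrt (u\<^sup>2 + w\<^sup>2)\<close>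
  are dominated by those of \<open>(u, w)\<close>, so no chain rule at the zeros is needed.\<close>

lemma AC_merge:
  assumes u: "AC u g" and w: "AC w p"
  obtains q where "AC (\<lambda>x. sqrt ((u x)\<^sup>2 + (w x)\<^sup>2)) q" "sqint q \<le> sqint g + sqint p"
    "sqint (\<lambda>x. sqrt ((u x)\<^sup>2 + (w x)\<^sup>2)) = sqint u + sqint w"
proof -
  define h where "h = (\<lambda>x. sqrt ((u x)\<^sup>2 + (w x)\<^sup>2))"
  have h2: "(h x)\<^sup>2 = (u x)\<^sup>2 + (w x)\<^sup>2" for x by (simp add: h_def)
  have uw: "integrable lborel (\<lambda>x. (u x)\<^sup>2)" "integrable lborel (\<lambda>x. (w x)\<^sup>2)"
    using AC_L2(1)[OF u] AC_L2(1)[OF w] by (auto intro: L2_integrable_power2)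
  have hc: "continuous_on UNIV h"
    unfolding h_def by (intro continuous_intros AC_continuous[OF u] AC_continuous[OF w])
  have hL: "h \<in> L2"
    using uw borel_measurable_continuous_onI[OF hc] by (auto simp: L2_def h2)
  have incr: "(h y - h x)\<^sup>2 \<le> (u y - u x)\<^sup>2 + (w y - w x)\<^sup>2" for x y
  proof -
    have "\<bar>norm (u y, w y) - norm (u x, w x)\<bar> \<le> norm ((u y, w y) - (u x, w x))"
      by (rule norm_triangle_ineq3)
    then have "\<bar>h y - h x\<bar> \<le> sqrt ((u y - u x)\<^sup>2 + (w y - w x)\<^sup>2)"
      by (simp add: norm_Pair h_def)
    then have "\<bar>h y - h x\<bar>\<^sup>2 \<le> (sqrt ((u y - u x)\<^sup>2 + (w y - w x)\<^sup>2))\<^sup>2"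
      by (intro power_mono) auto
    then show ?thesis by simp
  qed
  have en: "energy h k \<le> sqint g + sqint p" for k
  proof -
    have "energy h k \<le> energy u k + energy w k"
      unfolding energy_def sum.distrib[symmetric] distrib_left[symmetric]
      by (intro sum_mono mult_left_mono incr) auto
    then show ?thesis using energy_le_sqint[OF u, of k] energy_le_sqint[OF w, of k] by simp
  qed
  obtain q where "AC h q" "sqint q \<le> sqint g + sqint p"
    by (rule energy_bounded_imp_AC[OF hc hL en])
  moreover have "sqint h = sqint u + sqint w" unfolding h2 using uw by simp
  ultimately show ?thesis using that unfolding h_def by blast
qed

section \<open>Vanishing pairings and pointwise compactness\<close>

lemma tendsto_tail_zero:
  assumes "u \<in> L2"
  shows "(\<lambda>n. sqint (\<lambda>x. u x * indicator (- {- real n..<real n}) x)) \<longlonglongrightarrow> 0"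
proof -
  have [measurable]: "u \<in> borel_measurable borel" by (rule L2_measurable[OF assms])
  have "(\<lambda>n. sqint (\<lambda>x. u x * indicator (- {- real n..<real n}) x)) \<longlonglongrightarrow> (LINT x|(lborel :: real measure). 0)"
  proof (rule integral_dominated_convergence)
    show "integrable lborel (\<lambda>x. (u x)\<^sup>2)" by (rule L2_integrable_power2[OF assms])
    show "AE x in lborel. (\<lambda>n. (u x * indicator (- {- real n..<real n}) x)\<^sup>2) \<longlonglongrightarrow> 0"
    proof (rule AE_I2, rule tendsto_eventually)
      fix x :: real
      obtain N where N: "\<bar>x\<bar> < real N" using reals_Archimedean2 by blast
      have "(u x * indicator (- {- real n..<real n}) x)\<^sup>2 = 0" if "N \<le> n" for n
      proof -
        have "\<bar>x\<bar> < real n" using N that by (meson of_nat_mono order.strict_trans2)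
        then show ?thesis by (simp add: abs_less_iff less_imp_le)
      qed
      then show "\<forall>\<^sub>F n in sequentially. (u x * indicator (- {- real n..<real n}) x)\<^sup>2 = 0"
        unfolding eventually_sequentially by blast
    qed
    show "AE x in lborel. norm ((u x * indicator (- {- real n..<real n}) x)\<^sup>2) \<le> (u x)\<^sup>2" for n
      by (auto simp: indicator_def)
  qed auto
  then show ?thesis by simp
qed

lemma L2_abs: "u \<in> L2 \<Longrightarrow> (\<lambda>x. \<bar>u x\<bar>) \<in> L2"
  by (auto simp: L2_def)

text \<open>Outside a large interval \<open>u\<close> has little mass and Cauchy-Schwarz suffices;
  inside, the uniform bound \<open>S\<close> permits dominated convergence. The absolute values are
  needed because the interaction of potentials is estimated by such products.\<close>

lemma L2_weak_null:
  assumes u: "u \<in> L2" and w: "\<And>n. w n \<in> L2" and B: "\<And>n. sqint (w n) \<le> B"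
    and S: "\<And>n x. \<bar>w n x\<bar> \<le> S" and lim: "\<And>x. (\<lambda>n. w n x) \<longlonglongrightarrow> 0"
  shows "(\<lambda>n. LINT x|lborel. \<bar>u x\<bar> * \<bar>w n x\<bar>) \<longlonglongrightarrow> 0"
proof (rule LIMSEQ_I)
  fix e :: real assume e: "e > 0"
  have [measurable]: "u \<in> borel_measurable borel" "\<And>n. w n \<in> borel_measurable borel"
    using u w by (auto intro: L2_measurable)
  have "(\<lambda>k. sqrt (sqint (\<lambda>x. u x * indicator (- {- real k..<real k}) x)) * sqrt B) \<longlonglongrightarrow> sqrt 0 * sqrt B"
    by (intro tendsto_intros tendsto_tail_zero u)
  then have "\<forall>\<^sub>F k in sequentially. sqrt (sqint (\<lambda>x. u x * indicator (- {- real k..<real k}) x)) * sqrt B < e / 2"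
    using e by (intro order_tendstoD) auto
  then obtain k where k: "sqrt (sqint (\<lambda>x. u x * indicator (- {- real k..<real k}) x)) * sqrt B < e / 2"
    by (metis (mono_tags, lifting) eventually_sequentially order_refl)
  define A where "A = {- real k..<real k}"
  have [measurable]: "A \<in> sets borel" by (simp add: A_def)
  have "(\<lambda>n. LINT x|lborel. \<bar>u x\<bar> * indicator A x * \<bar>w n x\<bar>) \<longlonglongrightarrow> (LINT x|lborel. \<bar>u x\<bar> * indicator A x * 0)"
  proof (rule integral_dominated_convergence)
    show "integrable lborel (\<lambda>x. S * (indicator A x * \<bar>u x\<bar>))"
      using L2_set_integrable[OF L2_abs[OF u], of "- real k" "real k"] by (simp add: set_integrable_def A_def)
    show "AE x in lborel. (\<lambda>n. \<bar>u x\<bar> * indicator A x * \<bar>w n x\<bar>) \<longlonglongrightarrow> \<bar>u x\<bar> * indicator A x * 0"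
      by (intro AE_I2 tendsto_intros tendsto_rabs_zero lim)
    show "AE x in lborel. norm (\<bar>u x\<bar> * indicator A x * \<bar>w n x\<bar>) \<le> S * (indicator A x * \<bar>u x\<bar>)" for n
      using S[of n] by (intro AE_I2) (auto simp: abs_mult mult_right_mono mult.commute indicator_def)
  qed auto
  then have "\<forall>\<^sub>F n in sequentially. (LINT x|lborel. \<bar>u x\<bar> * indicator A x * \<bar>w n x\<bar>) < e / 2"
    using e by (intro order_tendstoD) auto
  then obtain N where N: "\<And>n. n \<ge> N \<Longrightarrow> (LINT x|lborel. \<bar>u x\<bar> * indicator A x * \<bar>w n x\<bar>) < e / 2"
    by (auto simp: eventually_sequentially)
  show "\<exists>N. \<forall>n\<ge>N. norm ((LINT x|lborel. \<bar>u x\<bar> * \<bar>w n x\<bar>) - 0) < e"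
  proof (intro exI[of _ N] allI impI)
    fix n assume n: "N \<le> n"
    have cL: "(\<lambda>x. u x * indicator (- A) x) \<in> L2" by (rule L2_indicator[OF u]) auto
    have "(LINT x|lborel. \<bar>u x\<bar> * \<bar>w n x\<bar>)
        = (LINT x|lborel. \<bar>u x\<bar> * indicator A x * \<bar>w n x\<bar> + \<bar>u x * indicator (- A) x\<bar> * \<bar>w n x\<bar>)"
      by (intro Bochner_Integration.integral_cong) (auto simp: indicator_def)
    also have "\<dots> = (LINT x|lborel. \<bar>u x\<bar> * indicator A x * \<bar>w n x\<bar>) + (LINT x|lborel. \<bar>u x * indicator (- A) x\<bar> * \<bar>w n x\<bar>)"
      by (intro Bochner_Integration.integral_add L2_integrable_mult L2_indicator L2_abs u w cL) auto
    also have "(LINT x|lborel. \<bar>u x * indicator (- A) x\<bar> * \<bar>w n x\<bar>) \<le> sqrt (sqint (\<lambda>x. u x * indicator (- A) x)) * sqrt (sqint (w n))"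
      using L2_Cauchy_Schwarz_abs[OF L2_abs[OF cL] L2_abs[OF w[of n]]] by simp
    also have "\<dots> \<le> sqrt (sqint (\<lambda>x. u x * indicator (- A) x)) * sqrt B"
      using B[of n] by (intro mult_left_mono) auto
    finally have "(LINT x|lborel. \<bar>u x\<bar> * \<bar>w n x\<bar>) < e"
      using k N[OF n] unfolding A_def by linarith
    then show "norm ((LINT x|lborel. \<bar>u x\<bar> * \<bar>w n x\<bar>) - 0) < e" by simp
  qed
qed

lemma L2_inner_null:
  assumes u: "u \<in> L2" and w: "\<And>n. w n \<in> L2" and lim: "(\<lambda>n. LINT x|lborel. \<bar>u x\<bar> * \<bar>w n x\<bar>) \<longlonglongrightarrow> 0"
  shows "(\<lambda>n. LINT x|lborel. u x * w n x) \<longlonglongrightarrow> 0"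
proof (rule Lim_null_comparison[OF _ lim])
  have "norm (LINT x|lborel. u x * w n x) \<le> (LINT x|lborel. \<bar>u x\<bar> * \<bar>w n x\<bar>)" for n
    using integral_norm_bound[of lborel "\<lambda>x. u x * w n x"] by (simp add: abs_mult)
  then show "\<forall>\<^sub>F n in sequentially. norm (LINT x|lborel. u x * w n x) \<le> (LINT x|lborel. \<bar>u x\<bar> * \<bar>w n x\<bar>)"
    by simp
qed

text \<open>The closing step of an Arzela-Ascoli argument: values at \<open>x\<close> stay within
  \<open>e / 3\<close> of those at a nearby rational, uniformly in \<open>n\<close>.\<close>

lemma equicontinuous_pointwise_limit:
  fixes u :: "nat \<Rightarrow> real \<Rightarrow> real"
  assumes H: "\<And>n x y. (u n y - u n x)\<^sup>2 \<le> \<bar>y - x\<bar> * M"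
    and rat: "\<And>q. q \<in> \<rat> \<Longrightarrow> convergent (\<lambda>n. u n q)"
  shows "convergent (\<lambda>n. u n x)"
proof (rule Cauchy_convergent, rule metric_CauchyI)
  fix e :: real assume e: "e > 0"
  \<comment> \<open>Solves \<open>d * (\<bar>M\<bar> + 1) = (e / 3)\<^sup>2\<close>; the
    \<open>+ 1\<close> keeps the denominator positive.\<close>
  define d where "d = (e / 3)\<^sup>2 / (\<bar>M\<bar> + 1)"
  have d: "d > 0" unfolding d_def using e by simp
  obtain q where q: "q \<in> \<rat>" "x < q" "q < x + d" using Rats_dense_in_real[of x "x + d"] d by (metis less_add_same_cancel1)
  have "\<bar>u n q - u n x\<bar> < e / 3" for n
  proof -
    have "(u n q - u n x)\<^sup>2 \<le> \<bar>q - x\<bar> * M" by (rule H)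
    also have "\<dots> \<le> \<bar>q - x\<bar> * (\<bar>M\<bar> + 1)" by (intro mult_left_mono) auto
    also have "\<dots> < d * (\<bar>M\<bar> + 1)" using q by (intro mult_strict_right_mono) auto
    also have "\<dots> = (e / 3)\<^sup>2" unfolding d_def by simp
    finally have "\<bar>u n q - u n x\<bar>\<^sup>2 < (e / 3)\<^sup>2" by simp
    then show ?thesis by (rule power_less_imp_less_base) (use e in simp)
  qed
  note near = this
  have "Cauchy (\<lambda>n. u n q)" using rat[OF q(1)] by (rule convergent_Cauchy)
  moreover have "e / 3 > 0" using e by simp
  ultimately obtain N where N: "\<And>i j. i \<ge> N \<Longrightarrow> j \<ge> N \<Longrightarrow> dist (u i q) (u j q) < e / 3"
    by (blast dest: metric_CauchyD)
  show "\<exists>N. \<forall>i\<ge>N. \<forall>j\<ge>N. dist (u i x) (u j x) < e"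
  proof (intro exI[of _ N] allI impI)
    fix i j assume "N \<le> i" "N \<le> j"
    then show "dist (u i x) (u j x) < e"
      using N[of i j] near[of i] near[of j] unfolding dist_real_def by linarith
  qed
qed

text \<open>The diagonal argument over the rationals is run on pairs of values, so that one
  subsequence serves both components.\<close>

lemma AC_pair_subsequence:
  assumes u: "\<And>n. AC (u n) (g n)" and v: "\<And>n. AC (v n) (k n)"
    and M: "\<And>n. sqint (g n) \<le> M" "\<And>n. sqint (k n) \<le> M"
    and S: "\<And>n x. \<bar>u n x\<bar> \<le> S" "\<And>n x. \<bar>v n x\<bar> \<le> S"
  obtains r U V where "strict_mono (r :: nat \<Rightarrow> nat)"
    "\<And>x. (\<lambda>n. u (r n) x) \<longlonglongrightarrow> U x" "\<And>x. (\<lambda>n. v (r n) x) \<longlonglongrightarrow> V x"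
proof -
  have "norm (u n x, v n x) \<le> S + S" for n x
    using norm_Pair_le[of "u n x" "v n x"] S[of n x] by simp
  then obtain r where r: "strict_mono r" "\<And>x. x \<in> \<rat> \<Longrightarrow> \<exists>l. (\<lambda>n. (u (r n) x, v (r n) x)) \<longlonglongrightarrow> l"
    using function_convergent_subsequence[OF countable_rat, of "\<lambda>n x. (u n x, v n x)" "S + S"] by metis
  have H: "(u n y - u n x)\<^sup>2 \<le> \<bar>y - x\<bar> * M" "(v n y - v n x)\<^sup>2 \<le> \<bar>y - x\<bar> * M" for n x y
    using AC_Hoelder[OF u, of n y x] mult_left_mono[OF M(1)[of n], of "\<bar>y - x\<bar>"]
      AC_Hoelder[OF v, of n y x] mult_left_mono[OF M(2)[of n], of "\<bar>y - x\<bar>"] by linarith+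
  have "convergent (\<lambda>n. u (r n) x)" for x
  proof (rule equicontinuous_pointwise_limit[OF H(1)])
    fix q :: real assume "q \<in> \<rat>"
    then obtain l where "(\<lambda>n. (u (r n) q, v (r n) q)) \<longlonglongrightarrow> l" using r(2) by blast
    then show "convergent (\<lambda>n. u (r n) q)" using tendsto_fst by (fastforce simp: convergent_def)
  qed
  moreover have "convergent (\<lambda>n. v (r n) x)" for x
  proof (rule equicontinuous_pointwise_limit[OF H(2)])
    fix q :: real assume "q \<in> \<rat>"
    then obtain l where "(\<lambda>n. (u (r n) q, v (r n) q)) \<longlonglongrightarrow> l" using r(2) by blast
    then show "convergent (\<lambda>n. v (r n) q)" using tendsto_snd by (fastforce simp: convergent_def)
  qed
  ultimately show ?thesis using that[OF r(1)] unfolding convergent_def by metis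
qed

text \<open>Closed under products, so all monomials of degree at least 2 are integrable. Every
  \<open>AC\<close> function belongs to it by the supremum bound.\<close>

definition BL2 :: "(real \<Rightarrow> real) set" where
  "BL2 = {u \<in> L2. \<exists>S. \<forall>x. \<bar>u x\<bar> \<le> S}"

lemma BL2_I: "u \<in> L2 \<Longrightarrow> (\<And>x. \<bar>u x\<bar> \<le> S) \<Longrightarrow> u \<in> BL2"
  by (auto simp: BL2_def)

lemma AC_BL2: "AC u g \<Longrightarrow> u \<in> BL2"
proof -
  assume u: "AC u g"
  have "\<bar>u x\<bar> \<le> sqrt (2 * sqint u + 2 * sqint g)" for x
    using AC_sup_bound[OF u, of 1 x] by (simp add: real_le_rsqrt)
  then show ?thesis using AC_L2[OF u] by (auto simp: BL2_def)
qed

lemma BL2_mult: "u \<in> BL2 \<Longrightarrow> v \<in> BL2 \<Longrightarrow> (\<lambda>x. u x * v x) \<in> BL2"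
proof -
  assume u: "u \<in> BL2" and v: "v \<in> BL2"
  obtain S where S: "\<And>x. \<bar>u x\<bar> \<le> S" using u by (auto simp: BL2_def)
  obtain S' where S': "\<And>x. \<bar>v x\<bar> \<le> S'" using v by (auto simp: BL2_def)
  have S0: "S \<ge> 0" using S[of 0] by linarith
  have uL: "u \<in> L2" and vL: "v \<in> L2" using u v by (auto simp: BL2_def)
  have [measurable]: "u \<in> borel_measurable borel" "v \<in> borel_measurable borel"
    using uL vL by (auto intro: L2_measurable)
  have "(\<lambda>x. u x * v x) \<in> L2"
  proof (rule L2_I, measurable, rule Bochner_Integration.integrable_bound)
    show "integrable lborel (\<lambda>x. S\<^sup>2 * (v x)\<^sup>2)"
      by (intro integrable_mult_right L2_integrable_power2 vL)
    have "(u x)\<^sup>2 \<le> S\<^sup>2" for x using S[of x] by (metis abs_ge_zero power2_abs power_mono)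
    then show "AE x in lborel. norm ((u x * v x)\<^sup>2) \<le> norm (S\<^sup>2 * (v x)\<^sup>2)"
      by (intro AE_I2) (auto simp: power_mult_distrib intro: mult_right_mono)
  qed auto
  moreover have "\<bar>u x * v x\<bar> \<le> S * S'" for x
    unfolding abs_mult using S[of x] S'[of x] S0 by (intro mult_mono) auto
  ultimately show ?thesis by (auto simp: BL2_def)
qed

lemma BL2_integrable: "u \<in> BL2 \<Longrightarrow> v \<in> BL2 \<Longrightarrow> integrable lborel (\<lambda>x. u x * v x)"
  by (intro L2_integrable_mult) (auto simp: BL2_def)

lemma BL2_power2: "u \<in> BL2 \<Longrightarrow> (\<lambda>x. (u x)\<^sup>2) \<in> BL2"
  unfolding power2_eq_square by (rule BL2_mult)

lemma test_function_AC:
  assumes \<phi>: "test_function \<phi>"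
  shows "AC \<phi> (deriv \<phi>)"
proof -
  obtain A B where AB: "\<And>x. x \<notin> {A..B} \<Longrightarrow> \<phi> x = 0" using test_function_bounded_support[OF \<phi>] by blast
  have d0: "deriv \<phi> x = 0" if "x \<notin> {A..B}" for x
      by (rule deriv_zero_outside[OF AB that])
  have cs: "f \<in> L2" if c: "continuous_on UNIV f" and z: "\<And>x. x \<notin> {A..B} \<Longrightarrow> f x = 0" for f :: "real \<Rightarrow> real"
    using loc_integrable_mult_test[OF loc_integrable_continuous[OF c] c z] borel_measurable_continuous_onI[OF c]
    by (intro L2_I) (auto simp: power2_eq_square)
  have dL: "deriv \<phi> \<in> L2" by (rule cs[OF test_function_continuous_deriv[OF \<phi>] d0])
  have "\<phi> y - \<phi> x = (LINT t:{x..<y}|lborel. deriv \<phi> t)" if "x \<le> y" for x y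
  proof -
    have dc: "isCont (deriv \<phi>) t" for t
      using test_function_continuous_deriv[OF \<phi>, of UNIV] by (simp add: continuous_on_eq_continuous_at)
    have "\<phi> y - \<phi> x = (LINT t|lborel. deriv \<phi> t * indicator {x..y} t)"
      by (rule integral_FTC_Icc_real[OF that test_function_DERIV[OF \<phi>] dc, symmetric])
    also have "\<dots> = (LINT t|lborel. indicator {x..<y} t * deriv \<phi> t)"
    proof (rule integral_cong_AE)
      show "AE t in lborel. deriv \<phi> t * indicator {x..y} t = indicator {x..<y} t * deriv \<phi> t"
        using AE_lborel_singleton[of y] by eventually_elim (auto simp: indicator_def)
    qed (use L2_measurable[OF dL] in auto)
    finally show ?thesis by (simp add: set_lebesgue_integral_def)
  qed
  then show ?thesis using dL cs[OF test_function_continuous[OF \<phi>] AB] by (simp add: AC_def)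
qed

section \<open>The energy functional\<close>

lemma abs_mult_le:
  fixes x y A B :: real
  assumes "\<bar>x\<bar> \<le> A" "\<bar>y\<bar> \<le> B"
  shows "\<bar>x * y\<bar> \<le> A * B"
  unfolding abs_mult using assms by (intro mult_mono) (auto intro: order_trans[OF abs_ge_zero])

lemma abs_add_le:
  fixes x y A B :: real
  shows "\<bar>x\<bar> \<le> A \<Longrightarrow> \<bar>y\<bar> \<le> B \<Longrightarrow> \<bar>x + y\<bar> \<le> A + B"
  by linarith

lemma power2_le_of_abs_le:
  fixes a s :: real
  assumes "\<bar>a\<bar> \<le> s"
  shows "a\<^sup>2 \<le> s\<^sup>2"
  using power_mono[OF assms abs_ge_zero, of 2] by simp

locale coupled =
  fixes \<mu>\<^sub>1 \<mu>\<^sub>2 \<rho> \<beta> :: real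
  assumes pos: "\<mu>\<^sub>1 > 0" "\<mu>\<^sub>2 > 0" "\<rho> > 0" "\<beta> > 0"
begin

definition dens :: "real \<Rightarrow> real \<Rightarrow> real" where
  "dens a b = \<mu>\<^sub>1 / 4 * a ^ 4 + \<mu>\<^sub>2 / 4 * b ^ 4 + \<rho> / 2 * (a\<^sup>2 * b\<^sup>2) + \<beta> / 2 * (a\<^sup>2 * b)"

text \<open>Bounds the ratio of \<open>\<bar>dens a b\<bar>\<close> to
  \<open>a\<^sup>2 + b\<^sup>2\<close> when both arguments are at most \<open>s\<close> in modulus.
  It tends to 0 with \<open>s\<close>: uniformly small pairs of bounded mass have negligible
  potential energy.\<close>

definition growth :: "real \<Rightarrow> real" where
  "growth s = (\<mu>\<^sub>1 + \<mu>\<^sub>2 + \<rho>) * s\<^sup>2 + \<beta> * s"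

definition pot :: "(real \<Rightarrow> real) \<Rightarrow> (real \<Rightarrow> real) \<Rightarrow> real" where
  "pot u v = (LINT x|lborel. dens (u x) (v x))"

definition En :: "(real \<Rightarrow> real) \<Rightarrow> (real \<Rightarrow> real) \<Rightarrow> (real \<Rightarrow> real) \<Rightarrow> (real \<Rightarrow> real) \<Rightarrow> real" where
  "En u g v k = (sqint g + sqint k) / 2 - pot u v"

lemma dens_bound:
  assumes "\<bar>a\<bar> \<le> s" "\<bar>b\<bar> \<le> s"
  shows "\<bar>dens a b\<bar> \<le> growth s * (a\<^sup>2 + b\<^sup>2)"
proof -
  have s: "s \<ge> 0" using assms by linarith
  have a: "a\<^sup>2 \<le> s\<^sup>2" and b: "b\<^sup>2 \<le> s\<^sup>2" using assms by (auto intro: power2_le_of_abs_le)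
  have 1: "\<bar>a ^ 4\<bar> \<le> s\<^sup>2 * a\<^sup>2"
    using mult_right_mono[OF a, of "a\<^sup>2"] by (simp add: power2_eq_square power4_eq_xxxx mult.assoc abs_mult)
  have 2: "\<bar>b ^ 4\<bar> \<le> s\<^sup>2 * b\<^sup>2"
    using mult_right_mono[OF b, of "b\<^sup>2"] by (simp add: power2_eq_square power4_eq_xxxx mult.assoc abs_mult)
  have 3: "\<bar>a\<^sup>2 * b\<^sup>2\<bar> \<le> s\<^sup>2 * a\<^sup>2"
    using mult_left_mono[OF b, of "a\<^sup>2"] by (simp add: mult.commute)
  have 4: "\<bar>a\<^sup>2 * b\<bar> \<le> s * a\<^sup>2"
    using mult_left_mono[OF assms(2), of "a\<^sup>2"] by (simp add: mult.commute abs_mult)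
  have "\<bar>dens a b\<bar> \<le> \<mu>\<^sub>1 / 4 * (s\<^sup>2 * a\<^sup>2) + \<mu>\<^sub>2 / 4 * (s\<^sup>2 * b\<^sup>2) + \<rho> / 2 * (s\<^sup>2 * a\<^sup>2) + \<beta> / 2 * (s * a\<^sup>2)"
    unfolding dens_def using pos by (intro abs_add_le abs_mult_le 1 2 3 4) auto
  also have "\<dots> \<le> \<mu>\<^sub>1 * (s\<^sup>2 * a\<^sup>2) + \<mu>\<^sub>2 * (s\<^sup>2 * b\<^sup>2) + \<rho> * (s\<^sup>2 * a\<^sup>2) + \<beta> * (s * a\<^sup>2)"
    using pos s by (intro add_mono mult_right_mono) auto
  also have "\<dots> \<le> growth s * (a\<^sup>2 + b\<^sup>2)"
  proof -
    have "0 \<le> \<mu>\<^sub>1 * (s\<^sup>2 * b\<^sup>2)" "0 \<le> \<mu>\<^sub>2 * (s\<^sup>2 * a\<^sup>2)" "0 \<le> \<rho> * (s\<^sup>2 * b\<^sup>2)" "0 \<le> \<beta> * (s * b\<^sup>2)"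
      using pos s by auto
    then show ?thesis unfolding growth_def by (simp add: algebra_simps)
  qed
  finally show ?thesis .
qed

text \<open>Only mixed monomials survive the subtraction, and each contains one of
  \<open>a * p\<close>, \<open>a * q\<close>, \<open>b * p\<close>, \<open>b * q\<close>. The
  cofactor is bounded through \<open>S\<close>; adding coefficients gives \<open>4 + 6 + 4\<close>
  for the fourth powers, \<open>3 + 8 + 3\<close> for the coupling and \<open>1 + 4 + 1\<close> for
  the cubic term.\<close>

lemma dens_split:
  assumes "\<bar>a\<bar> \<le> S" "\<bar>b\<bar> \<le> S" "\<bar>p\<bar> \<le> S" "\<bar>q\<bar> \<le> S"
  shows "\<bar>dens (a + p) (b + q) - dens a b - dens p q\<bar>
    \<le> (14 * S\<^sup>2 * (\<mu>\<^sub>1 + \<mu>\<^sub>2 + \<rho>) + 6 * S * \<beta>) * ((\<bar>a\<bar> + \<bar>b\<bar>) * (\<bar>p\<bar> + \<bar>q\<bar>))"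
proof -
  define X where "X = (\<bar>a\<bar> + \<bar>b\<bar>) * (\<bar>p\<bar> + \<bar>q\<bar>)"
  have X0: "X \<ge> 0" by (simp add: X_def)
  have S0: "S \<ge> 0" using assms by linarith
  have X: "\<bar>a * p\<bar> \<le> X" "\<bar>a * q\<bar> \<le> X" "\<bar>b * p\<bar> \<le> X" "\<bar>b * q\<bar> \<le> X"
    unfolding X_def abs_mult by (intro mult_mono; simp)+
  have sq: "\<bar>x * y\<bar> \<le> S\<^sup>2" if "\<bar>x\<bar> \<le> S" "\<bar>y\<bar> \<le> S" for x y
    using abs_mult_le[OF that] by (simp add: power2_eq_square)
  have quart: "\<bar>(x + y) ^ 4 - x ^ 4 - y ^ 4\<bar> \<le> X * (14 * S\<^sup>2)"
    if "\<bar>x\<bar> \<le> S" "\<bar>y\<bar> \<le> S" "\<bar>x * y\<bar> \<le> X" for x y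
  proof -
    have "(x + y) ^ 4 - x ^ 4 - y ^ 4 = (x * y) * (4 * (x * x) + 6 * (x * y) + 4 * (y * y))"
      by (simp add: power4_eq_xxxx algebra_simps)
    moreover have "\<bar>4 * (x * x) + 6 * (x * y) + 4 * (y * y)\<bar> \<le> 14 * S\<^sup>2"
      using sq[OF that(1,1)] sq[OF that(1,2)] sq[OF that(2,2)] unfolding abs_le_iff by linarith
    ultimately show ?thesis using abs_mult_le[OF that(3)] by simp
  qed
  have mixed: "\<bar>(a + p)\<^sup>2 * (b + q)\<^sup>2 - a\<^sup>2 * b\<^sup>2 - p\<^sup>2 * q\<^sup>2\<bar> \<le> X * (14 * S\<^sup>2)"
  proof -
    have "(a + p)\<^sup>2 * (b + q)\<^sup>2 - a\<^sup>2 * b\<^sup>2 - p\<^sup>2 * q\<^sup>2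
      = (a * q) * (2 * (a * b) + a * q) + (a * p) * (2 * (b * b) + 4 * (b * q) + 2 * (q * q)) + (b * p) * (b * p + 2 * (p * q))"
      by (simp add: power2_eq_square algebra_simps)
    moreover have "\<bar>(a * q) * (2 * (a * b) + a * q)\<bar> \<le> X * (3 * S\<^sup>2)"
      using sq[OF assms(1,2)] sq[OF assms(1,4)] by (intro abs_mult_le X) (simp only: abs_le_iff, linarith)
    moreover have "\<bar>(a * p) * (2 * (b * b) + 4 * (b * q) + 2 * (q * q))\<bar> \<le> X * (8 * S\<^sup>2)"
      using sq[OF assms(2,2)] sq[OF assms(2,4)] sq[OF assms(4,4)]
      by (intro abs_mult_le X) (simp only: abs_le_iff, linarith)
    moreover have "\<bar>(b * p) * (b * p + 2 * (p * q))\<bar> \<le> X * (3 * S\<^sup>2)"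
      using sq[OF assms(2,3)] sq[OF assms(3,4)] by (intro abs_mult_le X) (simp only: abs_le_iff, linarith)
    ultimately show ?thesis unfolding abs_le_iff by linarith
  qed
  have cub: "\<bar>(a + p)\<^sup>2 * (b + q) - a\<^sup>2 * b - p\<^sup>2 * q\<bar> \<le> X * (6 * S)"
  proof -
    have "(a + p)\<^sup>2 * (b + q) - a\<^sup>2 * b - p\<^sup>2 * q = (a * q) * a + (a * p) * (2 * b + 2 * q) + (b * p) * p"
      by (simp add: power2_eq_square algebra_simps)
    moreover have "\<bar>(a * q) * a\<bar> \<le> X * S" "\<bar>(b * p) * p\<bar> \<le> X * S"
      using assms by (intro abs_mult_le X; simp)+
    moreover have "\<bar>(a * p) * (2 * b + 2 * q)\<bar> \<le> X * (4 * S)"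
      using assms(2,4) by (intro abs_mult_le X) linarith
    ultimately show ?thesis unfolding abs_le_iff by linarith
  qed
  let ?A = "(a + p) ^ 4 - a ^ 4 - p ^ 4" and ?B = "(b + q) ^ 4 - b ^ 4 - q ^ 4"
    and ?C = "(a + p)\<^sup>2 * (b + q)\<^sup>2 - a\<^sup>2 * b\<^sup>2 - p\<^sup>2 * q\<^sup>2"
    and ?D = "(a + p)\<^sup>2 * (b + q) - a\<^sup>2 * b - p\<^sup>2 * q"
  have "\<bar>dens (a + p) (b + q) - dens a b - dens p q\<bar> = \<bar>\<mu>\<^sub>1 / 4 * ?A + \<mu>\<^sub>2 / 4 * ?B + \<rho> / 2 * ?C + \<beta> / 2 * ?D\<bar>"
    by (rule arg_cong[of _ _ abs]) (simp add: dens_def algebra_simps)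
  also have "\<dots> \<le> \<mu>\<^sub>1 * (X * (14 * S\<^sup>2)) + \<mu>\<^sub>2 * (X * (14 * S\<^sup>2)) + \<rho> * (X * (14 * S\<^sup>2)) + \<beta> * (X * (6 * S))"
    by (intro abs_add_le abs_mult_le mixed cub quart X assms) (use pos in auto)
  also have "\<dots> = (14 * S\<^sup>2 * (\<mu>\<^sub>1 + \<mu>\<^sub>2 + \<rho>) + 6 * S * \<beta>) * X" by (simp add: algebra_simps)
  finally show ?thesis by (simp add: X_def)
qed

text \<open>The fourth powers yield the cross terms \<open>a\<^sup>2 * p\<^sup>2\<close> and
  \<open>b\<^sup>2 * q\<^sup>2\<close>, the coupling the other two, all with coefficient at least
  half the minimum. The cubic term does not decrease, because the merged second component is at
  least \<open>b\<close> and at least \<open>q\<close>, whatever their signs.\<close>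

lemma dens_merge:
  "dens (sqrt (a\<^sup>2 + p\<^sup>2)) (sqrt (b\<^sup>2 + q\<^sup>2))
    \<ge> dens a b + dens p q + min \<mu>\<^sub>1 (min \<mu>\<^sub>2 \<rho>) / 2 * ((a\<^sup>2 + b\<^sup>2) * (p\<^sup>2 + q\<^sup>2))"
proof -
  define h where "h = sqrt (a\<^sup>2 + p\<^sup>2)"
  define l where "l = sqrt (b\<^sup>2 + q\<^sup>2)"
  define \<kappa> where "\<kappa> = min \<mu>\<^sub>1 (min \<mu>\<^sub>2 \<rho>)"
  have h2: "h\<^sup>2 = a\<^sup>2 + p\<^sup>2" and l2: "l\<^sup>2 = b\<^sup>2 + q\<^sup>2" by (simp_all add: h_def l_def)
  have h4: "h ^ 4 = (a\<^sup>2 + p\<^sup>2)\<^sup>2" and l4: "l ^ 4 = (b\<^sup>2 + q\<^sup>2)\<^sup>2"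
    unfolding h2[symmetric] l2[symmetric] by (simp_all flip: power_mult)
  have lb: "b \<le> l" "q \<le> l" unfolding l_def by (auto intro: real_le_rsqrt)
  have "h\<^sup>2 * l \<ge> a\<^sup>2 * b + p\<^sup>2 * q"
    unfolding h2 distrib_right using lb by (intro add_mono mult_left_mono) auto
  then have cub: "\<beta> / 2 * (h\<^sup>2 * l) \<ge> \<beta> / 2 * (a\<^sup>2 * b + p\<^sup>2 * q)" using pos by (intro mult_left_mono) auto
  have k: "\<kappa> \<le> \<mu>\<^sub>1" "\<kappa> \<le> \<mu>\<^sub>2" "\<kappa> \<le> \<rho>" by (auto simp: \<kappa>_def)
  have m1: "\<kappa> / 2 * (a\<^sup>2 * p\<^sup>2) \<le> \<mu>\<^sub>1 / 2 * (a\<^sup>2 * p\<^sup>2)" using k by (intro mult_right_mono) auto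
  have m2: "\<kappa> / 2 * (b\<^sup>2 * q\<^sup>2) \<le> \<mu>\<^sub>2 / 2 * (b\<^sup>2 * q\<^sup>2)" using k by (intro mult_right_mono) auto
  have m3: "\<kappa> / 2 * (a\<^sup>2 * q\<^sup>2 + b\<^sup>2 * p\<^sup>2) \<le> \<rho> / 2 * (a\<^sup>2 * q\<^sup>2 + b\<^sup>2 * p\<^sup>2)" using k by (intro mult_right_mono) auto
  have "dens h l - dens a b - dens p q = \<mu>\<^sub>1 / 2 * (a\<^sup>2 * p\<^sup>2) + \<mu>\<^sub>2 / 2 * (b\<^sup>2 * q\<^sup>2) + \<rho> / 2 * (a\<^sup>2 * q\<^sup>2 + b\<^sup>2 * p\<^sup>2)
      + \<beta> / 2 * (h\<^sup>2 * l) - \<beta> / 2 * (a\<^sup>2 * b + p\<^sup>2 * q)"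
    unfolding dens_def h4 l4 h2 l2 by (simp add: power2_eq_square power4_eq_xxxx field_simps)
  moreover have "\<kappa> / 2 * ((a\<^sup>2 + b\<^sup>2) * (p\<^sup>2 + q\<^sup>2))
      = \<kappa> / 2 * (a\<^sup>2 * p\<^sup>2) + \<kappa> / 2 * (b\<^sup>2 * q\<^sup>2) + \<kappa> / 2 * (a\<^sup>2 * q\<^sup>2 + b\<^sup>2 * p\<^sup>2)"
    by (simp add: field_simps)
  ultimately show ?thesis using m1 m2 m3 cub unfolding h_def l_def \<kappa>_def by linarith
qed

section \<open>Potential and energy of pairs of functions\<close>

lemma dens_integrable:
  assumes u: "u \<in> BL2" and v: "v \<in> BL2"
  shows "integrable lborel (\<lambda>x. dens (u x) (v x))"
proof -
  have "integrable lborel (\<lambda>x. \<mu>\<^sub>1 / 4 * ((u x)\<^sup>2 * (u x)\<^sup>2) + \<mu>\<^sub>2 / 4 * ((v x)\<^sup>2 * (v x)\<^sup>2)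
      + \<rho> / 2 * ((u x)\<^sup>2 * (v x)\<^sup>2) + \<beta> / 2 * ((u x)\<^sup>2 * v x))"
    by (intro Bochner_Integration.integrable_add integrable_mult_right BL2_integrable BL2_power2 u v)
  then show ?thesis by (simp add: dens_def power2_eq_square power4_eq_xxxx mult.assoc)
qed

lemma pot_bound:
  assumes u: "u \<in> L2" and v: "v \<in> L2" and s: "\<And>x. \<bar>u x\<bar> \<le> s" "\<And>x. \<bar>v x\<bar> \<le> s"
  shows "\<bar>pot u v\<bar> \<le> growth s * (sqint u + sqint v)"
proof -
  have B: "u \<in> BL2" "v \<in> BL2" using assms by (auto simp: BL2_def)
  have i: "integrable lborel (\<lambda>x. growth s * ((u x)\<^sup>2 + (v x)\<^sup>2))"
    by (intro integrable_mult_right Bochner_Integration.integrable_add L2_integrable_power2 u v)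
  have "\<bar>pot u v\<bar> \<le> (LINT x|lborel. \<bar>dens (u x) (v x)\<bar>)"
    unfolding pot_def using integral_norm_bound[of lborel "\<lambda>x. dens (u x) (v x)"] by simp
  also have "\<dots> \<le> (LINT x|lborel. growth s * ((u x)\<^sup>2 + (v x)\<^sup>2))"
    using dens_integrable[OF B] i by (intro integral_mono dens_bound s integrable_abs)
  also have "\<dots> = growth s * (sqint u + sqint v)"
    using L2_integrable_power2[OF u] L2_integrable_power2[OF v] by simp
  finally show ?thesis .
qed

text \<open>A splitting of Brezis-Lieb type: \<open>dens_split\<close> dominates the defect by
  pairings of the fixed pair with the null sequences, which vanish by
  \<open>L2_weak_null\<close>.\<close>

lemma pot_split_null:
  assumes u: "u \<in> L2" and v: "v \<in> L2" and w: "\<And>n. w n \<in> L2" and z: "\<And>n. z n \<in> L2"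
    and S: "\<And>x. \<bar>u x\<bar> \<le> S" "\<And>x. \<bar>v x\<bar> \<le> S" "\<And>n x. \<bar>w n x\<bar> \<le> S" "\<And>n x. \<bar>z n x\<bar> \<le> S"
    and B: "\<And>n. sqint (w n) \<le> B" "\<And>n. sqint (z n) \<le> B"
    and lim: "\<And>x. (\<lambda>n. w n x) \<longlonglongrightarrow> 0" "\<And>x. (\<lambda>n. z n x) \<longlonglongrightarrow> 0"
  shows "(\<lambda>n. pot (\<lambda>x. u x + w n x) (\<lambda>x. v x + z n x) - pot u v - pot (w n) (z n)) \<longlonglongrightarrow> 0"
proof -
  define C where "C = 14 * S\<^sup>2 * (\<mu>\<^sub>1 + \<mu>\<^sub>2 + \<rho>) + 6 * S * \<beta>"
  define R where "R = (\<lambda>n. C * ((LINT x|lborel. \<bar>u x\<bar> * \<bar>w n x\<bar>) + (LINT x|lborel. \<bar>u x\<bar> * \<bar>z n x\<bar>)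
    + (LINT x|lborel. \<bar>v x\<bar> * \<bar>w n x\<bar>) + (LINT x|lborel. \<bar>v x\<bar> * \<bar>z n x\<bar>)))"
  have "R \<longlonglongrightarrow> C * (0 + 0 + 0 + 0)"
    unfolding R_def
    by (intro tendsto_intros L2_weak_null[OF u w B(1) S(3) lim(1)] L2_weak_null[OF u z B(2) S(4) lim(2)]
      L2_weak_null[OF v w B(1) S(3) lim(1)] L2_weak_null[OF v z B(2) S(4) lim(2)])
  then have R: "R \<longlonglongrightarrow> 0" by simp
  have BL: "u \<in> BL2" "v \<in> BL2" "w n \<in> BL2" "z n \<in> BL2" for n
    by (rule BL2_I[OF u S(1)] BL2_I[OF v S(2)] BL2_I[OF w S(3)] BL2_I[OF z S(4)])+
  have BLs: "(\<lambda>x. u x + w n x) \<in> BL2" "(\<lambda>x. v x + z n x) \<in> BL2" for n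
  proof -
    have s: "\<bar>u x + w n x\<bar> \<le> S + S" "\<bar>v x + z n x\<bar> \<le> S + S" for x
      using S(1)[of x] S(2)[of x] S(3)[of n x] S(4)[of n x] by linarith+
    show "(\<lambda>x. u x + w n x) \<in> BL2" "(\<lambda>x. v x + z n x) \<in> BL2"
      by (rule BL2_I[OF L2_add[OF u w] s(1)] BL2_I[OF L2_add[OF v z] s(2)])+
  qed
  have bound: "norm (pot (\<lambda>x. u x + w n x) (\<lambda>x. v x + z n x) - pot u v - pot (w n) (z n)) \<le> R n" for n
  proof -
    let ?d = "\<lambda>x. dens (u x + w n x) (v x + z n x) - dens (u x) (v x) - dens (w n x) (z n x)"
    note i = dens_integrable[OF BLs[of n]] dens_integrable[OF BL(1,2)] dens_integrable[OF BL(3,4)[of n]]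
    have j: "integrable lborel (\<lambda>x. \<bar>u x\<bar> * \<bar>w n x\<bar>)" "integrable lborel (\<lambda>x. \<bar>u x\<bar> * \<bar>z n x\<bar>)"
      "integrable lborel (\<lambda>x. \<bar>v x\<bar> * \<bar>w n x\<bar>)" "integrable lborel (\<lambda>x. \<bar>v x\<bar> * \<bar>z n x\<bar>)"
      by (intro L2_integrable_mult L2_abs u v w z)+
    have ii: "integrable lborel ?d" by (intro Bochner_Integration.integrable_diff i)
    have jj: "integrable lborel (\<lambda>x. C * (\<bar>u x\<bar> * \<bar>w n x\<bar> + \<bar>u x\<bar> * \<bar>z n x\<bar> + \<bar>v x\<bar> * \<bar>w n x\<bar> + \<bar>v x\<bar> * \<bar>z n x\<bar>))"
      by (intro integrable_mult_right Bochner_Integration.integrable_add j)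
    have "pot (\<lambda>x. u x + w n x) (\<lambda>x. v x + z n x) - pot u v - pot (w n) (z n) = (LINT x|lborel. ?d x)"
      unfolding pot_def by (simp only: Bochner_Integration.integral_diff Bochner_Integration.integrable_diff i)
    then have "norm (pot (\<lambda>x. u x + w n x) (\<lambda>x. v x + z n x) - pot u v - pot (w n) (z n)) \<le> (LINT x|lborel. \<bar>?d x\<bar>)"
      using integral_norm_bound[of lborel ?d] by simp
    also have "\<dots> \<le> (LINT x|lborel. C * (\<bar>u x\<bar> * \<bar>w n x\<bar> + \<bar>u x\<bar> * \<bar>z n x\<bar> + \<bar>v x\<bar> * \<bar>w n x\<bar> + \<bar>v x\<bar> * \<bar>z n x\<bar>))"
    proof (intro integral_mono integrable_abs ii jj)
      fix x
      show "\<bar>?d x\<bar> \<le> C * (\<bar>u x\<bar> * \<bar>w n x\<bar> + \<bar>u x\<bar> * \<bar>z n x\<bar> + \<bar>v x\<bar> * \<bar>w n x\<bar> + \<bar>v x\<bar> * \<bar>z n x\<bar>)"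
        using dens_split[OF S(1)[of x] S(2)[of x] S(3)[of n x] S(4)[of n x]]
        unfolding C_def[symmetric] by (simp only: distrib_left distrib_right ac_simps)
    qed
    also have "\<dots> = R n" unfolding R_def
      by (simp only: integral_mult_right_zero Bochner_Integration.integral_add Bochner_Integration.integrable_add j)
    finally show ?thesis .
  qed
  show ?thesis by (rule Lim_null_comparison[OF always_eventually R]) (rule allI, rule bound)
qed

lemma En_merge:
  assumes u: "AC u g" and v: "AC v k" and w: "AC w p" and z: "AC z q"
  obtains h' l' where "AC (\<lambda>x. sqrt ((u x)\<^sup>2 + (w x)\<^sup>2)) h'" "AC (\<lambda>x. sqrt ((v x)\<^sup>2 + (z x)\<^sup>2)) l'"
    "sqint (\<lambda>x. sqrt ((u x)\<^sup>2 + (w x)\<^sup>2)) = sqint u + sqint w"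
    "sqint (\<lambda>x. sqrt ((v x)\<^sup>2 + (z x)\<^sup>2)) = sqint v + sqint z"
    "sqint h' \<le> sqint g + sqint p" "sqint l' \<le> sqint k + sqint q"
    "En (\<lambda>x. sqrt ((u x)\<^sup>2 + (w x)\<^sup>2)) h' (\<lambda>x. sqrt ((v x)\<^sup>2 + (z x)\<^sup>2)) l'
      \<le> En u g v k + En w p z q
        - min \<mu>\<^sub>1 (min \<mu>\<^sub>2 \<rho>) / 2 * (LINT x|lborel. ((u x)\<^sup>2 + (v x)\<^sup>2) * ((w x)\<^sup>2 + (z x)\<^sup>2))"
proof -
  obtain h' where h: "AC (\<lambda>x. sqrt ((u x)\<^sup>2 + (w x)\<^sup>2)) h'" "sqint h' \<le> sqint g + sqint p"
    "sqint (\<lambda>x. sqrt ((u x)\<^sup>2 + (w x)\<^sup>2)) = sqint u + sqint w"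
    by (rule AC_merge[OF u w])
  obtain l' where l: "AC (\<lambda>x. sqrt ((v x)\<^sup>2 + (z x)\<^sup>2)) l'" "sqint l' \<le> sqint k + sqint q"
    "sqint (\<lambda>x. sqrt ((v x)\<^sup>2 + (z x)\<^sup>2)) = sqint v + sqint z"
    by (rule AC_merge[OF v z])
  let ?c = "min \<mu>\<^sub>1 (min \<mu>\<^sub>2 \<rho>) / 2"
  let ?I = "\<lambda>x. ((u x)\<^sup>2 + (v x)\<^sup>2) * ((w x)\<^sup>2 + (z x)\<^sup>2)"
  note B = AC_BL2[OF u] AC_BL2[OF v] AC_BL2[OF w] AC_BL2[OF z]
  have "integrable lborel (\<lambda>x. (u x)\<^sup>2 * (w x)\<^sup>2 + (v x)\<^sup>2 * (w x)\<^sup>2 + ((u x)\<^sup>2 * (z x)\<^sup>2 + (v x)\<^sup>2 * (z x)\<^sup>2))"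
    by (intro Bochner_Integration.integrable_add BL2_integrable BL2_power2 B)
  then have I: "integrable lborel ?I" by (simp add: distrib_left distrib_right)
  have i: "integrable lborel (\<lambda>x. dens (u x) (v x))" "integrable lborel (\<lambda>x. dens (w x) (z x))"
    by (intro dens_integrable B)+
  have "pot u v + pot w z + ?c * (LINT x|lborel. ?I x) = (LINT x|lborel. dens (u x) (v x) + dens (w x) (z x) + ?c * ?I x)"
    using I i by (simp add: pot_def)
  also have "\<dots> \<le> pot (\<lambda>x. sqrt ((u x)\<^sup>2 + (w x)\<^sup>2)) (\<lambda>x. sqrt ((v x)\<^sup>2 + (z x)\<^sup>2))"
    unfolding pot_def
    by (intro integral_mono Bochner_Integration.integrable_add integrable_mult_right I i dens_integrable AC_BL2[OF h(1)] AC_BL2[OF l(1)] dens_merge)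
  finally have *: "pot u v + pot w z + ?c * (LINT x|lborel. ?I x)
      \<le> pot (\<lambda>x. sqrt ((u x)\<^sup>2 + (w x)\<^sup>2)) (\<lambda>x. sqrt ((v x)\<^sup>2 + (z x)\<^sup>2))" .
  define cI where "cI = ?c * (LINT x|lborel. ?I x)"
  have "En (\<lambda>x. sqrt ((u x)\<^sup>2 + (w x)\<^sup>2)) h' (\<lambda>x. sqrt ((v x)\<^sup>2 + (z x)\<^sup>2)) l'
      \<le> En u g v k + En w p z q - ?c * (LINT x|lborel. ?I x)"
    using * h(2) l(2) unfolding En_def cI_def[symmetric] by (simp add: field_simps)
  then show ?thesis by (rule that[OF h(1) l(1) h(3) l(3) h(2) l(2)])
qed

lemma pot_translate: "pot (\<lambda>x. u (x + c)) (\<lambda>x. v (x + c)) = pot u v"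
  using integral_affine_comp[of 1 "\<lambda>x. dens (u x) (v x)" c] by (simp add: pot_def)

lemma En_translate: "En (\<lambda>x. u (x + c)) (\<lambda>x. g (x + c)) (\<lambda>x. v (x + c)) (\<lambda>x. k (x + c)) = En u g v k"
  by (simp add: En_def pot_translate sqint_translate)

text \<open>Spreading out a bump: the kinetic energy scales like \<open>t\<^sup>2\<close>, the quartic terms like \<open>t\<close>.\<close>

lemma negative_energy_exists:
  assumes c: "c\<^sub>1 \<ge> 0" "c\<^sub>2 \<ge> 0" "c\<^sub>1 + c\<^sub>2 > 0"
  obtains p p' q q' where "AC p p'" "AC q q'" "sqint p = c\<^sub>1" "sqint q = c\<^sub>2" "En p p' q q' < 0"
proof -
  define \<phi> where "\<phi> = bump 0 1 1 1 0"
  have tf: "test_function \<phi>" unfolding \<phi>_def by (rule test_function_bump) auto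
  have ac: "AC \<phi> (deriv \<phi>)" by (rule test_function_AC[OF tf])
  have \<phi>0: "\<phi> x \<ge> 0" for x unfolding \<phi>_def by (rule bump_bounds) simp
  define I2 where "I2 = sqint \<phi>"
  define A where "A = sqint (deriv \<phi>)"
  define D where "D = (LINT x|lborel. (\<phi> x) ^ 4)"
  have i4: "integrable lborel (\<lambda>x. (\<phi> x) ^ 4)"
    using BL2_integrable[OF BL2_power2 BL2_power2, OF AC_BL2[OF ac] AC_BL2[OF ac]]
    by (simp flip: power_add)
  have nz: "\<not> (AE x in lborel. \<phi> x = 0)"
  proof
    assume "AE x in lborel. \<phi> x = 0"
    then have "(LINT x|lborel. \<phi> x) = (LINT x|(lborel :: real measure). 0)"
      using L2_measurable[OF AC_L2(1)[OF ac]] by (intro integral_cong_AE) auto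
    then show False using bump_integral_pos by (simp add: \<phi>_def)
  qed
  have "I2 \<noteq> 0" unfolding I2_def
    using nz by (subst integral_nonneg_eq_0_iff_AE[OF L2_integrable_power2[OF AC_L2(1)[OF ac]]]) auto
  then have I2: "I2 > 0" using sqint_nonneg[of \<phi>] unfolding I2_def by linarith
  have "D \<noteq> 0" unfolding D_def using nz by (subst integral_nonneg_eq_0_iff_AE[OF i4]) auto
  moreover have "D \<ge> 0" unfolding D_def by simp
  ultimately have D: "D > 0" by simp
  \<comment> \<open>With dilation parameter \<open>t\<close> the trial energy will be at most
    \<open>t\<^sup>2 * X - t * Y\<close>.\<close>
  define X where "X = (c\<^sub>1 + c\<^sub>2) * A / (2 * I2)"
  define Y where "Y = D * (\<mu>\<^sub>1 * c\<^sub>1\<^sup>2 + \<mu>\<^sub>2 * c\<^sub>2\<^sup>2) / (4 * I2\<^sup>2)"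
  have X: "X \<ge> 0" unfolding X_def A_def using c I2 by simp
  have "\<mu>\<^sub>1 * c\<^sub>1\<^sup>2 + \<mu>\<^sub>2 * c\<^sub>2\<^sup>2 > 0"
  proof (cases "c\<^sub>1 = 0")
    case True then show ?thesis using c pos by simp
  next
    case False then show ?thesis using c pos by (intro add_pos_nonneg) auto
  qed
  then have Y: "Y > 0" unfolding Y_def using D I2 by simp
  \<comment> \<open>Small enough for \<open>t * X < Y\<close>; the \<open>+ 1\<close> covers
    \<open>X = 0\<close>.\<close>
  define t where "t = Y / (X + 1)"
  have t: "t > 0" "t * X < Y" unfolding t_def using X Y by (auto simp: field_simps)
  \<comment> \<open>The prefactor normalises the dilated bump to mass \<open>c\<close>.\<close>
  define f where "f = (\<lambda>c x. sqrt (c * t / I2) * \<phi> (t * x + 0))"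
  define f' where "f' = (\<lambda>c x. sqrt (c * t / I2) * (t * deriv \<phi> (t * x + 0)))"
  have acf: "AC (f c) (f' c)" for c
    unfolding f_def f'_def by (intro AC_scale AC_affine_comp ac t)
  have mass: "sqint (f c) = c" if "c \<ge> 0" for c
  proof -
    have "sqint (f c) = (LINT x|lborel. (c * t / I2) * (\<phi> (t * x + 0))\<^sup>2)"
      unfolding f_def using that t I2 by (simp add: power_mult_distrib)
    also have "\<dots> = (c * t / I2) * (I2 / t)"
      unfolding I2_def using integral_affine_comp[OF t(1), of "\<lambda>x. (\<phi> x)\<^sup>2" 0] by simp
    finally show ?thesis using t I2 by simp
  qed
  have kin: "sqint (f' c) = c * t\<^sup>2 * A / I2" if "c \<ge> 0" for c
  proof -
    have "sqint (f' c) = (LINT x|lborel. (c * t / I2 * t\<^sup>2) * (deriv \<phi> (t * x + 0))\<^sup>2)"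
      unfolding f'_def using that t I2 by (simp add: power_mult_distrib mult.assoc)
    also have "\<dots> = (c * t / I2 * t\<^sup>2) * (A / t)"
      unfolding A_def using integral_affine_comp[OF t(1), of "\<lambda>x. (deriv \<phi> x)\<^sup>2" 0] by simp
    finally show ?thesis using t I2 by (simp add: power2_eq_square)
  qed
  have quart: "(LINT x|lborel. (f c x) ^ 4) = c\<^sup>2 * t * D / I2\<^sup>2" if "c \<ge> 0" for c
  proof -
    have e: "sqrt (c * t / I2) ^ 4 = (c * t / I2)\<^sup>2"
    proof -
      have "sqrt (c * t / I2) ^ 4 = (sqrt (c * t / I2) ^ 2) ^ 2" by (simp flip: power_mult)
      then show ?thesis using that t I2 by simp
    qed
    have "(LINT x|lborel. (f c x) ^ 4) = (LINT x|lborel. (c * t / I2)\<^sup>2 * (\<phi> (t * x + 0)) ^ 4)"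
      unfolding f_def by (simp only: power_mult_distrib e)
    also have "\<dots> = (c * t / I2)\<^sup>2 * (D / t)"
      unfolding D_def using integral_affine_comp[OF t(1), of "\<lambda>x. (\<phi> x) ^ 4" 0] by simp
    finally show ?thesis using t I2 by (simp add: power2_eq_square)
  qed
  have f4: "integrable lborel (\<lambda>x. (f c x) ^ 4)" for c
    using BL2_integrable[OF BL2_power2 BL2_power2, OF AC_BL2[OF acf] AC_BL2[OF acf], of c c]
    by (simp flip: power_add)
  \<comment> \<open>The second trial function is nonnegative, so the terms with
    \<open>\<rho>\<close> and \<open>\<beta>\<close> only lower the energy further.\<close>
  have "pot (f c\<^sub>1) (f c\<^sub>2) \<ge> (LINT x|lborel. \<mu>\<^sub>1 / 4 * (f c\<^sub>1 x) ^ 4 + \<mu>\<^sub>2 / 4 * (f c\<^sub>2 x) ^ 4)"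
    unfolding pot_def
  proof (intro integral_mono Bochner_Integration.integrable_add integrable_mult_right f4 dens_integrable AC_BL2[OF acf])
    fix x
    have "f c\<^sub>2 x \<ge> 0" unfolding f_def using \<phi>0 c t I2 by simp
    then have "0 \<le> \<rho> / 2 * ((f c\<^sub>1 x)\<^sup>2 * (f c\<^sub>2 x)\<^sup>2)" "0 \<le> \<beta> / 2 * ((f c\<^sub>1 x)\<^sup>2 * f c\<^sub>2 x)"
      using pos by auto
    then show "\<mu>\<^sub>1 / 4 * (f c\<^sub>1 x) ^ 4 + \<mu>\<^sub>2 / 4 * (f c\<^sub>2 x) ^ 4 \<le> dens (f c\<^sub>1 x) (f c\<^sub>2 x)"
      unfolding dens_def by linarith
  qed
  also have "(LINT x|lborel. \<mu>\<^sub>1 / 4 * (f c\<^sub>1 x) ^ 4 + \<mu>\<^sub>2 / 4 * (f c\<^sub>2 x) ^ 4) = t * Y"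
    using f4 c I2 by (simp add: quart Y_def field_simps)
  finally have "En (f c\<^sub>1) (f' c\<^sub>1) (f c\<^sub>2) (f' c\<^sub>2) \<le> (c\<^sub>1 * t\<^sup>2 * A / I2 + c\<^sub>2 * t\<^sup>2 * A / I2) / 2 - t * Y"
    unfolding En_def using c by (simp add: kin)
  also have "\<dots> = t * (t * X - Y)" using I2 by (simp add: X_def field_simps power2_eq_square)
  also have "\<dots> < 0" using t by (intro mult_pos_neg) auto
  finally show ?thesis using that[OF acf acf mass mass] c by blast
qed

lemma AC_abs_bound:
  assumes "AC u g" "L > 0"
  shows "\<bar>u x\<bar> \<le> sqrt (2 * sqint u / L + 2 * L * sqint g)"
  using AC_sup_bound[OF assms, of x] by (simp add: real_le_rsqrt)

text \<open>An inequality of Gagliardo-Nirenberg type: the supremum bound with free length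
  \<open>L\<close> gives \<open>s\<^sup>2 \<le> 2 * B / L + 2 * L * G\<close>, and the potential is
  at most \<open>growth s\<close> times the mass. A small \<open>L\<close> leaves only a quarter of
  the kinetic term \<open>G\<close>, against the half of it contained in \<open>En\<close>.\<close>

lemma En_coercive:
  assumes B: "B\<^sub>1 \<ge> 0" "B\<^sub>2 \<ge> 0"
  obtains C where "\<And>u g v k. AC u g \<Longrightarrow> AC v k \<Longrightarrow> sqint u = B\<^sub>1 \<Longrightarrow> sqint v = B\<^sub>2
    \<Longrightarrow> sqint g + sqint k \<le> 4 * En u g v k + C"
proof -
  define B where "B = B\<^sub>1 + B\<^sub>2"
  define c where "c = \<mu>\<^sub>1 + \<mu>\<^sub>2 + \<rho> + \<beta>"
  \<comment> \<open>Makes \<open>2 * L * c * B = B / (4 * (B + 1))\<close>, which is at most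
    \<open>1 / 4\<close>.\<close>
  define L where "L = 1 / (8 * (B + 1) * c)"
  have c: "c > 0" using pos by (simp add: c_def)
  have B0: "B \<ge> 0" using assms by (simp add: B_def)
  have L: "L > 0" using c B0 by (simp add: L_def)
  define C where "C = c * (2 * B / L) * B + \<beta> * B"
  have "sqint g + sqint k \<le> 4 * En u g v k + 4 * C"
    if u: "AC u g" and v: "AC v k" and m: "sqint u = B\<^sub>1" "sqint v = B\<^sub>2" for u g v k
  proof -
    define G where "G = sqint g + sqint k"
    have G0: "sqint g \<ge> 0" "sqint k \<ge> 0" by auto
    define s where "s = sqrt (2 * B / L + 2 * L * G)"
    have s2: "s\<^sup>2 = 2 * B / L + 2 * L * G" unfolding s_def using B0 L G0 by (simp add: G_def)
    have su: "\<bar>u x\<bar> \<le> s" for x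
    proof (rule order_trans[OF AC_abs_bound[OF u L]])
      have "2 * sqint u / L \<le> 2 * B / L" using L assms m by (intro divide_right_mono) (auto simp: B_def)
      moreover have "2 * L * sqint g \<le> 2 * L * G" using L G0 by (intro mult_left_mono) (auto simp: G_def)
      ultimately show "sqrt (2 * sqint u / L + 2 * L * sqint g) \<le> s" unfolding s_def by simp
    qed
    have sv: "\<bar>v x\<bar> \<le> s" for x
    proof (rule order_trans[OF AC_abs_bound[OF v L]])
      have "2 * sqint v / L \<le> 2 * B / L" using L assms m by (intro divide_right_mono) (auto simp: B_def)
      moreover have "2 * L * sqint k \<le> 2 * L * G" using L G0 by (intro mult_left_mono) (auto simp: G_def)
      ultimately show "sqrt (2 * sqint v / L + 2 * L * sqint k) \<le> s" unfolding s_def by simp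
    qed
    \<comment> \<open>The linear term of \<open>growth\<close> is absorbed by means of
      \<open>s \<le> 1 + s\<^sup>2\<close>.\<close>
    have "2 * s \<le> s\<^sup>2 + 1" "0 \<le> s\<^sup>2" using sum_squares_bound[of s 1] by simp_all
    then have "s \<le> 1 + s\<^sup>2" by linarith
    then have "\<beta> * s \<le> \<beta> * (1 + s\<^sup>2)" using pos by (intro mult_left_mono) auto
    then have "growth s \<le> c * s\<^sup>2 + \<beta>" unfolding growth_def c_def by (simp add: algebra_simps)
    then have "growth s * B \<le> (c * s\<^sup>2 + \<beta>) * B" using B0 by (intro mult_right_mono) auto
    also have "(c * s\<^sup>2 + \<beta>) * B = C + (2 * L * c * B) * G"
      unfolding s2 C_def by (simp add: algebra_simps)
    also have "(2 * L * c * B) * G \<le> (1 / 4) * G"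
    proof (rule mult_right_mono)
      have "L * c = 1 / (8 * (B + 1))" using c by (simp add: L_def)
      then have "2 * L * c * B = 2 * (1 / (8 * (B + 1))) * B" by (simp only: mult.assoc)
      also have "\<dots> \<le> 1 / 4" using B0 by (simp add: divide_simps)
      finally show "2 * L * c * B \<le> 1 / 4" .
    qed (simp add: G_def)
    finally have "growth s * B \<le> C + (1 / 4) * G" by simp
    moreover have "pot u v \<le> growth s * B"
      using pot_bound[OF AC_L2(1)[OF u] AC_L2(1)[OF v] su sv] m by (simp add: B_def)
    moreover have "En u g v k = G / 2 - pot u v" by (simp add: En_def G_def)
    ultimately show ?thesis unfolding G_def[symmetric] by linarith
  qed
  then show ?thesis by (rule that)
qed

end

section \<open>Compactness of minimizing sequences\<close>

context coupled
begin

text \<open>Every monomial is multiplied by its own product of powers of \<open>\<theta>\<close> and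
  \<open>\<tau>\<close>, so the change is governed by the distances of these products from
  1.\<close>

lemma dens_scale:
  assumes "\<bar>a\<bar> \<le> S" "\<bar>b\<bar> \<le> S"
  shows "\<bar>dens (\<theta> * a) (\<tau> * b) - dens a b\<bar>
    \<le> (\<mu>\<^sub>1 * \<bar>\<theta> ^ 4 - 1\<bar> * S\<^sup>2 + \<mu>\<^sub>2 * \<bar>\<tau> ^ 4 - 1\<bar> * S\<^sup>2 + \<rho> * \<bar>\<theta>\<^sup>2 * \<tau>\<^sup>2 - 1\<bar> * S\<^sup>2 + \<beta> * \<bar>\<theta>\<^sup>2 * \<tau> - 1\<bar> * S)
      * (a\<^sup>2 + b\<^sup>2)"
proof -
  have S: "S \<ge> 0" using assms by linarith
  have a: "a\<^sup>2 \<le> S\<^sup>2" and b: "b\<^sup>2 \<le> S\<^sup>2" using assms by (auto intro: power2_le_of_abs_le)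
  have ab: "a\<^sup>2 \<le> a\<^sup>2 + b\<^sup>2" "b\<^sup>2 \<le> a\<^sup>2 + b\<^sup>2" by auto
  have 1: "\<bar>a ^ 4\<bar> \<le> S\<^sup>2 * (a\<^sup>2 + b\<^sup>2)"
    using mult_mono[OF a ab(1)] by (simp add: power2_eq_square power4_eq_xxxx mult.assoc abs_mult)
  have 2: "\<bar>b ^ 4\<bar> \<le> S\<^sup>2 * (a\<^sup>2 + b\<^sup>2)"
    using mult_mono[OF b ab(2)] by (simp add: power2_eq_square power4_eq_xxxx mult.assoc abs_mult)
  have 3: "\<bar>a\<^sup>2 * b\<^sup>2\<bar> \<le> S\<^sup>2 * (a\<^sup>2 + b\<^sup>2)"
    using mult_mono[OF a ab(2)] by simp
  have 4: "\<bar>a\<^sup>2 * b\<bar> \<le> S * (a\<^sup>2 + b\<^sup>2)"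
    using mult_mono[OF assms(2) ab(1)] S by (simp add: mult.commute abs_mult)
  have eq: "dens (\<theta> * a) (\<tau> * b) - dens a b = \<mu>\<^sub>1 / 4 * ((\<theta> ^ 4 - 1) * a ^ 4) + \<mu>\<^sub>2 / 4 * ((\<tau> ^ 4 - 1) * b ^ 4)
      + \<rho> / 2 * ((\<theta>\<^sup>2 * \<tau>\<^sup>2 - 1) * (a\<^sup>2 * b\<^sup>2)) + \<beta> / 2 * ((\<theta>\<^sup>2 * \<tau> - 1) * (a\<^sup>2 * b))"
    by (simp add: dens_def power_mult_distrib algebra_simps)
  have "\<bar>dens (\<theta> * a) (\<tau> * b) - dens a b\<bar> \<le> \<mu>\<^sub>1 * (\<bar>\<theta> ^ 4 - 1\<bar> * (S\<^sup>2 * (a\<^sup>2 + b\<^sup>2))) + \<mu>\<^sub>2 * (\<bar>\<tau> ^ 4 - 1\<bar> * (S\<^sup>2 * (a\<^sup>2 + b\<^sup>2)))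
      + \<rho> * (\<bar>\<theta>\<^sup>2 * \<tau>\<^sup>2 - 1\<bar> * (S\<^sup>2 * (a\<^sup>2 + b\<^sup>2))) + \<beta> * (\<bar>\<theta>\<^sup>2 * \<tau> - 1\<bar> * (S * (a\<^sup>2 + b\<^sup>2)))"
    unfolding eq
    by (rule abs_add_le[OF abs_add_le[OF abs_add_le[OF
        abs_mult_le[OF _ abs_mult_le[OF order_refl 1]] abs_mult_le[OF _ abs_mult_le[OF order_refl 2]]]
        abs_mult_le[OF _ abs_mult_le[OF order_refl 3]]] abs_mult_le[OF _ abs_mult_le[OF order_refl 4]]])
      (use pos in simp_all)
  also have "\<dots> = (\<mu>\<^sub>1 * \<bar>\<theta> ^ 4 - 1\<bar> * S\<^sup>2 + \<mu>\<^sub>2 * \<bar>\<tau> ^ 4 - 1\<bar> * S\<^sup>2 + \<rho> * \<bar>\<theta>\<^sup>2 * \<tau>\<^sup>2 - 1\<bar> * S\<^sup>2 + \<beta> * \<bar>\<theta>\<^sup>2 * \<tau> - 1\<bar> * S)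
      * (a\<^sup>2 + b\<^sup>2)"
    by (simp add: distrib_right mult.assoc)
  finally show ?thesis .
qed

lemma sqint_scale: "sqint (\<lambda>x. c * u x) = c\<^sup>2 * sqint u"
  by (simp add: power_mult_distrib)

text \<open>The factors \<open>\<theta> n\<close> and \<open>\<tau> n\<close> put the pair back on
  the constraint, where \<open>lower\<close> applies. They tend to 1, and the energy rises by at
  most \<open>\<Omega> n\<close>, which tends to 0 because kinetic energies and masses are
  bounded.\<close>

lemma En_near_constraint:
  assumes b: "b\<^sub>1 > 0" "b\<^sub>2 > 0"
    and lower: "\<And>u g v k. AC u g \<Longrightarrow> AC v k \<Longrightarrow> sqint u = b\<^sub>1\<^sup>2 \<Longrightarrow> sqint v = b\<^sub>2\<^sup>2 \<Longrightarrow> m0 \<le> En u g v k"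
    and h: "\<And>n. AC (h n) (h' n)" and l: "\<And>n. AC (l n) (l' n)"
    and R: "\<And>n. sqint (h' n) \<le> R" "\<And>n. sqint (l' n) \<le> R"
    and lim: "(\<lambda>n. sqint (h n)) \<longlonglongrightarrow> b\<^sub>1\<^sup>2" "(\<lambda>n. sqint (l n)) \<longlonglongrightarrow> b\<^sub>2\<^sup>2"
    and e: "e > 0"
  shows "\<forall>\<^sub>F n in sequentially. m0 - e < En (h n) (h' n) (l n) (l' n)"
proof -
  obtain M1 where M1: "\<And>n. sqint (h n) \<le> M1"
    using convergent_imp_Bseq[OF convergentI[OF lim(1)]] by (auto simp: Bseq_def)
  obtain M2 where M2: "\<And>n. sqint (l n) \<le> M2"
    using convergent_imp_Bseq[OF convergentI[OF lim(2)]] by (auto simp: Bseq_def)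
  define M where "M = max M1 M2"
  have M: "sqint (h n) \<le> M" "sqint (l n) \<le> M" for n
    using M1[of n] M2[of n] by (simp_all add: M_def le_max_iff_disj)
  define S where "S = sqrt (2 * M + 2 * R)"
  have S: "\<bar>h n x\<bar> \<le> S" "\<bar>l n x\<bar> \<le> S" for n x
    using order_trans[OF AC_abs_bound[OF h[of n] zero_less_one, of x], of S]
      order_trans[OF AC_abs_bound[OF l[of n] zero_less_one, of x], of S] M[of n] R(1)[of n] R(2)[of n]
    by (simp_all add: S_def)
  define \<theta> where "\<theta> = (\<lambda>n. b\<^sub>1 / sqrt (sqint (h n)))"
  define \<tau> where "\<tau> = (\<lambda>n. b\<^sub>2 / sqrt (sqint (l n)))"
  have "\<theta> \<longlonglongrightarrow> b\<^sub>1 / sqrt (b\<^sub>1\<^sup>2)" unfolding \<theta>_def using b by (intro tendsto_intros lim) auto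
  then have th: "\<theta> \<longlonglongrightarrow> 1" using b by simp
  have "\<tau> \<longlonglongrightarrow> b\<^sub>2 / sqrt (b\<^sub>2\<^sup>2)" unfolding \<tau>_def using b by (intro tendsto_intros lim) auto
  then have ta: "\<tau> \<longlonglongrightarrow> 1" using b by simp
  define \<omega> where "\<omega> = (\<lambda>n. \<mu>\<^sub>1 * \<bar>\<theta> n ^ 4 - 1\<bar> * S\<^sup>2 + \<mu>\<^sub>2 * \<bar>\<tau> n ^ 4 - 1\<bar> * S\<^sup>2
    + \<rho> * \<bar>(\<theta> n)\<^sup>2 * (\<tau> n)\<^sup>2 - 1\<bar> * S\<^sup>2 + \<beta> * \<bar>(\<theta> n)\<^sup>2 * \<tau> n - 1\<bar> * S)"
  define \<Omega> where "\<Omega> = (\<lambda>n. \<bar>(\<theta> n)\<^sup>2 - 1\<bar> * R + \<bar>(\<tau> n)\<^sup>2 - 1\<bar> * R + \<omega> n * (M + M))"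
  have "\<Omega> \<longlonglongrightarrow> \<bar>1\<^sup>2 - 1\<bar> * R + \<bar>1\<^sup>2 - 1\<bar> * R + (\<mu>\<^sub>1 * \<bar>1 ^ 4 - 1\<bar> * S\<^sup>2 + \<mu>\<^sub>2 * \<bar>1 ^ 4 - 1\<bar> * S\<^sup>2
    + \<rho> * \<bar>1\<^sup>2 * 1\<^sup>2 - 1\<bar> * S\<^sup>2 + \<beta> * \<bar>1\<^sup>2 * 1 - 1\<bar> * S) * (M + M)"
    unfolding \<Omega>_def \<omega>_def by (intro tendsto_intros th ta)
  then have "\<Omega> \<longlonglongrightarrow> 0" by simp
  then have ev1: "\<forall>\<^sub>F n in sequentially. \<Omega> n < e" using e by (intro order_tendstoD)
  have ev2: "\<forall>\<^sub>F n in sequentially. 0 < sqint (h n)" using order_tendstoD(1)[OF lim(1), of 0] b by simp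
  have ev3: "\<forall>\<^sub>F n in sequentially. 0 < sqint (l n)" using order_tendstoD(1)[OF lim(2), of 0] b by simp
  show ?thesis using ev1 ev2 ev3
  proof eventually_elim
    case (elim n)
    let ?h = "\<lambda>x. \<theta> n * h n x" and ?h' = "\<lambda>x. \<theta> n * h' n x" and ?l = "\<lambda>x. \<tau> n * l n x" and ?l' = "\<lambda>x. \<tau> n * l' n x"
    have ac: "AC ?h ?h'" "AC ?l ?l'" by (intro AC_scale h l)+
    have "sqint ?h = b\<^sub>1\<^sup>2" "sqint ?l = b\<^sub>2\<^sup>2"
      unfolding sqint_scale \<theta>_def \<tau>_def using elim by (simp_all add: power_divide)
    then have low: "m0 \<le> En ?h ?h' ?l ?l'" by (rule lower[OF ac])
    have B: "h n \<in> BL2" "l n \<in> BL2" "?h \<in> BL2" "?l \<in> BL2"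
      using AC_BL2[OF h] AC_BL2[OF l] AC_BL2[OF ac(1)] AC_BL2[OF ac(2)] by auto
    note i = dens_integrable[OF B(3,4)] dens_integrable[OF B(1,2)]
    have L: "h n \<in> L2" "l n \<in> L2" using h l by (auto intro: AC_L2(1))
    have \<omega>0: "\<omega> n \<ge> 0"
      unfolding \<omega>_def using pos order_trans[OF abs_ge_zero S(1)[of n 0]] by (intro add_nonneg_nonneg mult_nonneg_nonneg) auto
    have "\<bar>pot ?h ?l - pot (h n) (l n)\<bar> = \<bar>LINT x|lborel. dens (?h x) (?l x) - dens (h n x) (l n x)\<bar>"
      unfolding pot_def by (simp only: Bochner_Integration.integral_diff i)
    also have "\<dots> \<le> (LINT x|lborel. \<bar>dens (?h x) (?l x) - dens (h n x) (l n x)\<bar>)"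
      using integral_norm_bound[of lborel "\<lambda>x. dens (?h x) (?l x) - dens (h n x) (l n x)"] by simp
    also have "\<dots> \<le> (LINT x|lborel. \<omega> n * ((h n x)\<^sup>2 + (l n x)\<^sup>2))"
      unfolding \<omega>_def
      by (intro integral_mono integrable_abs Bochner_Integration.integrable_diff i integrable_mult_right
        Bochner_Integration.integrable_add L2_integrable_power2 L dens_scale S)
    also have "\<dots> = \<omega> n * (sqint (h n) + sqint (l n))"
      using L2_integrable_power2[OF L(1)] L2_integrable_power2[OF L(2)] by simp
    also have "\<dots> \<le> \<omega> n * (M + M)" by (intro mult_left_mono add_mono M \<omega>0)
    finally have p: "\<bar>pot ?h ?l - pot (h n) (l n)\<bar> \<le> \<omega> n * (M + M)" .
    have "((\<theta> n)\<^sup>2 - 1) * sqint (h' n) \<le> \<bar>(\<theta> n)\<^sup>2 - 1\<bar> * R" "((\<tau> n)\<^sup>2 - 1) * sqint (l' n) \<le> \<bar>(\<tau> n)\<^sup>2 - 1\<bar> * R"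
      by (intro mult_mono R; simp)+
    then have k1: "sqint ?h' \<le> sqint (h' n) + \<bar>(\<theta> n)\<^sup>2 - 1\<bar> * R" "sqint ?l' \<le> sqint (l' n) + \<bar>(\<tau> n)\<^sup>2 - 1\<bar> * R"
      unfolding sqint_scale left_diff_distrib by linarith+
    have "0 \<le> R" using R(1)[of n] sqint_nonneg[of "h' n"] by linarith
    then have "0 \<le> \<bar>(\<theta> n)\<^sup>2 - 1\<bar> * R" "0 \<le> \<bar>(\<tau> n)\<^sup>2 - 1\<bar> * R" by auto
    have arith: "A' \<le> A + X \<Longrightarrow> B' \<le> B + Y \<Longrightarrow> \<bar>p' - p\<bar> \<le> Z \<Longrightarrow> 0 \<le> X \<Longrightarrow> 0 \<le> Y
      \<Longrightarrow> (A' + B') / 2 - p' \<le> (A + B) / 2 - p + (X + Y + Z)" for A A' B B' X Y Z p p' :: real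
      by (simp add: abs_le_iff field_simps)
    have "En ?h ?h' ?l ?l' \<le> En (h n) (h' n) (l n) (l' n) + \<Omega> n"
      unfolding En_def \<Omega>_def by (rule arith[OF k1 p]) fact+
    then show ?case using low elim(1) by linarith
  qed
qed

text \<open>Near \<open>x0\<close> the fixed pair stays away from 0 by continuity; a function
  exceeding \<open>s\<close> in modulus at \<open>y\<close> stays above \<open>s / 2\<close> on an
  interval whose length depends only on \<open>s\<close> and \<open>P\<close>. Translating by
  \<open>y - x0\<close> makes the two intervals coincide, so \<open>\<delta>\<close> is the same for
  all remainders.\<close>

lemma interaction_lower_bound:
  assumes U: "AC U g" and V: "AC V k" and x0: "U x0 \<noteq> 0 \<or> V x0 \<noteq> 0" and s: "s > 0" and P: "P \<ge> 0"
  obtains \<delta> where "\<delta> > 0" "\<And>w p z q y. AC w p \<Longrightarrow> AC z q \<Longrightarrow> sqint p \<le> P \<Longrightarrow> sqint q \<le> P \<Longrightarrow> \<bar>w y\<bar> > s \<or> \<bar>z y\<bar> > s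
    \<Longrightarrow> \<exists>c. \<delta> \<le> (LINT x|lborel. ((U x)\<^sup>2 + (V x)\<^sup>2) * ((w (x + c))\<^sup>2 + (z (x + c))\<^sup>2))"
proof -
  define f where "f = (\<lambda>x. (U x)\<^sup>2 + (V x)\<^sup>2)"
  have fx0: "f x0 > 0" unfolding f_def using x0 by (auto simp: add_nonneg_pos add_pos_nonneg)
  have "continuous_on UNIV f"
    unfolding f_def by (intro continuous_intros AC_continuous[OF U] AC_continuous[OF V])
  then have "(f \<longlongrightarrow> f x0) (at x0)" by (simp add: continuous_on_eq_continuous_at isCont_def)
  then have "\<forall>\<^sub>F x in at x0. f x > f x0 / 2" using fx0 by (intro order_tendstoD) auto
  then obtain d where d: "d > 0" "\<And>x. x \<noteq> x0 \<Longrightarrow> dist x x0 < d \<Longrightarrow> f x > f x0 / 2"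
    unfolding eventually_at by auto
  \<comment> \<open>The second entry gives \<open>D * P \<le> s\<^sup>2 / 4\<close>, so by the
    Hoelder bound \<open>w\<close> varies by at most \<open>s / 2\<close> over the length
    \<open>D\<close>.\<close>
  define D where "D = min d (s\<^sup>2 / (4 * (P + 1)))"
  have D: "D > 0" using d s P by (simp add: D_def)
  have DP: "D * P \<le> s\<^sup>2 / 4"
  proof -
    have "D * P \<le> (s\<^sup>2 / (4 * (P + 1))) * (P + 1)" using D P by (intro mult_mono) (auto simp: D_def)
    also have "\<dots> = s\<^sup>2 / 4" using P by (simp add: divide_simps)
    finally show ?thesis .
  qed
  have fD: "f x \<ge> f x0 / 2" if "x \<in> {x0..<x0 + D}" for x
  proof (cases "x = x0")
    case False
    have "D \<le> d" by (simp add: D_def)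
    then have "dist x x0 < d" using that by (simp add: dist_real_def)
    then show ?thesis using d(2)[OF False] by simp
  qed (use fx0 in simp)
  have half: "(w (x + (y - x0)))\<^sup>2 \<ge> s\<^sup>2 / 4"
    if w: "AC w p" "sqint p \<le> P" "\<bar>w y\<bar> > s" and x: "x \<in> {x0..<x0 + D}" for w p y x
  proof -
    have "(w (x + (y - x0)) - w y)\<^sup>2 \<le> \<bar>x + (y - x0) - y\<bar> * sqint p" by (rule AC_Hoelder[OF w(1)])
    also have "\<dots> \<le> D * P" using x w(2) D by (intro mult_mono) auto
    also have "\<dots> \<le> (s / 2)\<^sup>2" using DP by (simp add: power_divide)
    finally have "\<bar>w (x + (y - x0)) - w y\<bar> \<le> s / 2"
      using s by (simp add: abs_le_square_iff[symmetric])
    then have "s / 2 \<le> \<bar>w (x + (y - x0))\<bar>" using w(3) by linarith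
    then have "(s / 2)\<^sup>2 \<le> \<bar>w (x + (y - x0))\<bar>\<^sup>2" using s by (intro power_mono) auto
    then show ?thesis by (simp add: power_divide)
  qed
  define \<delta> where "\<delta> = D * (f x0 / 2 * (s\<^sup>2 / 4))"
  show ?thesis
  proof (rule that[of \<delta>])
    show "\<delta> > 0" using D fx0 s by (simp add: \<delta>_def)
    fix w p z q y
    assume w: "AC w p" and z: "AC z q" and p: "sqint p \<le> P" and q: "sqint q \<le> P" and y: "\<bar>w y\<bar> > s \<or> \<bar>z y\<bar> > s"
    define c where "c = y - x0"
    let ?F = "\<lambda>x. ((U x)\<^sup>2 + (V x)\<^sup>2) * ((w (x + c))\<^sup>2 + (z (x + c))\<^sup>2)"
    note B = AC_BL2[OF U] AC_BL2[OF V] AC_BL2[OF AC_translate[OF w, of c]] AC_BL2[OF AC_translate[OF z, of c]]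
    have "integrable lborel (\<lambda>x. (U x)\<^sup>2 * (w (x + c))\<^sup>2 + (V x)\<^sup>2 * (w (x + c))\<^sup>2
        + ((U x)\<^sup>2 * (z (x + c))\<^sup>2 + (V x)\<^sup>2 * (z (x + c))\<^sup>2))"
      by (intro Bochner_Integration.integrable_add BL2_integrable BL2_power2 B)
    then have i: "integrable lborel ?F" by (simp add: distrib_left distrib_right)
    have ind: "integrable lborel (\<lambda>x. indicator {x0..<x0 + D} x * (f x0 / 2 * (s\<^sup>2 / 4)) :: real)"
      using D by (intro integrable_mult_left integrable_real_indicator) (auto simp: emeasure_lborel_Ico)
    have "\<delta> = (LINT x|lborel. indicator {x0..<x0 + D} x * (f x0 / 2 * (s\<^sup>2 / 4)))"
      using D by (simp add: \<delta>_def)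
    also have "\<dots> \<le> (LINT x|lborel. ?F x)"
    proof (intro integral_mono i ind)
      fix x
      show "indicator {x0..<x0 + D} x * (f x0 / 2 * (s\<^sup>2 / 4)) \<le> ?F x"
      proof (cases "x \<in> {x0..<x0 + D}")
        case True
        have "s\<^sup>2 / 4 \<le> (w (x + c))\<^sup>2 + (z (x + c))\<^sup>2"
          using y
        proof
          assume "\<bar>w y\<bar> > s"
          then have "s\<^sup>2 / 4 \<le> (w (x + c))\<^sup>2" unfolding c_def by (rule half[OF w p _ True])
          then show ?thesis by (simp add: add_increasing2)
        next
          assume "\<bar>z y\<bar> > s"
          then have "s\<^sup>2 / 4 \<le> (z (x + c))\<^sup>2" unfolding c_def by (rule half[OF z q _ True])
          then show ?thesis by (simp add: add_increasing)
        qed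
        then have "f x0 / 2 * (s\<^sup>2 / 4) \<le> ?F x"
          using fD[OF True] fx0 unfolding f_def by (intro mult_mono) auto
        then show ?thesis using True by simp
      qed simp
    qed
    finally show "\<exists>c. \<delta> \<le> (LINT x|lborel. ((U x)\<^sup>2 + (V x)\<^sup>2) * ((w (x + c))\<^sup>2 + (z (x + c))\<^sup>2))" by blast
  qed
qed

lemma growth_small:
  assumes "e > 0"
  obtains s where "s > 0" "growth s < e"
proof -
  have "(growth \<longlongrightarrow> (\<mu>\<^sub>1 + \<mu>\<^sub>2 + \<rho>) * 0\<^sup>2 + \<beta> * 0) (at_right 0)"
    unfolding growth_def by (intro tendsto_intros)
  then have "\<forall>\<^sub>F s in at_right 0. growth s < e" using assms by (intro order_tendstoD) auto
  moreover have "\<forall>\<^sub>F s in at_right 0. s > (0::real)" by (rule eventually_at_right_less)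
  ultimately have "\<forall>\<^sub>F s in at_right 0. s > 0 \<and> growth s < e" by eventually_elim simp
  then show ?thesis using that eventually_happens'[OF trivial_limit_at_right_real] by blast
qed


text \<open>Cross terms between limit and remainder vanish by weak convergence, so masses, kinetic
  energies and potentials all split in the limit. The nonzero value at \<open>x0\<close> guarantees
  that the limit can interact with a translated remainder. Everything known about \<open>m0\<close>
  as an infimum is \<open>lower\<close>, and both cases of mass loss contradict it.\<close>

lemma minimizing_weak_limit_is_strong:
  assumes b: "b\<^sub>1 > 0" "b\<^sub>2 > 0"
    and lower: "\<And>u g v k. AC u g \<Longrightarrow> AC v k \<Longrightarrow> sqint u = b\<^sub>1\<^sup>2 \<Longrightarrow> sqint v = b\<^sub>2\<^sup>2 \<Longrightarrow> m0 \<le> En u g v k"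
    and u: "\<And>n. AC (u n) (g n)" and v: "\<And>n. AC (v n) (k n)"
    and mass: "\<And>n. sqint (u n) = b\<^sub>1\<^sup>2" "\<And>n. sqint (v n) = b\<^sub>2\<^sup>2"
    and G: "\<And>n. sqint (g n) \<le> G" "\<And>n. sqint (k n) \<le> G"
    and En: "(\<lambda>n. En (u n) (g n) (v n) (k n)) \<longlonglongrightarrow> m0"
    and lim: "\<And>x. (\<lambda>n. u n x) \<longlonglongrightarrow> U x" "\<And>x. (\<lambda>n. v n x) \<longlonglongrightarrow> V x"
    and nz: "U x0 \<noteq> 0 \<or> V x0 \<noteq> 0"
  obtains g' k' where "AC U g'" "AC V k'" "sqint U = b\<^sub>1\<^sup>2" "sqint V = b\<^sub>2\<^sup>2" "En U g' V k' = m0"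
    "(\<lambda>n. sqint (\<lambda>x. u n x - U x)) \<longlonglongrightarrow> 0" "(\<lambda>n. sqint (\<lambda>x. v n x - V x)) \<longlonglongrightarrow> 0"
    "(\<lambda>n. sqint (\<lambda>x. g n x - g' x)) \<longlonglongrightarrow> 0" "(\<lambda>n. sqint (\<lambda>x. k n x - k' x)) \<longlonglongrightarrow> 0"
proof -
  have G0: "G \<ge> 0" using G(1)[of 0] sqint_nonneg[of "g 0"] by linarith
  obtain g' where U: "AC U g'" and g': "sqint g' \<le> G"
    by (rule AC_limit[OF u eq_refl[OF mass(1)] G(1) lim(1)])
  obtain k' where V: "AC V k'" and k': "sqint k' \<le> G"
    by (rule AC_limit[OF v eq_refl[OF mass(2)] G(2) lim(2)])
  define w where "w = (\<lambda>n x. u n x - U x)"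
  define p where "p = (\<lambda>n x. g n x - g' x)"
  define z where "z = (\<lambda>n x. v n x - V x)"
  define q where "q = (\<lambda>n x. k n x - k' x)"
  have w: "AC (w n) (p n)" and z: "AC (z n) (q n)" for n
    unfolding w_def p_def z_def q_def by (intro AC_diff u v U V)+
  have wlim: "(\<lambda>n. w n x) \<longlonglongrightarrow> 0" for x
    unfolding w_def using tendsto_diff[OF lim(1) tendsto_const, of x "U x"] by simp
  have zlim: "(\<lambda>n. z n x) \<longlonglongrightarrow> 0" for x
    unfolding z_def using tendsto_diff[OF lim(2) tendsto_const, of x "V x"] by simp
  note L = AC_L2[OF u] AC_L2[OF v] AC_L2[OF U] AC_L2[OF V] AC_L2[OF w] AC_L2[OF z]
  \<comment> \<open>Large enough for the masses of limit and remainder alike, so that a single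
    \<open>S\<close> bounds all four functions.\<close>
  define B where "B = 2 * b\<^sub>1\<^sup>2 + 2 * sqint U + 2 * b\<^sub>2\<^sup>2 + 2 * sqint V"
  have wB: "sqint (w n) \<le> B" and zB: "sqint (z n) \<le> B" for n
    using sqint_diff_le[OF L(1,5), of n] sqint_diff_le[OF L(3,7), of n] mass(1)[of n] mass(2)[of n]
      sqint_nonneg[of U] sqint_nonneg[of V] zero_le_power2[of b\<^sub>1] zero_le_power2[of b\<^sub>2]
    unfolding w_def z_def B_def by linarith+
  have B0: "B \<ge> 0" using wB[of 0] sqint_nonneg[of "w 0"] by linarith
  have pG: "sqint (p n) \<le> 4 * G" and qG: "sqint (q n) \<le> 4 * G" for n
    using sqint_diff_le[OF L(2,6), of n] sqint_diff_le[OF L(4,8), of n] G(1)[of n] G(2)[of n] g' k'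
    unfolding p_def q_def by linarith+
  define S where "S = sqrt (2 * B + 8 * G)"
  have SI: "\<bar>f x\<bar> \<le> S" if f: "AC f f'" "sqint f \<le> B" "sqint f' \<le> 4 * G" for f f' x
    using order_trans[OF AC_abs_bound[OF f(1) zero_less_one, of x], of S] f(2,3) by (simp add: S_def)
  have S: "\<bar>U x\<bar> \<le> S" "\<bar>V x\<bar> \<le> S" "\<bar>w n x\<bar> \<le> S" "\<bar>z n x\<bar> \<le> S" for n x
  proof -
    have "sqint U \<le> B" "sqint V \<le> B"
      using sqint_nonneg[of U] sqint_nonneg[of V] zero_le_power2[of b\<^sub>1] zero_le_power2[of b\<^sub>2]
      unfolding B_def by linarith+
    then show "\<bar>U x\<bar> \<le> S" "\<bar>V x\<bar> \<le> S"
      using g' k' G0 by (auto intro!: SI[OF U] SI[OF V])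
    show "\<bar>w n x\<bar> \<le> S" "\<bar>z n x\<bar> \<le> S"
      by (rule SI[OF w wB pG] SI[OF z zB qG])+
  qed
  have u_eq: "u n = (\<lambda>x. U x + 1 * w n x)" and v_eq: "v n = (\<lambda>x. V x + 1 * z n x)"
    and g_eq: "g n = (\<lambda>x. g' x + 1 * p n x)" and k_eq: "k n = (\<lambda>x. k' x + 1 * q n x)" for n
    by (auto simp: w_def z_def p_def q_def)
  have iw: "(\<lambda>n. LINT x|lborel. U x * w n x) \<longlonglongrightarrow> 0"
    by (rule L2_inner_null[OF L(5) L(9) L2_weak_null[OF L(5) L(9) wB S(3) wlim]])
  have iz: "(\<lambda>n. LINT x|lborel. V x * z n x) \<longlonglongrightarrow> 0"
    by (rule L2_inner_null[OF L(7) L(11) L2_weak_null[OF L(7) L(11) zB S(4) zlim]])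
  have ip: "(\<lambda>n. LINT x|lborel. g' x * p n x) \<longlonglongrightarrow> 0"
    by (rule AC_gradient_weak_null[OF U w pG wlim])
  have iq: "(\<lambda>n. LINT x|lborel. k' x * q n x) \<longlonglongrightarrow> 0"
    by (rule AC_gradient_weak_null[OF V z qG zlim])
  have mw: "sqint (w n) = b\<^sub>1\<^sup>2 - sqint U - 2 * (LINT x|lborel. U x * w n x)" for n
  proof -
    have "sqint (u n) = sqint U + 2 * 1 * (LINT x|lborel. U x * w n x) + 1\<^sup>2 * sqint (w n)"
      by (subst u_eq) (rule sqint_linear[OF L(5) L(9)])
    then show ?thesis unfolding mass by simp
  qed
  have mz: "sqint (z n) = b\<^sub>2\<^sup>2 - sqint V - 2 * (LINT x|lborel. V x * z n x)" for n
  proof -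
    have "sqint (v n) = sqint V + 2 * 1 * (LINT x|lborel. V x * z n x) + 1\<^sup>2 * sqint (z n)"
      by (subst v_eq) (rule sqint_linear[OF L(7) L(11)])
    then show ?thesis unfolding mass by simp
  qed
  have kg: "sqint (g n) = sqint g' + 2 * (LINT x|lborel. g' x * p n x) + sqint (p n)" for n
    by (subst g_eq) (use sqint_linear[OF L(6) L(10), of 1 n] in simp)
  have kk: "sqint (k n) = sqint k' + 2 * (LINT x|lborel. k' x * q n x) + sqint (q n)" for n
    by (subst k_eq) (use sqint_linear[OF L(8) L(12), of 1 n] in simp)
  \<comment> \<open>The masses that escape from the limit.\<close>
  define c\<^sub>1 where "c\<^sub>1 = b\<^sub>1\<^sup>2 - sqint U"
  define c\<^sub>2 where "c\<^sub>2 = b\<^sub>2\<^sup>2 - sqint V"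
  have "(\<lambda>n. sqint (w n)) \<longlonglongrightarrow> b\<^sub>1\<^sup>2 - sqint U - 2 * 0"
    unfolding mw by (intro tendsto_intros iw)
  then have c1: "(\<lambda>n. sqint (w n)) \<longlonglongrightarrow> c\<^sub>1" by (simp add: c\<^sub>1_def)
  have "(\<lambda>n. sqint (z n)) \<longlonglongrightarrow> b\<^sub>2\<^sup>2 - sqint V - 2 * 0"
    unfolding mz by (intro tendsto_intros iz)
  then have c2: "(\<lambda>n. sqint (z n)) \<longlonglongrightarrow> c\<^sub>2" by (simp add: c\<^sub>2_def)
  have c0: "c\<^sub>1 \<ge> 0" "c\<^sub>2 \<ge> 0"
    using LIMSEQ_le_const[OF c1, of 0] LIMSEQ_le_const[OF c2, of 0] by auto
  define EU where "EU = En U g' V k'"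
  define Ew where "Ew = (\<lambda>n. En (w n) (p n) (z n) (q n))"
  have Ew: "Ew \<longlonglongrightarrow> m0 - EU"
  proof -
    define D where "D = (\<lambda>n. pot (\<lambda>x. U x + w n x) (\<lambda>x. V x + z n x) - pot U V - pot (w n) (z n))"
    have D: "D \<longlonglongrightarrow> 0"
      unfolding D_def by (rule pot_split_null[OF L(5,7,9,11) S wB zB wlim zlim])
    have e: "Ew n = En (u n) (g n) (v n) (k n) - EU - (LINT x|lborel. g' x * p n x) - (LINT x|lborel. k' x * q n x) + D n" for n
    proof -
      have "pot (u n) (v n) = D n + pot U V + pot (w n) (z n)"
        unfolding D_def u_eq[of n] v_eq[of n] by simp
      then show ?thesis unfolding Ew_def EU_def En_def kg kk by (simp add: field_simps)
    qed
    have "(\<lambda>n. Ew n) \<longlonglongrightarrow> m0 - EU - 0 - 0 + 0"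
      unfolding e by (intro tendsto_intros En ip iq D)
    then show ?thesis by simp
  qed
  have "c\<^sub>1 + c\<^sub>2 = 0"
  proof (rule ccontr)
    assume "c\<^sub>1 + c\<^sub>2 \<noteq> 0"
    then have cpos: "c\<^sub>1 + c\<^sub>2 > 0" using c0 by linarith
    show False
    proof (cases "\<forall>s>0. \<forall>\<^sub>F n in sequentially. \<forall>x. \<bar>w n x\<bar> \<le> s \<and> \<bar>z n x\<bar> \<le> s")
      case True
      \<comment> \<open>A uniformly vanishing remainder has negligible potential energy and
        nonnegative kinetic energy.\<close>
      have "0 \<le> m0 - EU"
      proof (rule field_le_epsilon)
        fix e :: real assume e: "e > 0"
        obtain s where s: "s > 0" "growth s < e / (2 * B + 1)"
          using growth_small[of "e / (2 * B + 1)"] e B0 by auto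
        have "\<forall>\<^sub>F n in sequentially. - e \<le> Ew n"
          using True[rule_format, OF s(1)]
        proof eventually_elim
          case (elim n)
          have gs: "growth s \<ge> 0" using s(1) pos unfolding growth_def by simp
          have "\<bar>pot (w n) (z n)\<bar> \<le> growth s * (sqint (w n) + sqint (z n))"
            using elim by (intro pot_bound L) auto
          also have "\<dots> \<le> growth s * (2 * B + 1)"
            using wB[of n] zB[of n] gs by (intro mult_left_mono) auto
          also have "\<dots> \<le> e" using s(2) B0 by (simp add: field_simps)
          finally have "\<bar>pot (w n) (z n)\<bar> \<le> e" .
          moreover have "- pot (w n) (z n) \<le> Ew n" unfolding Ew_def En_def by simp
          ultimately show ?case by linarith
        qed
        then have "- e \<le> m0 - EU" by (rule tendsto_lowerbound[OF Ew]) simp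
        then show "0 \<le> m0 - EU + e" by simp
      qed
      \<comment> \<open>Only the sum of the escaping masses is known to be positive, which is why
        the trial pair may have one mass equal to 0.\<close>
      obtain f f' h h' where f: "AC f f'" and h: "AC h h'" and fm: "sqint f = c\<^sub>1" "sqint h = c\<^sub>2"
        and neg: "En f f' h h' < 0"
        by (rule negative_energy_exists[OF c0 cpos])
      obtain r' t' where r: "AC (\<lambda>x. sqrt ((U x)\<^sup>2 + (f x)\<^sup>2)) r'" and t: "AC (\<lambda>x. sqrt ((V x)\<^sup>2 + (h x)\<^sup>2)) t'"
        and rm: "sqint (\<lambda>x. sqrt ((U x)\<^sup>2 + (f x)\<^sup>2)) = sqint U + sqint f"
        and tm: "sqint (\<lambda>x. sqrt ((V x)\<^sup>2 + (h x)\<^sup>2)) = sqint V + sqint h"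
        and E: "En (\<lambda>x. sqrt ((U x)\<^sup>2 + (f x)\<^sup>2)) r' (\<lambda>x. sqrt ((V x)\<^sup>2 + (h x)\<^sup>2)) t'
          \<le> En U g' V k' + En f f' h h'
            - min \<mu>\<^sub>1 (min \<mu>\<^sub>2 \<rho>) / 2 * (LINT x|lborel. ((U x)\<^sup>2 + (V x)\<^sup>2) * ((f x)\<^sup>2 + (h x)\<^sup>2))"
        by (rule En_merge[OF U V f h])
      have "m0 \<le> En (\<lambda>x. sqrt ((U x)\<^sup>2 + (f x)\<^sup>2)) r' (\<lambda>x. sqrt ((V x)\<^sup>2 + (h x)\<^sup>2)) t'"
      proof (rule lower[OF r t])
        show "sqint (\<lambda>x. sqrt ((U x)\<^sup>2 + (f x)\<^sup>2)) = b\<^sub>1\<^sup>2" unfolding rm fm c\<^sub>1_def by simp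
        show "sqint (\<lambda>x. sqrt ((V x)\<^sup>2 + (h x)\<^sup>2)) = b\<^sub>2\<^sup>2" unfolding tm fm c\<^sub>2_def by simp
      qed
      moreover have "0 \<le> min \<mu>\<^sub>1 (min \<mu>\<^sub>2 \<rho>) / 2 * (LINT x|lborel. ((U x)\<^sup>2 + (V x)\<^sup>2) * ((f x)\<^sup>2 + (h x)\<^sup>2))"
        using pos by (intro mult_nonneg_nonneg integral_nonneg) auto
      ultimately have "m0 \<le> EU + En f f' h h'" using E unfolding EU_def by linarith
      then show False using \<open>0 \<le> m0 - EU\<close> neg by linarith
    next
      case False
      then obtain s where s: "s > 0" and freq: "\<not> (\<forall>\<^sub>F n in sequentially. \<forall>x. \<bar>w n x\<bar> \<le> s \<and> \<bar>z n x\<bar> \<le> s)"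
        by blast
      have "4 * G \<ge> 0" using G0 by simp
      obtain \<delta> where \<delta>: "\<delta> > 0" and inter: "\<And>w p z q y. AC w p \<Longrightarrow> AC z q \<Longrightarrow> sqint p \<le> 4 * G \<Longrightarrow> sqint q \<le> 4 * G
          \<Longrightarrow> \<bar>w y\<bar> > s \<or> \<bar>z y\<bar> > s
          \<Longrightarrow> \<exists>c. \<delta> \<le> (LINT x|lborel. ((U x)\<^sup>2 + (V x)\<^sup>2) * ((w (x + c))\<^sup>2 + (z (x + c))\<^sup>2))"
        by (rule interaction_lower_bound[OF U V nz s \<open>4 * G \<ge> 0\<close>]) (rule that)
      \<comment> \<open>By \<open>freq\<close> these indices are not eventually excluded; the
        merging argument will show that they are.\<close>
      define Bad where "Bad = (\<lambda>n. \<not> (\<forall>x. \<bar>w n x\<bar> \<le> s \<and> \<bar>z n x\<bar> \<le> s))"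
      have "\<exists>c. Bad n \<longrightarrow> \<delta> \<le> (LINT x|lborel. ((U x)\<^sup>2 + (V x)\<^sup>2) * ((w n (x + c))\<^sup>2 + (z n (x + c))\<^sup>2))" for n
      proof (cases "Bad n")
        case True
        then obtain y where "\<bar>w n y\<bar> > s \<or> \<bar>z n y\<bar> > s" by (auto simp: Bad_def not_le)
        then show ?thesis using inter[OF w[of n] z[of n] pG[of n] qG[of n]] by blast
      qed simp
      from choice[OF allI[OF this]] obtain c where
        c: "\<forall>n. Bad n \<longrightarrow> \<delta> \<le> (LINT x|lborel. ((U x)\<^sup>2 + (V x)\<^sup>2) * ((w n (x + c n))\<^sup>2 + (z n (x + c n))\<^sup>2))" ..
      define \<kappa> where "\<kappa> = min \<mu>\<^sub>1 (min \<mu>\<^sub>2 \<rho>) / 2"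
      have \<kappa>: "\<kappa> > 0" using pos by (simp add: \<kappa>_def)
      define hs where "hs = (\<lambda>n x. sqrt ((U x)\<^sup>2 + (w n (x + c n))\<^sup>2))"
      define ls where "ls = (\<lambda>n x. sqrt ((V x)\<^sup>2 + (z n (x + c n))\<^sup>2))"
      \<comment> \<open>The bound \<open>5 * G\<close> is \<open>G\<close> from the limit plus
        \<open>4 * G\<close> from the remainder.\<close>
      have "\<exists>h' l'. AC (hs n) h' \<and> AC (ls n) l' \<and> sqint (hs n) = sqint U + sqint (w n) \<and> sqint (ls n) = sqint V + sqint (z n)
          \<and> sqint h' \<le> 5 * G \<and> sqint l' \<le> 5 * G \<and> (Bad n \<longrightarrow> En (hs n) h' (ls n) l' \<le> EU + Ew n - \<kappa> * \<delta>)" for n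
      proof -
        obtain h' l' where h: "AC (hs n) h'" and l: "AC (ls n) l'"
          and hm: "sqint (hs n) = sqint U + sqint (\<lambda>x. w n (x + c n))"
          and lm: "sqint (ls n) = sqint V + sqint (\<lambda>x. z n (x + c n))"
          and hk: "sqint h' \<le> sqint g' + sqint (\<lambda>x. p n (x + c n))" and lk: "sqint l' \<le> sqint k' + sqint (\<lambda>x. q n (x + c n))"
          and E: "En (hs n) h' (ls n) l'
            \<le> En U g' V k' + En (\<lambda>x. w n (x + c n)) (\<lambda>x. p n (x + c n)) (\<lambda>x. z n (x + c n)) (\<lambda>x. q n (x + c n))
              - min \<mu>\<^sub>1 (min \<mu>\<^sub>2 \<rho>) / 2 * (LINT x|lborel. ((U x)\<^sup>2 + (V x)\<^sup>2) * ((w n (x + c n))\<^sup>2 + (z n (x + c n))\<^sup>2))"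
          unfolding hs_def ls_def
          by (rule En_merge[OF U V AC_translate[OF w] AC_translate[OF z]])
        have E': "En (hs n) h' (ls n) l' \<le> EU + Ew n - \<kappa> * \<delta>" if "Bad n"
        proof -
          have "\<kappa> * \<delta> \<le> \<kappa> * (LINT x|lborel. ((U x)\<^sup>2 + (V x)\<^sup>2) * ((w n (x + c n))\<^sup>2 + (z n (x + c n))\<^sup>2))"
            using \<kappa> c[rule_format, OF that] by (intro mult_left_mono) auto
          then show ?thesis using E unfolding En_translate EU_def[symmetric] Ew_def[symmetric] \<kappa>_def[symmetric]
            by (simp add: Ew_def)
        qed
        have "sqint h' \<le> 5 * G" "sqint l' \<le> 5 * G"
          using hk lk g' k' pG[of n] qG[of n] unfolding sqint_translate by linarith+
        then show ?thesis
          by (intro exI[of _ h'] exI[of _ l'] conjI impI h l E' hm[unfolded sqint_translate] lm[unfolded sqint_translate])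
      qed
      from choice[OF allI[OF this]] obtain h' where "\<forall>n. \<exists>l'. AC (hs n) (h' n) \<and> AC (ls n) l' \<and> sqint (hs n) = sqint U + sqint (w n)
          \<and> sqint (ls n) = sqint V + sqint (z n) \<and> sqint (h' n) \<le> 5 * G \<and> sqint l' \<le> 5 * G
          \<and> (Bad n \<longrightarrow> En (hs n) (h' n) (ls n) l' \<le> EU + Ew n - \<kappa> * \<delta>)" ..
      from choice[OF this] obtain l' where "\<forall>n. AC (hs n) (h' n) \<and> AC (ls n) (l' n) \<and> sqint (hs n) = sqint U + sqint (w n)
          \<and> sqint (ls n) = sqint V + sqint (z n) \<and> sqint (h' n) \<le> 5 * G \<and> sqint (l' n) \<le> 5 * G
          \<and> (Bad n \<longrightarrow> En (hs n) (h' n) (ls n) (l' n) \<le> EU + Ew n - \<kappa> * \<delta>)" ..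
      then have h: "\<And>n. AC (hs n) (h' n)" and l: "\<And>n. AC (ls n) (l' n)"
        and hm: "\<And>n. sqint (hs n) = sqint U + sqint (w n)" and lm: "\<And>n. sqint (ls n) = sqint V + sqint (z n)"
        and hk: "\<And>n. sqint (h' n) \<le> 5 * G" and lk: "\<And>n. sqint (l' n) \<le> 5 * G"
        and E: "\<And>n. Bad n \<Longrightarrow> En (hs n) (h' n) (ls n) (l' n) \<le> EU + Ew n - \<kappa> * \<delta>"
        by simp_all
      have "(\<lambda>n. sqint (hs n)) \<longlonglongrightarrow> sqint U + c\<^sub>1" "(\<lambda>n. sqint (ls n)) \<longlonglongrightarrow> sqint V + c\<^sub>2"
        unfolding hm lm by (intro tendsto_intros c1 c2)+
      then have ml: "(\<lambda>n. sqint (hs n)) \<longlonglongrightarrow> b\<^sub>1\<^sup>2" "(\<lambda>n. sqint (ls n)) \<longlonglongrightarrow> b\<^sub>2\<^sup>2"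
        by (simp_all add: c\<^sub>1_def c\<^sub>2_def)
      have half: "\<kappa> * \<delta> / 2 > 0" using \<kappa> \<delta> by simp
      \<comment> \<open>Half of the gain \<open>\<kappa> * \<delta>\<close> pays for the masses
        being correct only in the limit, the other half for the distance of \<open>Ew n\<close> from
        its limit.\<close>
      have ev1: "\<forall>\<^sub>F n in sequentially. m0 - \<kappa> * \<delta> / 2 < En (hs n) (h' n) (ls n) (l' n)"
        by (rule En_near_constraint[OF b lower h l hk lk ml half])
      have ev2: "\<forall>\<^sub>F n in sequentially. Ew n < m0 - EU + \<kappa> * \<delta> / 2"
        by (rule order_tendstoD(2)[OF Ew]) (use half in simp)
      have "\<forall>\<^sub>F n in sequentially. \<not> Bad n"
        using ev1 ev2
      proof eventually_elim
        case (elim n)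
        show ?case
        proof
          assume "Bad n"
          then show False using E[of n] elim by linarith
        qed
      qed
      then show False using freq by (simp add: Bad_def)
    qed
  qed
  then have cz: "c\<^sub>1 = 0" "c\<^sub>2 = 0" using c0 by linarith+
  have mU: "sqint U = b\<^sub>1\<^sup>2" and mV: "sqint V = b\<^sub>2\<^sup>2" using cz by (simp_all add: c\<^sub>1_def c\<^sub>2_def)
  have w0: "(\<lambda>n. sqint (w n)) \<longlonglongrightarrow> 0" and z0: "(\<lambda>n. sqint (z n)) \<longlonglongrightarrow> 0" using c1 c2 cz by simp_all
  have EUm: "m0 \<le> EU" unfolding EU_def by (rule lower[OF U V mU mV])
  have pot0: "(\<lambda>n. pot (w n) (z n)) \<longlonglongrightarrow> 0"
  proof (rule Lim_null_comparison)
    have "(\<lambda>n. growth S * (sqint (w n) + sqint (z n))) \<longlonglongrightarrow> growth S * (0 + 0)"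
      by (intro tendsto_intros w0 z0)
    then show "(\<lambda>n. growth S * (sqint (w n) + sqint (z n))) \<longlonglongrightarrow> 0" by simp
    have "norm (pot (w n) (z n)) \<le> growth S * (sqint (w n) + sqint (z n))" for n
      unfolding real_norm_def by (rule pot_bound[OF L(9) L(11) S(3) S(4)])
    then show "\<forall>\<^sub>F n in sequentially. norm (pot (w n) (z n)) \<le> growth S * (sqint (w n) + sqint (z n))" by simp
  qed
  have "(\<lambda>n. 2 * (Ew n + pot (w n) (z n))) \<longlonglongrightarrow> 2 * (m0 - EU + 0)"
    by (intro tendsto_intros Ew pot0)
  moreover have "2 * (Ew n + pot (w n) (z n)) = sqint (p n) + sqint (q n)" for n
    unfolding Ew_def En_def by (simp add: field_simps)
  ultimately have kin: "(\<lambda>n. sqint (p n) + sqint (q n)) \<longlonglongrightarrow> 2 * (m0 - EU)" by simp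
  \<comment> \<open>The kinetic energy of the remainder tends to \<open>2 * (m0 - EU)\<close>. As it
    is nonnegative, \<open>EU \<le> m0\<close>; with the opposite inequality \<open>EUm\<close> the
    limit is 0, which is strong convergence of the derivatives.\<close>
  have "0 \<le> 2 * (m0 - EU)" by (rule LIMSEQ_le_const[OF kin]) auto
  then have EUeq: "EU = m0" using EUm by simp
  then have kin0: "(\<lambda>n. sqint (p n) + sqint (q n)) \<longlonglongrightarrow> 0" using kin by simp
  have p0: "(\<lambda>n. sqint (p n)) \<longlonglongrightarrow> 0"
    by (rule tendsto_sandwich[OF _ _ tendsto_const kin0]) auto
  have q0: "(\<lambda>n. sqint (q n)) \<longlonglongrightarrow> 0"
    by (rule tendsto_sandwich[OF _ _ tendsto_const kin0]) auto
  show ?thesis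
    by (rule that[OF U V mU mV EUeq[unfolded EU_def] w0[unfolded w_def] z0[unfolded z_def] p0[unfolded p_def] q0[unfolded q_def]])
qed

text \<open>Each late pair is recentred at a point where one component exceeds a fixed
  \<open>s\<close>, so the pointwise limit is nonzero at 0. Coercivity bounds the derivatives and
  thereby provides the limit.\<close>

theorem minimizing_sequence_compact:
  assumes b: "b\<^sub>1 > 0" "b\<^sub>2 > 0"
    and lower: "\<And>u g v k. AC u g \<Longrightarrow> AC v k \<Longrightarrow> sqint u = b\<^sub>1\<^sup>2 \<Longrightarrow> sqint v = b\<^sub>2\<^sup>2 \<Longrightarrow> m0 \<le> En u g v k"
    and u: "\<And>n. AC (u n) (g n)" and v: "\<And>n. AC (v n) (k n)"
    and mass: "\<And>n. sqint (u n) = b\<^sub>1\<^sup>2" "\<And>n. sqint (v n) = b\<^sub>2\<^sup>2"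
    and En: "(\<lambda>n. En (u n) (g n) (v n) (k n)) \<longlonglongrightarrow> m0"
  obtains r y U V g' k' where "strict_mono (r :: nat \<Rightarrow> nat)"
    "AC U g'" "AC V k'" "sqint U = b\<^sub>1\<^sup>2" "sqint V = b\<^sub>2\<^sup>2" "En U g' V k' = m0"
    "(\<lambda>n. sqint (\<lambda>x. u (r n) (x + y n) - U x)) \<longlonglongrightarrow> 0"
    "(\<lambda>n. sqint (\<lambda>x. v (r n) (x + y n) - V x)) \<longlonglongrightarrow> 0"
    "(\<lambda>n. sqint (\<lambda>x. g (r n) (x + y n) - g' x)) \<longlonglongrightarrow> 0"
    "(\<lambda>n. sqint (\<lambda>x. k (r n) (x + y n) - k' x)) \<longlonglongrightarrow> 0"
proof -
  have "m0 < 0"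
  proof -
    obtain f f' h h' where f: "AC f f'" "AC h h'" "sqint f = b\<^sub>1\<^sup>2" "sqint h = b\<^sub>2\<^sup>2" "En f f' h h' < 0"
      by (rule negative_energy_exists[of "b\<^sub>1\<^sup>2" "b\<^sub>2\<^sup>2"]) (use b in \<open>auto simp: add_pos_pos\<close>)
    then show ?thesis using lower[OF f(1-4)] by linarith
  qed
  obtain C where C: "\<And>u g v k. AC u g \<Longrightarrow> AC v k \<Longrightarrow> sqint u = b\<^sub>1\<^sup>2 \<Longrightarrow> sqint v = b\<^sub>2\<^sup>2
      \<Longrightarrow> sqint g + sqint k \<le> 4 * En u g v k + C"
    by (rule En_coercive[of "b\<^sub>1\<^sup>2" "b\<^sub>2\<^sup>2"]) auto
  obtain K where K: "\<And>n. \<bar>En (u n) (g n) (v n) (k n)\<bar> \<le> K"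
    using convergent_imp_Bseq[OF convergentI[OF En]] by (auto simp: Bseq_def)
  define G where "G = 4 * K + C"
  have G: "sqint (g n) \<le> G" "sqint (k n) \<le> G" for n
    using C[OF u v mass(1) mass(2), of n n] K[of n] sqint_nonneg[of "g n"] sqint_nonneg[of "k n"]
    unfolding G_def by linarith+
  define B where "B = b\<^sub>1\<^sup>2 + b\<^sub>2\<^sup>2"
  have B0: "B > 0" using b by (simp add: B_def add_pos_pos)
  have "- m0 / (2 * B) > 0" using \<open>m0 < 0\<close> B0 by (intro divide_pos_pos) auto
  \<comment> \<open>For this \<open>s\<close>, a pair bounded by \<open>s\<close> has potential at
    most \<open>- m0 / 2\<close> and hence energy at least \<open>m0 / 2\<close>, which late members
    of the sequence undercut since \<open>m0 < 0\<close>.\<close>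
  then obtain s where s: "s > 0" "growth s < - m0 / (2 * B)" by (rule growth_small)
  have "\<forall>\<^sub>F n in sequentially. En (u n) (g n) (v n) (k n) < m0 / 2"
    using \<open>m0 < 0\<close> by (intro order_tendstoD(2)[OF En]) simp
  then have "\<forall>\<^sub>F n in sequentially. \<exists>y. \<bar>u n y\<bar> > s \<or> \<bar>v n y\<bar> > s"
  proof eventually_elim
    case (elim n)
    show ?case
    proof (rule ccontr)
      assume "\<not> (\<exists>y. \<bar>u n y\<bar> > s \<or> \<bar>v n y\<bar> > s)"
      then have "\<bar>u n y\<bar> \<le> s" "\<bar>v n y\<bar> \<le> s" for y by (auto simp: not_less)
      then have "\<bar>pot (u n) (v n)\<bar> \<le> growth s * (sqint (u n) + sqint (v n))"
        by (intro pot_bound AC_L2(1)[OF u] AC_L2(1)[OF v])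
      also have "\<dots> = growth s * B" by (simp add: mass B_def)
      also have "\<dots> \<le> - m0 / (2 * B) * B" using s(2) B0 by (intro mult_right_mono) auto
      also have "\<dots> = - m0 / 2" using B0 by simp
      finally have "pot (u n) (v n) \<le> - m0 / 2" by linarith
      moreover have "- pot (u n) (v n) \<le> En (u n) (g n) (v n) (k n)"
        unfolding En_def by simp
      ultimately show False using elim by linarith
    qed
  qed
  then obtain N where N: "\<And>n. n \<ge> N \<Longrightarrow> \<exists>y. \<bar>u n y\<bar> > s \<or> \<bar>v n y\<bar> > s"
    by (auto simp: eventually_sequentially)
  then have "\<forall>n. \<exists>y. n \<ge> N \<longrightarrow> \<bar>u n y\<bar> > s \<or> \<bar>v n y\<bar> > s" by blast
  from choice[OF this] obtain y where "\<forall>n. n \<ge> N \<longrightarrow> \<bar>u n (y n)\<bar> > s \<or> \<bar>v n (y n)\<bar> > s" ..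
  then have y: "\<And>n. n \<ge> N \<Longrightarrow> \<bar>u n (y n)\<bar> > s \<or> \<bar>v n (y n)\<bar> > s" by blast
  define u' where "u' = (\<lambda>n x. u n (x + y n))"
  define v' where "v' = (\<lambda>n x. v n (x + y n))"
  define gg where "gg = (\<lambda>n x. g n (x + y n))"
  define kk where "kk = (\<lambda>n x. k n (x + y n))"
  have u': "AC (u' n) (gg n)" and v': "AC (v' n) (kk n)" for n
    unfolding u'_def v'_def gg_def kk_def by (intro AC_translate u v)+
  have mass': "sqint (u' n) = b\<^sub>1\<^sup>2" "sqint (v' n) = b\<^sub>2\<^sup>2" for n
    unfolding u'_def v'_def sqint_translate by (rule mass)+
  have G': "sqint (gg n) \<le> G" "sqint (kk n) \<le> G" for n
    unfolding gg_def kk_def sqint_translate by (rule G)+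
  define S where "S = sqrt (2 * B + 2 * G)"
  have S: "\<bar>u' n x\<bar> \<le> S" "\<bar>v' n x\<bar> \<le> S" for n x
    using order_trans[OF AC_abs_bound[OF u' zero_less_one, of n x], of S]
      order_trans[OF AC_abs_bound[OF v' zero_less_one, of n x], of S] G'[of n]
      zero_le_power2[of b\<^sub>1] zero_le_power2[of b\<^sub>2]
    unfolding S_def mass' B_def real_sqrt_le_iff by argo+
  obtain r U V where r: "strict_mono (r :: nat \<Rightarrow> nat)" and lim: "\<And>x. (\<lambda>n. u' (r n) x) \<longlonglongrightarrow> U x"
    "\<And>x. (\<lambda>n. v' (r n) x) \<longlonglongrightarrow> V x"
    by (rule AC_pair_subsequence[of u' gg v' kk G S, OF u' v' G' S]) (rule that)
  \<comment> \<open>Which component is large may change with \<open>n\<close>; the sum of squares is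
    bounded below in either case.\<close>
  have "s\<^sup>2 \<le> (U 0)\<^sup>2 + (V 0)\<^sup>2"
  proof (rule LIMSEQ_le_const)
    show "(\<lambda>n. (u' (r n) 0)\<^sup>2 + (v' (r n) 0)\<^sup>2) \<longlonglongrightarrow> (U 0)\<^sup>2 + (V 0)\<^sup>2" by (intro tendsto_intros lim)
    have "s\<^sup>2 \<le> (u' (r n) 0)\<^sup>2 + (v' (r n) 0)\<^sup>2" if "n \<ge> N" for n
    proof -
      have "r n \<ge> N" using that seq_suble[OF r, of n] by simp
      from y[OF this] show ?thesis
      proof
        assume "s < \<bar>u (r n) (y (r n))\<bar>"
        then have "s\<^sup>2 \<le> \<bar>u (r n) (y (r n))\<bar>\<^sup>2" using s(1) by (intro power_mono) auto
        then show ?thesis by (simp add: u'_def add_increasing2)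
      next
        assume "s < \<bar>v (r n) (y (r n))\<bar>"
        then have "s\<^sup>2 \<le> \<bar>v (r n) (y (r n))\<bar>\<^sup>2" using s(1) by (intro power_mono) auto
        then show ?thesis by (simp add: v'_def add_increasing)
      qed
    qed
    then show "\<exists>N. \<forall>n\<ge>N. s\<^sup>2 \<le> (u' (r n) 0)\<^sup>2 + (v' (r n) 0)\<^sup>2" by blast
  qed
  moreover have "s\<^sup>2 > 0" using s(1) by simp
  ultimately have nz: "U 0 \<noteq> 0 \<or> V 0 \<noteq> 0" by auto
  have "(\<lambda>n. En (u' n) (gg n) (v' n) (kk n)) \<longlonglongrightarrow> m0"
    using En unfolding u'_def v'_def gg_def kk_def En_translate .
  then have En': "(\<lambda>n. En (u' (r n)) (gg (r n)) (v' (r n)) (kk (r n))) \<longlonglongrightarrow> m0"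
    using LIMSEQ_subseq_LIMSEQ[OF _ r, unfolded o_def] by fast
  obtain g' k' where res: "AC U g'" "AC V k'" "sqint U = b\<^sub>1\<^sup>2" "sqint V = b\<^sub>2\<^sup>2" "En U g' V k' = m0"
    "(\<lambda>n. sqint (\<lambda>x. u' (r n) x - U x)) \<longlonglongrightarrow> 0" "(\<lambda>n. sqint (\<lambda>x. v' (r n) x - V x)) \<longlonglongrightarrow> 0"
    "(\<lambda>n. sqint (\<lambda>x. gg (r n) x - g' x)) \<longlonglongrightarrow> 0" "(\<lambda>n. sqint (\<lambda>x. kk (r n) x - k' x)) \<longlonglongrightarrow> 0"
    by (rule minimizing_weak_limit_is_strong[OF b lower u' v' mass' G' En' lim nz])
  show ?thesis
    by (rule that[OF r res(1-5), of "\<lambda>n. y (r n)"]) (use res(6-9) in \<open>simp_all only: u'_def v'_def gg_def kk_def\<close>)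
qed

end

section \<open>The Euler--Lagrange equations\<close>

text \<open>\<open>a\<close>, \<open>P\<close> and \<open>l\<close> collect the terms of the energy that are homogeneous of degree 2, 4 and 1
  in the varied component, and \<open>N\<close> is its mass divided by the prescribed mass.\<close>

lemma constrained_stationarity:
  fixes a P l N :: "real \<Rightarrow> real"
  assumes D: "(a has_real_derivative a') (at 0)" "(P has_real_derivative P') (at 0)"
    "(l has_real_derivative l') (at 0)" "(N has_real_derivative N') (at 0)"
    and N0: "N 0 = 1"
    and min: "\<And>t. N t > 0 \<Longrightarrow> a 0 - P 0 - l 0 \<le> a t / N t - P t / (N t)\<^sup>2 - l t / sqrt (N t)"
  shows "a' - P' - l' = N' * (a 0 - 2 * P 0 - l 0 / 2)"
proof -
  \<comment> \<open>The powers of \<open>N t\<close> are those produced by dividing the varied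
    component by \<open>sqrt (N t)\<close>, which restores its prescribed mass.\<close>
  define F where "F = (\<lambda>t. a t / N t - P t / (N t)\<^sup>2 - l t / sqrt (N t))"
  have S: "((\<lambda>t. sqrt (N t)) has_real_derivative N' / 2) (at 0)"
    using DERIV_chain2[OF DERIV_real_sqrt[of "N 0"] D(4)] N0 by simp
  have "(F has_real_derivative ((a' * N 0 - a 0 * N') / (N 0 * N 0)
      - (P' * (N 0)\<^sup>2 - P 0 * (real 2 * (N' * N 0 ^ (2 - Suc 0)))) / ((N 0)\<^sup>2 * (N 0)\<^sup>2)
      - (l' * sqrt (N 0) - l 0 * (N' / 2)) / (sqrt (N 0) * sqrt (N 0)))) (at 0)"
    unfolding F_def using N0 by (intro DERIV_diff DERIV_divide DERIV_power D S) auto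
  then have F': "(F has_real_derivative (a' - a 0 * N' - (P' - P 0 * (2 * N')) - (l' - l 0 * (N' / 2)))) (at 0)"
    by (simp add: N0)
  have "isCont N 0" using D(4) by (rule DERIV_isCont)
  then have "\<forall>\<^sub>F t in at 0. N t > 0" unfolding isCont_def using N0 by (intro order_tendstoD(1)) auto
  then obtain d where d: "d > 0" "\<And>t. t \<noteq> 0 \<Longrightarrow> dist t 0 < d \<Longrightarrow> N t > 0"
    unfolding eventually_at by auto
  have "F 0 \<le> F t" if "\<bar>0 - t\<bar> < d" for t
  proof -
    have "N t > 0" using d(2)[of t] that N0 by (cases "t = 0") auto
    then show ?thesis using min[of t] by (simp add: F_def N0)
  qed
  then have "a' - a 0 * N' - (P' - P 0 * (2 * N')) - (l' - l 0 * (N' / 2)) = 0"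
    using DERIV_local_min[OF F' d(1)] by blast
  then show ?thesis by (simp add: algebra_simps)
qed

text \<open>Along a line \<open>u + t * \<phi>\<close> each integral in the energy is a polynomial
  in \<open>t\<close> of degree at most 4, so no differentiation under the integral sign is
  involved. Lower degrees are padded with zero coefficients.\<close>

lemma DERIV_poly4:
  fixes c0 c1 c2 c3 c4 :: real
  shows "((\<lambda>t. c0 + t * c1 + t\<^sup>2 * c2 + t ^ 3 * c3 + t ^ 4 * c4) has_real_derivative c1) (at 0)"
  by (auto intro!: derivative_eq_intros)

lemma DERIV_integral_square:
  assumes i: "integrable lborel (\<lambda>x. (u x)\<^sup>2 * w x)" "integrable lborel (\<lambda>x. u x * \<phi> x * w x)"
    "integrable lborel (\<lambda>x. (\<phi> x)\<^sup>2 * w x)"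
  shows "((\<lambda>t. LINT x|lborel. (u x + t * \<phi> x)\<^sup>2 * w x) has_real_derivative 2 * (LINT x|lborel. u x * \<phi> x * w x)) (at 0)"
proof -
  have "(LINT x|lborel. (u x + t * \<phi> x)\<^sup>2 * w x) = (LINT x|lborel. (u x)\<^sup>2 * w x) + t * (2 * (LINT x|lborel. u x * \<phi> x * w x))
      + t\<^sup>2 * (LINT x|lborel. (\<phi> x)\<^sup>2 * w x) + t ^ 3 * 0 + t ^ 4 * 0" for t
  proof -
    have "(LINT x|lborel. (u x + t * \<phi> x)\<^sup>2 * w x)
        = (LINT x|lborel. (u x)\<^sup>2 * w x + (2 * t) * (u x * \<phi> x * w x) + t\<^sup>2 * ((\<phi> x)\<^sup>2 * w x))"
      by (intro Bochner_Integration.integral_cong) (auto simp: power2_eq_square algebra_simps)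
    also have "\<dots> = (LINT x|lborel. (u x)\<^sup>2 * w x) + (2 * t) * (LINT x|lborel. u x * \<phi> x * w x) + t\<^sup>2 * (LINT x|lborel. (\<phi> x)\<^sup>2 * w x)"
      by (simp only: Bochner_Integration.integral_add Bochner_Integration.integrable_add integrable_mult_right i integral_mult_right_zero)
    finally show ?thesis by simp
  qed
  then show ?thesis using DERIV_poly4 by presburger
qed

lemma BL2_integrable3:
  assumes "u \<in> BL2" "v \<in> BL2" "w \<in> BL2"
  shows "integrable lborel (\<lambda>x. u x * v x * w x)"
  by (rule BL2_integrable[OF BL2_mult[OF assms(1,2)] assms(3)])

lemma BL2_integrable4:
  assumes "u \<in> BL2" "v \<in> BL2" "w \<in> BL2" "z \<in> BL2"
  shows "integrable lborel (\<lambda>x. u x * v x * (w x * z x))"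
  by (rule BL2_integrable[OF BL2_mult[OF assms(1,2)] BL2_mult[OF assms(3,4)]])

lemma DERIV_integral_fourth:
  assumes u: "u \<in> BL2" and \<phi>: "\<phi> \<in> BL2"
  shows "((\<lambda>t. LINT x|lborel. (u x + t * \<phi> x) ^ 4) has_real_derivative 4 * (LINT x|lborel. (u x) ^ 3 * \<phi> x)) (at 0)"
proof -
  have i: "integrable lborel (\<lambda>x. u x ^ 4)" "integrable lborel (\<lambda>x. u x ^ 3 * \<phi> x)" "integrable lborel (\<lambda>x. (u x)\<^sup>2 * (\<phi> x)\<^sup>2)"
    "integrable lborel (\<lambda>x. u x * \<phi> x ^ 3)" "integrable lborel (\<lambda>x. \<phi> x ^ 4)"
    using BL2_integrable4[OF u u u u] BL2_integrable4[OF u u u \<phi>] BL2_integrable4[OF u u \<phi> \<phi>]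
      BL2_integrable4[OF u \<phi> \<phi> \<phi>] BL2_integrable4[OF \<phi> \<phi> \<phi> \<phi>]
    by (simp_all add: power2_eq_square power3_eq_cube power4_eq_xxxx mult.assoc)
  have "(LINT x|lborel. (u x + t * \<phi> x) ^ 4) = (LINT x|lborel. u x ^ 4) + t * (4 * (LINT x|lborel. u x ^ 3 * \<phi> x))
      + t\<^sup>2 * (6 * (LINT x|lborel. (u x)\<^sup>2 * (\<phi> x)\<^sup>2)) + t ^ 3 * (4 * (LINT x|lborel. u x * \<phi> x ^ 3)) + t ^ 4 * (LINT x|lborel. \<phi> x ^ 4)" for t
  proof -
    have "(LINT x|lborel. (u x + t * \<phi> x) ^ 4)
        = (LINT x|lborel. u x ^ 4 + (4 * t) * (u x ^ 3 * \<phi> x) + (6 * t\<^sup>2) * ((u x)\<^sup>2 * (\<phi> x)\<^sup>2) + (4 * t ^ 3) * (u x * \<phi> x ^ 3) + t ^ 4 * (\<phi> x ^ 4))"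
      by (intro Bochner_Integration.integral_cong) (auto simp: power2_eq_square power3_eq_cube power4_eq_xxxx algebra_simps)
    also have "\<dots> = (LINT x|lborel. u x ^ 4) + (4 * t) * (LINT x|lborel. u x ^ 3 * \<phi> x) + (6 * t\<^sup>2) * (LINT x|lborel. (u x)\<^sup>2 * (\<phi> x)\<^sup>2)
        + (4 * t ^ 3) * (LINT x|lborel. u x * \<phi> x ^ 3) + t ^ 4 * (LINT x|lborel. \<phi> x ^ 4)"
      by (simp only: Bochner_Integration.integral_add Bochner_Integration.integrable_add integrable_mult_right i integral_mult_right_zero)
    finally show ?thesis by simp
  qed
  then show ?thesis using DERIV_poly4 by presburger
qed

lemma DERIV_integral_linear:
  assumes "integrable lborel (\<lambda>x. w x * v x)" "integrable lborel (\<lambda>x. w x * \<phi> x)"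
  shows "((\<lambda>t. LINT x|lborel. w x * (v x + t * \<phi> x)) has_real_derivative (LINT x|lborel. w x * \<phi> x)) (at 0)"
proof -
  have "(LINT x|lborel. w x * (v x + t * \<phi> x)) = (LINT x|lborel. w x * v x) + t * (LINT x|lborel. w x * \<phi> x)
      + t\<^sup>2 * 0 + t ^ 3 * 0 + t ^ 4 * 0" for t
  proof -
    have "(LINT x|lborel. w x * (v x + t * \<phi> x)) = (LINT x|lborel. w x * v x + t * (w x * \<phi> x))"
      by (simp add: algebra_simps)
    also have "\<dots> = (LINT x|lborel. w x * v x) + t * (LINT x|lborel. w x * \<phi> x)"
      by (simp only: Bochner_Integration.integral_add integrable_mult_right assms integral_mult_right_zero)
    finally show ?thesis by simp
  qed
  then show ?thesis using DERIV_poly4 by presburger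
qed

lemma DERIV_sqint:
  assumes "u \<in> L2" "\<phi> \<in> L2"
  shows "((\<lambda>t. sqint (\<lambda>x. u x + t * \<phi> x)) has_real_derivative 2 * (LINT x|lborel. u x * \<phi> x)) (at 0)"
  using DERIV_integral_square[of u "\<lambda>_. 1" \<phi>] L2_integrable_power2[OF assms(1)] L2_integrable_power2[OF assms(2)]
    L2_integrable_mult[OF assms] by simp

context coupled
begin

lemma pot_expand:
  assumes u: "u \<in> BL2" and v: "v \<in> BL2"
  shows "pot u v = \<mu>\<^sub>1 / 4 * (LINT x|lborel. u x ^ 4) + \<mu>\<^sub>2 / 4 * (LINT x|lborel. v x ^ 4)
    + \<rho> / 2 * (LINT x|lborel. (u x)\<^sup>2 * (v x)\<^sup>2) + \<beta> / 2 * (LINT x|lborel. (u x)\<^sup>2 * v x)"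
proof -
  have i: "integrable lborel (\<lambda>x. u x ^ 4)" "integrable lborel (\<lambda>x. v x ^ 4)" "integrable lborel (\<lambda>x. (u x)\<^sup>2 * (v x)\<^sup>2)"
    "integrable lborel (\<lambda>x. (u x)\<^sup>2 * v x)"
    using BL2_integrable4[OF u u u u] BL2_integrable4[OF v v v v] BL2_integrable4[OF u u v v] BL2_integrable3[OF u u v]
    by (simp_all add: power2_eq_square power4_eq_xxxx mult.assoc)
  show ?thesis unfolding pot_def dens_def
    by (simp only: Bochner_Integration.integral_add Bochner_Integration.integrable_add integrable_mult_right i integral_mult_right_zero)
qed

lemma BL2_scale: "u \<in> BL2 \<Longrightarrow> (\<lambda>x. c * u x) \<in> BL2"
proof -
  assume u: "u \<in> BL2"
  then obtain S where S: "\<And>x. \<bar>u x\<bar> \<le> S" by (auto simp: BL2_def)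
  have "\<bar>c * u x\<bar> \<le> \<bar>c\<bar> * S" for x unfolding abs_mult by (intro mult_left_mono S) auto
  then show ?thesis using u by (intro BL2_I L2_scale) (auto simp: BL2_def)
qed

lemma pot_scale:
  assumes u: "u \<in> BL2" and v: "v \<in> BL2"
  shows "pot (\<lambda>x. \<theta> * u x) (\<lambda>x. \<tau> * v x) = \<mu>\<^sub>1 / 4 * (\<theta> ^ 4 * (LINT x|lborel. u x ^ 4)) + \<mu>\<^sub>2 / 4 * (\<tau> ^ 4 * (LINT x|lborel. v x ^ 4))
    + \<rho> / 2 * (\<theta>\<^sup>2 * \<tau>\<^sup>2 * (LINT x|lborel. (u x)\<^sup>2 * (v x)\<^sup>2)) + \<beta> / 2 * (\<theta>\<^sup>2 * \<tau> * (LINT x|lborel. (u x)\<^sup>2 * v x))"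
proof -
  have e: "(\<theta> * u x)\<^sup>2 * (\<tau> * v x)\<^sup>2 = \<theta>\<^sup>2 * \<tau>\<^sup>2 * ((u x)\<^sup>2 * (v x)\<^sup>2)" "(\<theta> * u x)\<^sup>2 * (\<tau> * v x) = \<theta>\<^sup>2 * \<tau> * ((u x)\<^sup>2 * v x)" for x
    by (simp_all add: power_mult_distrib)
  show ?thesis
    unfolding pot_expand[OF BL2_scale[OF u] BL2_scale[OF v]] e
    by (simp only: power_mult_distrib integral_mult_right_zero)
qed

text \<open>Only \<open>u\<close> is varied, so the terms containing just \<open>v\<close> cancel
  from the comparison. The multiplier is read off from the derivative of the mass and depends on
  \<open>u\<close> and \<open>v\<close> but not on the direction \<open>\<phi>\<close>.\<close>

lemma Euler_Lagrange_first:
  assumes b: "b\<^sub>1 > 0"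
    and lower: "\<And>u g v k. AC u g \<Longrightarrow> AC v k \<Longrightarrow> sqint u = b\<^sub>1\<^sup>2 \<Longrightarrow> sqint v = b\<^sub>2\<^sup>2 \<Longrightarrow> m0 \<le> En u g v k"
    and u: "AC u g" and v: "AC v k" and mass: "sqint u = b\<^sub>1\<^sup>2" "sqint v = b\<^sub>2\<^sup>2" and E: "En u g v k = m0"
  obtains l where "\<And>\<phi> \<psi>. AC \<phi> \<psi> \<Longrightarrow> (LINT x|lborel. g x * \<psi> x) + l * (LINT x|lborel. u x * \<phi> x)
    = (LINT x|lborel. (\<beta> * u x * v x + \<mu>\<^sub>1 * (u x) ^ 3 + \<rho> * (v x)\<^sup>2 * u x) * \<phi> x)"
proof -
  note Bu = AC_BL2[OF u] and Bv = AC_BL2[OF v]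
  \<comment> \<open>Both the coupling and the cubic term are quadratic in \<open>u\<close>, hence
    belong to the part of degree 2; the part of degree 1 is 0.\<close>
  define A where "A = sqint g / 2 - \<rho> / 2 * (LINT x|lborel. (u x)\<^sup>2 * (v x)\<^sup>2) - \<beta> / 2 * (LINT x|lborel. (u x)\<^sup>2 * v x)"
  define Q where "Q = \<mu>\<^sub>1 / 4 * (LINT x|lborel. u x ^ 4)"
  have "(LINT x|lborel. g x * \<psi> x) + (- (2 / b\<^sub>1\<^sup>2 * (A - 2 * Q))) * (LINT x|lborel. u x * \<phi> x)
    = (LINT x|lborel. (\<beta> * u x * v x + \<mu>\<^sub>1 * (u x) ^ 3 + \<rho> * (v x)\<^sup>2 * u x) * \<phi> x)" if \<phi>: "AC \<phi> \<psi>" for \<phi> \<psi>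
  proof -
    note B\<phi> = AC_BL2[OF \<phi>]
    define U where "U = (\<lambda>t x. u x + t * \<phi> x)"
    define U' where "U' = (\<lambda>t x. g x + t * \<psi> x)"
    have ac: "AC (U t) (U' t)" for t unfolding U_def U'_def by (rule AC_linear[OF u \<phi>])
    note BU = AC_BL2[OF ac]
    define a where "a = (\<lambda>t. sqint (U' t) / 2 - \<rho> / 2 * (LINT x|lborel. (U t x)\<^sup>2 * (v x)\<^sup>2) - \<beta> / 2 * (LINT x|lborel. (U t x)\<^sup>2 * v x))"
    define P where "P = (\<lambda>t. \<mu>\<^sub>1 / 4 * (LINT x|lborel. (U t x) ^ 4))"
    define N where "N = (\<lambda>t. sqint (U t) / b\<^sub>1\<^sup>2)"
    have "(a has_real_derivative (2 * (LINT x|lborel. g x * \<psi> x)) / 2 - \<rho> / 2 * (2 * (LINT x|lborel. u x * \<phi> x * (v x)\<^sup>2))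
        - \<beta> / 2 * (2 * (LINT x|lborel. u x * \<phi> x * v x))) (at 0)"
      unfolding a_def U_def U'_def
    proof (intro DERIV_diff DERIV_cmult DERIV_cdivide DERIV_sqint DERIV_integral_square AC_L2(2)[OF u] AC_L2(2)[OF \<phi>])
      show "integrable lborel (\<lambda>x. (u x)\<^sup>2 * (v x)\<^sup>2)" "integrable lborel (\<lambda>x. u x * \<phi> x * (v x)\<^sup>2)" "integrable lborel (\<lambda>x. (\<phi> x)\<^sup>2 * (v x)\<^sup>2)"
        by (intro BL2_integrable BL2_power2 BL2_mult Bu Bv B\<phi>)+
      show "integrable lborel (\<lambda>x. (u x)\<^sup>2 * v x)" "integrable lborel (\<lambda>x. u x * \<phi> x * v x)" "integrable lborel (\<lambda>x. (\<phi> x)\<^sup>2 * v x)"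
        by (intro BL2_integrable BL2_power2 BL2_mult Bu Bv B\<phi>)+
    qed
    then have Da: "(a has_real_derivative (LINT x|lborel. g x * \<psi> x) - \<rho> * (LINT x|lborel. u x * \<phi> x * (v x)\<^sup>2)
        - \<beta> * (LINT x|lborel. u x * \<phi> x * v x)) (at 0)" by simp
    have "(P has_real_derivative \<mu>\<^sub>1 / 4 * (4 * (LINT x|lborel. (u x) ^ 3 * \<phi> x))) (at 0)"
      unfolding P_def U_def by (intro DERIV_cmult DERIV_integral_fourth Bu B\<phi>)
    then have DP: "(P has_real_derivative \<mu>\<^sub>1 * (LINT x|lborel. (u x) ^ 3 * \<phi> x)) (at 0)" by simp
    have DN: "(N has_real_derivative 2 * (LINT x|lborel. u x * \<phi> x) / b\<^sub>1\<^sup>2) (at 0)"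
      unfolding N_def U_def by (intro DERIV_cdivide DERIV_sqint AC_L2(1)[OF u] AC_L2(1)[OF \<phi>])
    have N0: "N 0 = 1" using b by (simp add: N_def U_def mass)
    have a0: "a 0 = A" and P0: "P 0 = Q" by (simp_all add: a_def P_def A_def Q_def U_def U'_def)
    have min: "a 0 - P 0 - 0 \<le> a t / N t - P t / (N t)\<^sup>2 - 0 / sqrt (N t)" if Nt: "N t > 0" for t
    proof -
      define \<theta> where "\<theta> = 1 / sqrt (N t)"
      have th2: "\<theta>\<^sup>2 = 1 / N t" and th4: "\<theta> ^ 4 = 1 / (N t)\<^sup>2"
      proof -
        show "\<theta>\<^sup>2 = 1 / N t" unfolding \<theta>_def using Nt by (simp add: power_divide)
        then have "(\<theta>\<^sup>2)\<^sup>2 = (1 / N t)\<^sup>2" by simp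
        then show "\<theta> ^ 4 = 1 / (N t)\<^sup>2" by (simp add: power_divide flip: power_mult)
      qed
      have "sqint (\<lambda>x. \<theta> * U t x) = b\<^sub>1\<^sup>2"
        unfolding sqint_scale th2 using Nt b by (simp add: N_def field_simps)
      then have "m0 \<le> En (\<lambda>x. \<theta> * U t x) (\<lambda>x. \<theta> * U' t x) v k"
        by (intro lower AC_scale ac v mass)
      also have "\<dots> = a t / N t - P t / (N t)\<^sup>2 + (sqint k / 2 - \<mu>\<^sub>2 / 4 * (LINT x|lborel. v x ^ 4))"
        using pot_scale[OF BU[of t] Bv, of \<theta> 1] unfolding En_def sqint_scale th2 th4 a_def P_def
        by (simp add: diff_divide_distrib add_divide_distrib algebra_simps)
      finally have 1: "m0 \<le> a t / N t - P t / (N t)\<^sup>2 + (sqint k / 2 - \<mu>\<^sub>2 / 4 * (LINT x|lborel. v x ^ 4))" .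
      have "m0 = a 0 - P 0 + (sqint k / 2 - \<mu>\<^sub>2 / 4 * (LINT x|lborel. v x ^ 4))"
        using pot_expand[OF Bu Bv] E unfolding En_def a0 P0 A_def Q_def by (simp add: field_simps)
      then show ?thesis using 1 by simp
    qed
    have "(LINT x|lborel. g x * \<psi> x) - \<rho> * (LINT x|lborel. u x * \<phi> x * (v x)\<^sup>2)
        - \<beta> * (LINT x|lborel. u x * \<phi> x * v x) - \<mu>\<^sub>1 * (LINT x|lborel. (u x) ^ 3 * \<phi> x) - 0
      = 2 * (LINT x|lborel. u x * \<phi> x) / b\<^sub>1\<^sup>2 * (a 0 - 2 * P 0 - 0 / 2)"
      by (rule constrained_stationarity[OF Da DP DERIV_const DN N0 min])
    moreover have "(LINT x|lborel. (\<beta> * u x * v x + \<mu>\<^sub>1 * (u x) ^ 3 + \<rho> * (v x)\<^sup>2 * u x) * \<phi> x)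
      = \<beta> * (LINT x|lborel. u x * \<phi> x * v x) + \<mu>\<^sub>1 * (LINT x|lborel. (u x) ^ 3 * \<phi> x) + \<rho> * (LINT x|lborel. u x * \<phi> x * (v x)\<^sup>2)"
    proof -
      have i: "integrable lborel (\<lambda>x. u x * \<phi> x * v x)" "integrable lborel (\<lambda>x. (u x) ^ 3 * \<phi> x)" "integrable lborel (\<lambda>x. u x * \<phi> x * (v x)\<^sup>2)"
        using BL2_integrable3[OF Bu B\<phi> Bv] BL2_integrable4[OF Bu Bu Bu B\<phi>] BL2_integrable4[OF Bu B\<phi> Bv Bv]
        by (simp_all add: power2_eq_square power3_eq_cube mult.assoc)
      have "(LINT x|lborel. (\<beta> * u x * v x + \<mu>\<^sub>1 * (u x) ^ 3 + \<rho> * (v x)\<^sup>2 * u x) * \<phi> x)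
        = (LINT x|lborel. \<beta> * (u x * \<phi> x * v x) + \<mu>\<^sub>1 * ((u x) ^ 3 * \<phi> x) + \<rho> * (u x * \<phi> x * (v x)\<^sup>2))"
        by (intro Bochner_Integration.integral_cong) (auto simp: algebra_simps)
      then show ?thesis
        by (simp only: Bochner_Integration.integral_add Bochner_Integration.integrable_add integrable_mult_right i integral_mult_right_zero)
    qed
    ultimately show ?thesis unfolding a0 P0 by (simp add: field_simps)
  qed
  then show ?thesis by (rule that)
qed

text \<open>As for \<open>u\<close>, except that the cubic term is now of degree 1 in the varied
  component and scales with the first power of the normalising factor.\<close>

lemma Euler_Lagrange_second:
  assumes b: "b\<^sub>2 > 0"
    and lower: "\<And>u g v k. AC u g \<Longrightarrow> AC v k \<Longrightarrow> sqint u = b\<^sub>1\<^sup>2 \<Longrightarrow> sqint v = b\<^sub>2\<^sup>2 \<Longrightarrow> m0 \<le> En u g v k"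
    and u: "AC u g" and v: "AC v k" and mass: "sqint u = b\<^sub>1\<^sup>2" "sqint v = b\<^sub>2\<^sup>2" and E: "En u g v k = m0"
  obtains l where "\<And>\<phi> \<psi>. AC \<phi> \<psi> \<Longrightarrow> (LINT x|lborel. k x * \<psi> x) + l * (LINT x|lborel. v x * \<phi> x)
    = (LINT x|lborel. (\<beta> / 2 * (u x)\<^sup>2 + \<mu>\<^sub>2 * (v x) ^ 3 + \<rho> * (u x)\<^sup>2 * v x) * \<phi> x)"
proof -
  note Bu = AC_BL2[OF u] and Bv = AC_BL2[OF v]
  define A where "A = sqint k / 2 - \<rho> / 2 * (LINT x|lborel. (v x)\<^sup>2 * (u x)\<^sup>2)"
  define Q where "Q = \<mu>\<^sub>2 / 4 * (LINT x|lborel. v x ^ 4)"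
  \<comment> \<open>The part of degree 1; it enters the multiplier with weight \<open>1 / 2\<close>,
    the derivative of the square root at 1.\<close>
  define C where "C = \<beta> / 2 * (LINT x|lborel. (u x)\<^sup>2 * v x)"
  have "(LINT x|lborel. k x * \<psi> x) + (- (2 / b\<^sub>2\<^sup>2 * (A - 2 * Q - C / 2))) * (LINT x|lborel. v x * \<phi> x)
    = (LINT x|lborel. (\<beta> / 2 * (u x)\<^sup>2 + \<mu>\<^sub>2 * (v x) ^ 3 + \<rho> * (u x)\<^sup>2 * v x) * \<phi> x)" if \<phi>: "AC \<phi> \<psi>" for \<phi> \<psi>
  proof -
    note B\<phi> = AC_BL2[OF \<phi>]
    define V where "V = (\<lambda>t x. v x + t * \<phi> x)"
    define V' where "V' = (\<lambda>t x. k x + t * \<psi> x)"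
    have ac: "AC (V t) (V' t)" for t unfolding V_def V'_def by (rule AC_linear[OF v \<phi>])
    note BV = AC_BL2[OF ac]
    define a where "a = (\<lambda>t. sqint (V' t) / 2 - \<rho> / 2 * (LINT x|lborel. (V t x)\<^sup>2 * (u x)\<^sup>2))"
    define P where "P = (\<lambda>t. \<mu>\<^sub>2 / 4 * (LINT x|lborel. (V t x) ^ 4))"
    define l where "l = (\<lambda>t. \<beta> / 2 * (LINT x|lborel. (u x)\<^sup>2 * V t x))"
    define N where "N = (\<lambda>t. sqint (V t) / b\<^sub>2\<^sup>2)"
    have "(a has_real_derivative (2 * (LINT x|lborel. k x * \<psi> x)) / 2 - \<rho> / 2 * (2 * (LINT x|lborel. v x * \<phi> x * (u x)\<^sup>2))) (at 0)"
      unfolding a_def V_def V'_def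
    proof (intro DERIV_diff DERIV_cmult DERIV_cdivide DERIV_sqint DERIV_integral_square AC_L2(2)[OF v] AC_L2(2)[OF \<phi>])
      show "integrable lborel (\<lambda>x. (v x)\<^sup>2 * (u x)\<^sup>2)" "integrable lborel (\<lambda>x. v x * \<phi> x * (u x)\<^sup>2)" "integrable lborel (\<lambda>x. (\<phi> x)\<^sup>2 * (u x)\<^sup>2)"
        by (intro BL2_integrable BL2_power2 BL2_mult Bu Bv B\<phi>)+
    qed
    then have Da: "(a has_real_derivative (LINT x|lborel. k x * \<psi> x) - \<rho> * (LINT x|lborel. v x * \<phi> x * (u x)\<^sup>2)) (at 0)" by simp
    have "(P has_real_derivative \<mu>\<^sub>2 / 4 * (4 * (LINT x|lborel. (v x) ^ 3 * \<phi> x))) (at 0)"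
      unfolding P_def V_def by (intro DERIV_cmult DERIV_integral_fourth Bv B\<phi>)
    then have DP: "(P has_real_derivative \<mu>\<^sub>2 * (LINT x|lborel. (v x) ^ 3 * \<phi> x)) (at 0)" by simp
    have Dl: "(l has_real_derivative \<beta> / 2 * (LINT x|lborel. (u x)\<^sup>2 * \<phi> x)) (at 0)"
      unfolding l_def V_def by (intro DERIV_cmult DERIV_integral_linear BL2_integrable BL2_power2 Bu Bv B\<phi>)
    have DN: "(N has_real_derivative 2 * (LINT x|lborel. v x * \<phi> x) / b\<^sub>2\<^sup>2) (at 0)"
      unfolding N_def V_def by (intro DERIV_cdivide DERIV_sqint AC_L2(1)[OF v] AC_L2(1)[OF \<phi>])
    have N0: "N 0 = 1" using b by (simp add: N_def V_def mass)
    have a0: "a 0 = A" and P0: "P 0 = Q" and l0: "l 0 = C"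
      by (simp_all add: a_def P_def l_def A_def Q_def C_def V_def V'_def)
    have min: "a 0 - P 0 - l 0 \<le> a t / N t - P t / (N t)\<^sup>2 - l t / sqrt (N t)" if Nt: "N t > 0" for t
    proof -
      define \<theta> where "\<theta> = 1 / sqrt (N t)"
      have th2: "\<theta>\<^sup>2 = 1 / N t" and th4: "\<theta> ^ 4 = 1 / (N t)\<^sup>2"
      proof -
        show "\<theta>\<^sup>2 = 1 / N t" unfolding \<theta>_def using Nt by (simp add: power_divide)
        then have "(\<theta>\<^sup>2)\<^sup>2 = (1 / N t)\<^sup>2" by simp
        then show "\<theta> ^ 4 = 1 / (N t)\<^sup>2" by (simp add: power_divide flip: power_mult)
      qed
      have "sqint (\<lambda>x. \<theta> * V t x) = b\<^sub>2\<^sup>2"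
        unfolding sqint_scale th2 using Nt b by (simp add: N_def field_simps)
      then have "m0 \<le> En u g (\<lambda>x. \<theta> * V t x) (\<lambda>x. \<theta> * V' t x)"
        by (intro lower AC_scale ac u mass)
      also have "\<dots> = a t / N t - P t / (N t)\<^sup>2 - \<theta> * l t + (sqint g / 2 - \<mu>\<^sub>1 / 4 * (LINT x|lborel. u x ^ 4))"
        using pot_scale[OF Bu BV[of t], of 1 \<theta>] unfolding En_def sqint_scale th2 th4 a_def P_def l_def
        by (simp add: diff_divide_distrib add_divide_distrib algebra_simps)
      finally have 1: "m0 \<le> a t / N t - P t / (N t)\<^sup>2 - \<theta> * l t + (sqint g / 2 - \<mu>\<^sub>1 / 4 * (LINT x|lborel. u x ^ 4))" .
      have "m0 = a 0 - P 0 - l 0 + (sqint g / 2 - \<mu>\<^sub>1 / 4 * (LINT x|lborel. u x ^ 4))"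
        using pot_expand[OF Bu Bv] E unfolding En_def a0 P0 l0 A_def Q_def C_def by (simp add: field_simps)
      then show ?thesis using 1 by (simp add: \<theta>_def)
    qed
    have "(LINT x|lborel. k x * \<psi> x) - \<rho> * (LINT x|lborel. v x * \<phi> x * (u x)\<^sup>2)
        - \<mu>\<^sub>2 * (LINT x|lborel. (v x) ^ 3 * \<phi> x) - \<beta> / 2 * (LINT x|lborel. (u x)\<^sup>2 * \<phi> x)
      = 2 * (LINT x|lborel. v x * \<phi> x) / b\<^sub>2\<^sup>2 * (a 0 - 2 * P 0 - l 0 / 2)"
      by (rule constrained_stationarity[OF Da DP Dl DN N0 min])
    moreover have "(LINT x|lborel. (\<beta> / 2 * (u x)\<^sup>2 + \<mu>\<^sub>2 * (v x) ^ 3 + \<rho> * (u x)\<^sup>2 * v x) * \<phi> x)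
      = \<beta> / 2 * (LINT x|lborel. (u x)\<^sup>2 * \<phi> x) + \<mu>\<^sub>2 * (LINT x|lborel. (v x) ^ 3 * \<phi> x) + \<rho> * (LINT x|lborel. v x * \<phi> x * (u x)\<^sup>2)"
    proof -
      have i: "integrable lborel (\<lambda>x. (u x)\<^sup>2 * \<phi> x)" "integrable lborel (\<lambda>x. (v x) ^ 3 * \<phi> x)" "integrable lborel (\<lambda>x. v x * \<phi> x * (u x)\<^sup>2)"
        using BL2_integrable3[OF Bu Bu B\<phi>] BL2_integrable4[OF Bv Bv Bv B\<phi>] BL2_integrable4[OF Bv B\<phi> Bu Bu]
        by (simp_all add: power2_eq_square power3_eq_cube mult.assoc)
      have "(LINT x|lborel. (\<beta> / 2 * (u x)\<^sup>2 + \<mu>\<^sub>2 * (v x) ^ 3 + \<rho> * (u x)\<^sup>2 * v x) * \<phi> x)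
        = (LINT x|lborel. \<beta> / 2 * ((u x)\<^sup>2 * \<phi> x) + \<mu>\<^sub>2 * ((v x) ^ 3 * \<phi> x) + \<rho> * (v x * \<phi> x * (u x)\<^sup>2))"
        by (intro Bochner_Integration.integral_cong) (auto simp: algebra_simps)
      then show ?thesis
        by (simp only: Bochner_Integration.integral_add Bochner_Integration.integrable_add integrable_mult_right i integral_mult_right_zero)
    qed
    ultimately show ?thesis unfolding a0 P0 l0 by (simp add: field_simps)
  qed
  then show ?thesis by (rule that)
qed

end

section \<open>Transfer to \<open>H1\<close>\<close>

lemma T_imp_AC:
  assumes "u \<in> T b"
  obtains U g where "AC U g" "AE x in lborel. u x = U x" "sqint U = b\<^sup>2"
proof -
  have u: "u \<in> H1" "sqint u = b\<^sup>2" using assms by (auto simp: T_def)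
  obtain U g where U: "AC U g" "AE x in lborel. u x = U x" by (rule H1_imp_AC[OF u(1)])
  have "u \<in> L2" using u(1) by (simp add: H1_def)
  then have "sqint U = sqint u"
    using U(2) by (intro sqint_cong_AE[symmetric] L2_measurable AC_L2(1)[OF U(1)])
  then show ?thesis using U u(2) by (intro that) auto
qed

lemma T_measurable: "u \<in> T b \<Longrightarrow> u \<in> borel_measurable borel"
  by (simp add: T_def H1_def L2_measurable)

lemma AC_imp_T: "AC u g \<Longrightarrow> sqint u = b\<^sup>2 \<Longrightarrow> u \<in> T b"
  by (simp add: T_def AC_imp_H1)

text \<open>Both integrals ignore null sets, so the choice made by \<open>grad\<close> is immaterial
  and the norm can be computed from any \<open>AC\<close> representative.\<close>

lemma H1_norm_AE_AC:
  assumes "AC u g" "v \<in> borel_measurable borel" "AE x in lborel. v x = u x"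
  shows "H1_norm v = sqrt (sqint u + sqint g)"
proof -
  have g: "grad v \<in> L2" by (rule grad_properties(1)[OF AE_AC_imp_H1(1)[OF assms]])
  have "sqint v = sqint u"
    by (rule sqint_cong_AE[OF assms(2) L2_measurable[OF AC_L2(1)[OF assms(1)]] assms(3)])
  moreover have "sqint (grad v) = sqint g"
    by (rule sqint_cong_AE[OF L2_measurable[OF g] L2_measurable[OF AC_L2(2)[OF assms(1)]] AE_AC_imp_H1(2)[OF assms]])
  ultimately show ?thesis by (simp add: H1_norm_def)
qed

lemma AE_translate:
  fixes f g :: "real \<Rightarrow> real"
  assumes [measurable]: "f \<in> borel_measurable borel" "g \<in> borel_measurable borel"
    and "AE x in lborel. f x = g x"
  shows "AE x in lborel. f (x + c) = g (x + c)"
  using AE_borel_affine[of 1 "\<lambda>x. f x = g x" c] assms(3) by (simp add: add.commute)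

lemma H1_tendsto_AC:
  assumes u: "\<And>n. AC (u n) (g n)" and U: "AC U G"
    and w: "\<And>n. w n \<in> borel_measurable borel" "\<And>n. AE x in lborel. w n x = u n x"
    and lim: "(\<lambda>n. sqint (\<lambda>x. u (r n) (x + y n) - U x)) \<longlonglongrightarrow> 0"
      "(\<lambda>n. sqint (\<lambda>x. g (r n) (x + y n) - G x)) \<longlonglongrightarrow> 0"
  shows "H1_tendsto (\<lambda>n x. w (r n) (x + y n)) U"
proof -
  have um: "u n \<in> borel_measurable borel" and Um: "U \<in> borel_measurable borel" for n
    using L2_measurable[OF AC_L2(1)[OF u]] L2_measurable[OF AC_L2(1)[OF U]] by auto
  have "H1_norm (\<lambda>x. w (r n) (x + y n) - U x)
      = sqrt (sqint (\<lambda>x. u (r n) (x + y n) - U x) + sqint (\<lambda>x. g (r n) (x + y n) - G x))" for n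
  proof (rule H1_norm_AE_AC[OF AC_diff[OF AC_translate[OF u] U]])
    show "(\<lambda>x. w (r n) (x + y n) - U x) \<in> borel_measurable borel"
      using w(1)[of "r n"] Um by measurable
    show "AE x in lborel. w (r n) (x + y n) - U x = u (r n) (x + y n) - U x"
      using AE_translate[OF w(1) um w(2), of "r n" "y n"] by eventually_elim simp
  qed
  moreover have "(\<lambda>n. sqrt (sqint (\<lambda>x. u (r n) (x + y n) - U x) + sqint (\<lambda>x. g (r n) (x + y n) - G x))) \<longlonglongrightarrow> sqrt (0 + 0)"
    by (intro tendsto_intros lim)
  ultimately show ?thesis unfolding H1_tendsto_def by simp
qed

text \<open>A test element of \<open>H1\<close> may be replaced by its continuous representative,
  since every integral in the equation ignores null sets.\<close>

lemma weak_solution_AC: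
  assumes u: "AC u g" and f: "f \<in> borel_measurable borel"
    and eq: "\<And>\<phi> \<psi>. AC \<phi> \<psi> \<Longrightarrow> (LINT x|lborel. g x * \<psi> x) + l * (LINT x|lborel. u x * \<phi> x) = (LINT x|lborel. f x * \<phi> x)"
  shows "weak_solution f l u"
  unfolding weak_solution_def
proof (intro conjI ballI)
  show H: "u \<in> H1" by (rule AC_imp_H1[OF u])
  fix \<phi> assume \<phi>H: "\<phi> \<in> H1"
  obtain \<Phi> \<psi> where \<Phi>: "AC \<Phi> \<psi>" and ae: "AE x in lborel. \<phi> x = \<Phi> x" by (rule H1_imp_AC[OF \<phi>H])
  have \<phi>m[measurable]: "\<phi> \<in> borel_measurable borel" using \<phi>H by (simp add: H1_def L2_measurable)
  note [measurable] = f L2_measurable[OF AC_L2(1)[OF u]] L2_measurable[OF AC_L2(2)[OF u]]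
    L2_measurable[OF AC_L2(1)[OF \<Phi>]] L2_measurable[OF AC_L2(2)[OF \<Phi>]]
    L2_measurable[OF grad_properties(1)[OF H]] L2_measurable[OF grad_properties(1)[OF \<phi>H]]
  have gu: "AE x in lborel. grad u x = g x" by (rule AE_AC_imp_H1(2)[OF u]) auto
  have gp: "AE x in lborel. grad \<phi> x = \<psi> x" by (rule AE_AC_imp_H1(2)[OF \<Phi> \<phi>m ae])
  have "(LINT x|lborel. grad u x * grad \<phi> x) = (LINT x|lborel. g x * \<psi> x)"
    using gu gp by (intro integral_cong_AE) auto
  moreover have "(LINT x|lborel. u x * \<phi> x) = (LINT x|lborel. u x * \<Phi> x)"
    using ae by (intro integral_cong_AE) auto
  moreover have "(LINT x|lborel. f x * \<phi> x) = (LINT x|lborel. f x * \<Phi> x)"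
    using ae by (intro integral_cong_AE) auto
  ultimately show "(LINT x|lborel. grad u x * grad \<phi> x) + l * (LINT x|lborel. u x * \<phi> x) = (LINT x|lborel. f x * \<phi> x)"
    using eq[OF \<Phi>] by simp
qed

section \<open>The infimum and its minimizing sequences\<close>

context coupled
begin

lemma J_eq_En:
  assumes U: "AC U g" and V: "AC V k"
    and u: "u \<in> borel_measurable borel" "AE x in lborel. u x = U x"
    and v: "v \<in> borel_measurable borel" "AE x in lborel. v x = V x"
  shows "J \<mu>\<^sub>1 \<mu>\<^sub>2 \<rho> \<beta> u v = En U g V k"
proof -
  note L = AC_L2[OF U] AC_L2[OF V]
  note Bu = AC_BL2[OF U] and Bv = AC_BL2[OF V]
  note [measurable] = u(1) v(1) L2_measurable[OF L(1)] L2_measurable[OF L(2)] L2_measurable[OF L(3)] L2_measurable[OF L(4)]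
    L2_measurable[OF grad_properties(1)[OF AE_AC_imp_H1(1)[OF U u]]] L2_measurable[OF grad_properties(1)[OF AE_AC_imp_H1(1)[OF V v]]]
  have i: "integrable lborel (\<lambda>x. U x ^ 4)" "integrable lborel (\<lambda>x. V x ^ 4)" "integrable lborel (\<lambda>x. (U x)\<^sup>2 * (V x)\<^sup>2)"
    using BL2_integrable4[OF Bu Bu Bu Bu] BL2_integrable4[OF Bv Bv Bv Bv] BL2_integrable4[OF Bu Bu Bv Bv]
    by (simp_all add: power2_eq_square power4_eq_xxxx mult.assoc)
  have "(LINT x|lborel. \<bar>grad u x\<bar>\<^sup>2 + \<bar>grad v x\<bar>\<^sup>2) = (LINT x|lborel. (g x)\<^sup>2 + (k x)\<^sup>2)"
    using AE_AC_imp_H1(2)[OF U u] AE_AC_imp_H1(2)[OF V v] by (intro integral_cong_AE) auto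
  also have "\<dots> = sqint g + sqint k"
    by (intro Bochner_Integration.integral_add L2_integrable_power2 L)
  finally have 1: "(LINT x|lborel. \<bar>grad u x\<bar>\<^sup>2 + \<bar>grad v x\<bar>\<^sup>2) = sqint g + sqint k" .
  have "(LINT x|lborel. \<mu>\<^sub>1 * (u x) ^ 4 + \<mu>\<^sub>2 * (v x) ^ 4 + 2 * \<rho> * (u x)\<^sup>2 * (v x)\<^sup>2)
      = (LINT x|lborel. \<mu>\<^sub>1 * (U x ^ 4) + \<mu>\<^sub>2 * (V x ^ 4) + (2 * \<rho>) * ((U x)\<^sup>2 * (V x)\<^sup>2))"
    using u(2) v(2) by (intro integral_cong_AE) (auto simp: mult.assoc)
  also have "\<dots> = \<mu>\<^sub>1 * (LINT x|lborel. U x ^ 4) + \<mu>\<^sub>2 * (LINT x|lborel. V x ^ 4) + (2 * \<rho>) * (LINT x|lborel. (U x)\<^sup>2 * (V x)\<^sup>2)"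
    by (simp only: Bochner_Integration.integral_add Bochner_Integration.integrable_add integrable_mult_right i integral_mult_right_zero)
  finally have 2: "(LINT x|lborel. \<mu>\<^sub>1 * (u x) ^ 4 + \<mu>\<^sub>2 * (v x) ^ 4 + 2 * \<rho> * (u x)\<^sup>2 * (v x)\<^sup>2)
      = \<mu>\<^sub>1 * (LINT x|lborel. U x ^ 4) + \<mu>\<^sub>2 * (LINT x|lborel. V x ^ 4) + (2 * \<rho>) * (LINT x|lborel. (U x)\<^sup>2 * (V x)\<^sup>2)" .
  have 3: "(LINT x|lborel. (u x)\<^sup>2 * v x) = (LINT x|lborel. (U x)\<^sup>2 * V x)"
    using u(2) v(2) by (intro integral_cong_AE) auto
  show ?thesis unfolding J_def En_def pot_expand[OF Bu Bv] 1 2 3 by (simp add: algebra_simps)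
qed

text \<open>Coercivity and nonnegativity of the kinetic energy bound all energies below by
  \<open>- C / 4\<close>, while a spread-out bump has negative energy. This excludes both infinite
  values of the infimum.\<close>

lemma minimum_finite:
  assumes b: "b\<^sub>1 > 0" "b\<^sub>2 > 0"
  obtains m0 where "m \<mu>\<^sub>1 \<mu>\<^sub>2 \<rho> \<beta> b\<^sub>1 b\<^sub>2 = ereal m0" "m0 < 0"
    "\<And>u g v k. AC u g \<Longrightarrow> AC v k \<Longrightarrow> sqint u = b\<^sub>1\<^sup>2 \<Longrightarrow> sqint v = b\<^sub>2\<^sup>2 \<Longrightarrow> m0 \<le> En u g v k"
proof -
  let ?m = "m \<mu>\<^sub>1 \<mu>\<^sub>2 \<rho> \<beta> b\<^sub>1 b\<^sub>2"
  obtain C where C: "\<And>u g v k. AC u g \<Longrightarrow> AC v k \<Longrightarrow> sqint u = b\<^sub>1\<^sup>2 \<Longrightarrow> sqint v = b\<^sub>2\<^sup>2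
      \<Longrightarrow> sqint g + sqint k \<le> 4 * En u g v k + C"
    by (rule En_coercive[of "b\<^sub>1\<^sup>2" "b\<^sub>2\<^sup>2"]) auto
  have "ereal (- C / 4) \<le> ?m"
    unfolding m_def
  proof (rule INF_greatest)
    fix x assume "x \<in> T b\<^sub>1 \<times> T b\<^sub>2"
    then obtain u v where x: "x = (u, v)" and u: "u \<in> T b\<^sub>1" and v: "v \<in> T b\<^sub>2" by blast
    obtain U g where U: "AC U g" "AE x in lborel. u x = U x" "sqint U = b\<^sub>1\<^sup>2" by (rule T_imp_AC[OF u])
    obtain V k where V: "AC V k" "AE x in lborel. v x = V x" "sqint V = b\<^sub>2\<^sup>2" by (rule T_imp_AC[OF v])
    have "- C / 4 \<le> En U g V k"
      using C[OF U(1) V(1) U(3) V(3)] sqint_nonneg[of g] sqint_nonneg[of k] by linarith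
    then show "ereal (- C / 4) \<le> (case x of (u, v) \<Rightarrow> ereal (J \<mu>\<^sub>1 \<mu>\<^sub>2 \<rho> \<beta> u v))"
      by (simp add: x J_eq_En[OF U(1) V(1) T_measurable[OF u] U(2) T_measurable[OF v] V(2)])
  qed
  moreover have le: "?m \<le> ereal (En u g v k)"
    if "AC u g" "AC v k" "sqint u = b\<^sub>1\<^sup>2" "sqint v = b\<^sub>2\<^sup>2" for u g v k
  proof -
    have "(u, v) \<in> T b\<^sub>1 \<times> T b\<^sub>2" using that by (auto intro: AC_imp_T)
    then have "?m \<le> (case (u, v) of (u, v) \<Rightarrow> ereal (J \<mu>\<^sub>1 \<mu>\<^sub>2 \<rho> \<beta> u v))"
      unfolding m_def by (rule INF_lower)
    also have "\<dots> = ereal (En u g v k)"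
      using J_eq_En[OF that(1,2) L2_measurable[OF AC_L2(1)[OF that(1)]] _ L2_measurable[OF AC_L2(1)[OF that(2)]]] by simp
    finally show ?thesis .
  qed
  moreover obtain p p' q q' where p: "AC p p'" "AC q q'" "sqint p = b\<^sub>1\<^sup>2" "sqint q = b\<^sub>2\<^sup>2" "En p p' q q' < 0"
    by (rule negative_energy_exists[of "b\<^sub>1\<^sup>2" "b\<^sub>2\<^sup>2"]) (use b in \<open>auto simp: add_pos_pos\<close>)
  ultimately obtain m0 where m0: "?m = ereal m0"
    by (cases ?m) fastforce+
  then have lower: "m0 \<le> En u g v k" if "AC u g" "AC v k" "sqint u = b\<^sub>1\<^sup>2" "sqint v = b\<^sub>2\<^sup>2" for u g v k
    using le[OF that] by simp
  then have "m0 < 0" using p by (meson le_less_trans)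
  then show ?thesis using m0 lower by (intro that)
qed

text \<open>Passing to continuous representatives for each index turns the problem into one about
  \<open>AC\<close> pairs. Convergence of the functions and of their derivatives in
  \<open>L2\<close> is then convergence in \<open>H1\<close>, and minimality of the limit yields
  both equations.\<close>

lemma minimizing_sequence_converges:
  assumes b: "b\<^sub>1 > 0" "b\<^sub>2 > 0" and min: "minimizing_sequence \<mu>\<^sub>1 \<mu>\<^sub>2 \<rho> \<beta> b\<^sub>1 b\<^sub>2 U V"
  obtains r y u v where "strict_mono (r :: nat \<Rightarrow> nat)"
    "H1_tendsto (\<lambda>n x. U (r n) (x + y n)) u" "H1_tendsto (\<lambda>n x. V (r n) (x + y n)) v"
    "is_solution \<mu>\<^sub>1 \<mu>\<^sub>2 \<rho> \<beta> b\<^sub>1 b\<^sub>2 u v" "u \<in> T b\<^sub>1" "v \<in> T b\<^sub>2"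
    "ereal (J \<mu>\<^sub>1 \<mu>\<^sub>2 \<rho> \<beta> u v) = m \<mu>\<^sub>1 \<mu>\<^sub>2 \<rho> \<beta> b\<^sub>1 b\<^sub>2"
proof -
  obtain m0 where m0: "m \<mu>\<^sub>1 \<mu>\<^sub>2 \<rho> \<beta> b\<^sub>1 b\<^sub>2 = ereal m0"
    and lower: "\<And>u g v k. AC u g \<Longrightarrow> AC v k \<Longrightarrow> sqint u = b\<^sub>1\<^sup>2 \<Longrightarrow> sqint v = b\<^sub>2\<^sup>2 \<Longrightarrow> m0 \<le> En u g v k"
    by (rule minimum_finite[OF b]) (rule that)
  have UT: "U n \<in> T b\<^sub>1" and VT: "V n \<in> T b\<^sub>2" for n using min by (auto simp: minimizing_sequence_def)
  have Jlim: "(\<lambda>n. J \<mu>\<^sub>1 \<mu>\<^sub>2 \<rho> \<beta> (U n) (V n)) \<longlonglongrightarrow> m0"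
    using min by (simp add: minimizing_sequence_def m0)
  have "\<exists>p g. AC p g \<and> (AE x in lborel. U n x = p x) \<and> sqint p = b\<^sub>1\<^sup>2" for n
    by (rule T_imp_AC[OF UT[of n]]) blast
  from choice[OF allI[OF this]] obtain u where
    "\<forall>n. \<exists>g. AC (u n) g \<and> (AE x in lborel. U n x = u n x) \<and> sqint (u n) = b\<^sub>1\<^sup>2" ..
  from choice[OF this] obtain g where
    "\<forall>n. AC (u n) (g n) \<and> (AE x in lborel. U n x = u n x) \<and> sqint (u n) = b\<^sub>1\<^sup>2" ..
  then have u: "\<And>n. AC (u n) (g n)" "\<And>n. AE x in lborel. U n x = u n x" "\<And>n. sqint (u n) = b\<^sub>1\<^sup>2" by auto
  have "\<exists>p g. AC p g \<and> (AE x in lborel. V n x = p x) \<and> sqint p = b\<^sub>2\<^sup>2" for n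
    by (rule T_imp_AC[OF VT[of n]]) blast
  from choice[OF allI[OF this]] obtain v where
    "\<forall>n. \<exists>g. AC (v n) g \<and> (AE x in lborel. V n x = v n x) \<and> sqint (v n) = b\<^sub>2\<^sup>2" ..
  from choice[OF this] obtain k where
    "\<forall>n. AC (v n) (k n) \<and> (AE x in lborel. V n x = v n x) \<and> sqint (v n) = b\<^sub>2\<^sup>2" ..
  then have v: "\<And>n. AC (v n) (k n)" "\<And>n. AE x in lborel. V n x = v n x" "\<And>n. sqint (v n) = b\<^sub>2\<^sup>2" by auto
  have "J \<mu>\<^sub>1 \<mu>\<^sub>2 \<rho> \<beta> (U n) (V n) = En (u n) (g n) (v n) (k n)" for n
    by (rule J_eq_En[OF u(1) v(1) T_measurable[OF UT] u(2) T_measurable[OF VT] v(2)])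
  then have Elim: "(\<lambda>n. En (u n) (g n) (v n) (k n)) \<longlonglongrightarrow> m0" using Jlim by simp
  obtain r y u0 v0 g0 k0 where r: "strict_mono (r :: nat \<Rightarrow> nat)"
    and AC0: "AC u0 g0" "AC v0 k0" and mass: "sqint u0 = b\<^sub>1\<^sup>2" "sqint v0 = b\<^sub>2\<^sup>2" and E: "En u0 g0 v0 k0 = m0"
    and lim: "(\<lambda>n. sqint (\<lambda>x. u (r n) (x + y n) - u0 x)) \<longlonglongrightarrow> 0" "(\<lambda>n. sqint (\<lambda>x. v (r n) (x + y n) - v0 x)) \<longlonglongrightarrow> 0"
      "(\<lambda>n. sqint (\<lambda>x. g (r n) (x + y n) - g0 x)) \<longlonglongrightarrow> 0" "(\<lambda>n. sqint (\<lambda>x. k (r n) (x + y n) - k0 x)) \<longlonglongrightarrow> 0"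
    by (rule minimizing_sequence_compact[OF b lower u(1) v(1) u(3) v(3) Elim])
  have m0': "u0 \<in> borel_measurable borel" "v0 \<in> borel_measurable borel"
    by (intro L2_measurable AC_L2(1)[OF AC0(1)] AC_L2(1)[OF AC0(2)])+
  obtain l\<^sub>1 where l1: "\<And>\<phi> \<psi>. AC \<phi> \<psi> \<Longrightarrow> (LINT x|lborel. g0 x * \<psi> x) + l\<^sub>1 * (LINT x|lborel. u0 x * \<phi> x)
    = (LINT x|lborel. (\<beta> * u0 x * v0 x + \<mu>\<^sub>1 * (u0 x) ^ 3 + \<rho> * (v0 x)\<^sup>2 * u0 x) * \<phi> x)"
    by (rule Euler_Lagrange_first[OF b(1) lower AC0 mass E], assumption+) (rule that)
  obtain l\<^sub>2 where l2: "\<And>\<phi> \<psi>. AC \<phi> \<psi> \<Longrightarrow> (LINT x|lborel. k0 x * \<psi> x) + l\<^sub>2 * (LINT x|lborel. v0 x * \<phi> x)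
    = (LINT x|lborel. (\<beta> / 2 * (u0 x)\<^sup>2 + \<mu>\<^sub>2 * (v0 x) ^ 3 + \<rho> * (u0 x)\<^sup>2 * v0 x) * \<phi> x)"
    by (rule Euler_Lagrange_second[OF b(2) lower AC0 mass E], assumption+) (rule that)
  have s1: "weak_solution (\<lambda>x. \<beta> * u0 x * v0 x + \<mu>\<^sub>1 * (u0 x) ^ 3 + \<rho> * (v0 x)\<^sup>2 * u0 x) l\<^sub>1 u0"
    by (rule weak_solution_AC[OF AC0(1) _ l1]) (use m0' in measurable)
  have s2: "weak_solution (\<lambda>x. \<beta> / 2 * (u0 x)\<^sup>2 + \<mu>\<^sub>2 * (v0 x) ^ 3 + \<rho> * (u0 x)\<^sup>2 * v0 x) l\<^sub>2 v0"
    by (rule weak_solution_AC[OF AC0(2) _ l2]) (use m0' in measurable)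
  have "is_solution \<mu>\<^sub>1 \<mu>\<^sub>2 \<rho> \<beta> b\<^sub>1 b\<^sub>2 u0 v0"
    unfolding is_solution_def by (intro conjI exI[of _ l\<^sub>1] exI[of _ l\<^sub>2] s1 s2 mass)
  moreover have "ereal (J \<mu>\<^sub>1 \<mu>\<^sub>2 \<rho> \<beta> u0 v0) = m \<mu>\<^sub>1 \<mu>\<^sub>2 \<rho> \<beta> b\<^sub>1 b\<^sub>2"
    using J_eq_En[OF AC0 m0'(1) _ m0'(2)] E by (simp add: m0)
  moreover have "H1_tendsto (\<lambda>n x. U (r n) (x + y n)) u0"
    by (rule H1_tendsto_AC[where u = u and g = g, OF u(1) AC0(1) T_measurable[OF UT] u(2) lim(1,3)])
  moreover have "H1_tendsto (\<lambda>n x. V (r n) (x + y n)) v0"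
    by (rule H1_tendsto_AC[where u = v and g = k, OF v(1) AC0(2) T_measurable[OF VT] v(2) lim(2,4)])
  ultimately show ?thesis
    using that r AC_imp_T[OF AC0(1) mass(1)] AC_imp_T[OF AC0(2) mass(2)] by blast
qed

text \<open>Attainment of the infimum comes from the compactness result, which needs a sequence to
  start from.\<close>

lemma minimizing_sequence_exists:
  assumes b: "b\<^sub>1 > 0" "b\<^sub>2 > 0"
  obtains U V where "minimizing_sequence \<mu>\<^sub>1 \<mu>\<^sub>2 \<rho> \<beta> b\<^sub>1 b\<^sub>2 U V"
proof -
  obtain m0 where m0: "m \<mu>\<^sub>1 \<mu>\<^sub>2 \<rho> \<beta> b\<^sub>1 b\<^sub>2 = ereal m0"
    by (rule minimum_finite[OF b])
  have "\<exists>p. p \<in> T b\<^sub>1 \<times> T b\<^sub>2 \<and> J \<mu>\<^sub>1 \<mu>\<^sub>2 \<rho> \<beta> (fst p) (snd p) < m0 + 1 / real (Suc n)" for n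
  proof -
    have "m \<mu>\<^sub>1 \<mu>\<^sub>2 \<rho> \<beta> b\<^sub>1 b\<^sub>2 < ereal (m0 + 1 / real (Suc n))" by (simp add: m0)
    then show ?thesis unfolding m_def INF_less_iff by (auto simp: split_beta)
  qed
  from choice[OF allI[OF this]] obtain p where
    p: "\<forall>n. p n \<in> T b\<^sub>1 \<times> T b\<^sub>2 \<and> J \<mu>\<^sub>1 \<mu>\<^sub>2 \<rho> \<beta> (fst (p n)) (snd (p n)) < m0 + 1 / real (Suc n)" ..
  have "(\<lambda>n. J \<mu>\<^sub>1 \<mu>\<^sub>2 \<rho> \<beta> (fst (p n)) (snd (p n))) \<longlonglongrightarrow> m0"
  proof (rule tendsto_sandwich[OF _ _ tendsto_const])
    show "(\<lambda>n. m0 + 1 / real (Suc n)) \<longlonglongrightarrow> m0"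
      using tendsto_add[OF tendsto_const LIMSEQ_Suc[OF lim_1_over_n], of m0] by simp
    show "\<forall>\<^sub>F n in sequentially. J \<mu>\<^sub>1 \<mu>\<^sub>2 \<rho> \<beta> (fst (p n)) (snd (p n)) \<le> m0 + 1 / real (Suc n)"
      using p by (intro always_eventually allI less_imp_le) blast
    have "ereal m0 \<le> ereal (J \<mu>\<^sub>1 \<mu>\<^sub>2 \<rho> \<beta> (fst (p n)) (snd (p n)))" for n
    proof -
      have "p n \<in> T b\<^sub>1 \<times> T b\<^sub>2" using p by blast
      then have "m \<mu>\<^sub>1 \<mu>\<^sub>2 \<rho> \<beta> b\<^sub>1 b\<^sub>2 \<le> (case p n of (u, v) \<Rightarrow> ereal (J \<mu>\<^sub>1 \<mu>\<^sub>2 \<rho> \<beta> u v))"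
        unfolding m_def by (rule INF_lower)
      then show ?thesis by (simp add: m0 split_beta)
    qed
    then show "\<forall>\<^sub>F n in sequentially. m0 \<le> J \<mu>\<^sub>1 \<mu>\<^sub>2 \<rho> \<beta> (fst (p n)) (snd (p n))" by simp
  qed
  then have "minimizing_sequence \<mu>\<^sub>1 \<mu>\<^sub>2 \<rho> \<beta> b\<^sub>1 b\<^sub>2 (\<lambda>n. fst (p n)) (\<lambda>n. snd (p n))"
    using p by (auto simp: minimizing_sequence_def m0 mem_Times_iff)
  then show ?thesis by (rule that)
qed

end

text \<open>A subsequence is unavoidable: \<open>J\<close> is even in its first component, so
  alternating the sign of a minimizer's first component gives a minimizing sequence without a single
  limit up to translation.\<close>

theorem theorem1p1:
  fixes \<mu>\<^sub>1 \<mu>\<^sub>2 \<rho> \<beta> b\<^sub>1 b\<^sub>2 :: real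
  assumes "b\<^sub>1 > 0" and "b\<^sub>2 > 0"
    and "\<mu>\<^sub>1 > 0" and "\<mu>\<^sub>2 > 0" and "\<rho> > 0" and "\<beta> > 0"
  shows "- \<infinity> < m \<mu>\<^sub>1 \<mu>\<^sub>2 \<rho> \<beta> b\<^sub>1 b\<^sub>2 \<and> m \<mu>\<^sub>1 \<mu>\<^sub>2 \<rho> \<beta> b\<^sub>1 b\<^sub>2 < 0 \<and>
    (\<exists>u \<in> T b\<^sub>1. \<exists>v \<in> T b\<^sub>2. ereal (J \<mu>\<^sub>1 \<mu>\<^sub>2 \<rho> \<beta> u v) = m \<mu>\<^sub>1 \<mu>\<^sub>2 \<rho> \<beta> b\<^sub>1 b\<^sub>2) \<and>
    (\<forall>U V. minimizing_sequence \<mu>\<^sub>1 \<mu>\<^sub>2 \<rho> \<beta> b\<^sub>1 b\<^sub>2 U V \<longrightarrow>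
      (\<exists>r y u v. strict_mono (r :: nat \<Rightarrow> nat) \<and>
         H1_tendsto (\<lambda>n x. U (r n) (x + y n)) u \<and>
         H1_tendsto (\<lambda>n x. V (r n) (x + y n)) v \<and>
         is_solution \<mu>\<^sub>1 \<mu>\<^sub>2 \<rho> \<beta> b\<^sub>1 b\<^sub>2 u v))"
proof -
  interpret coupled \<mu>\<^sub>1 \<mu>\<^sub>2 \<rho> \<beta> using assms by unfold_locales
  obtain m0 where m0: "m \<mu>\<^sub>1 \<mu>\<^sub>2 \<rho> \<beta> b\<^sub>1 b\<^sub>2 = ereal m0" "m0 < 0"
    by (rule minimum_finite[OF assms(1,2)])
  obtain U V where UV: "minimizing_sequence \<mu>\<^sub>1 \<mu>\<^sub>2 \<rho> \<beta> b\<^sub>1 b\<^sub>2 U V"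
    by (rule minimizing_sequence_exists[OF assms(1,2)])
  have "\<exists>u\<in>T b\<^sub>1. \<exists>v\<in>T b\<^sub>2. ereal (J \<mu>\<^sub>1 \<mu>\<^sub>2 \<rho> \<beta> u v) = m \<mu>\<^sub>1 \<mu>\<^sub>2 \<rho> \<beta> b\<^sub>1 b\<^sub>2"
    by (rule minimizing_sequence_converges[OF assms(1,2) UV]) blast
  moreover have "\<exists>r y u v. strict_mono (r :: nat \<Rightarrow> nat) \<and>
         H1_tendsto (\<lambda>n x. U (r n) (x + y n)) u \<and>
         H1_tendsto (\<lambda>n x. V (r n) (x + y n)) v \<and>
         is_solution \<mu>\<^sub>1 \<mu>\<^sub>2 \<rho> \<beta> b\<^sub>1 b\<^sub>2 u v" if "minimizing_sequence \<mu>\<^sub>1 \<mu>\<^sub>2 \<rho> \<beta> b\<^sub>1 b\<^sub>2 U V" for U V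
    by (rule minimizing_sequence_converges[OF assms(1,2) that]) blast
  ultimately show ?thesis using m0 by simp
qed

end
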